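(* Let $N\geq 3$ be an integer and let $\rho\in L^\infty_{\rm loc}(\mathbb{R}^N)$ satisfy $\rho\geq 0$ and $\rho\not\equiv 0$. Put $\Phi(r):=\max_{|x|=r}\rho(x)$ and assume that $\int_0^\infty r^{N-1}\Phi(r)\,dr<\infty$. Let $f:(0,\infty)\to(0,\infty)$ satisfy $f\in C^{0,\alpha}_{\rm loc}(0,\infty)$ for some $0<\alpha<1$, and assume that: (i) the mapping $u\mapsto f(u)/u$ is decreasing on $(0,\infty)$ and $\lim_{u\to\infty}f(u)/u=0$; (ii) $f$ is increasing in $(0,\infty)$ and $\lim_{u\searrow 0}f(u)/u=+\infty$. Then the problem $$-\Delta u=\rho(x)f(u)\ \text{ in }\mathbb{R}^N,\qquad u>0\ \text{ in }\mathbb{R}^N,\qquad u(x)\to 0\ \text{ as }|x|\to\infty$$ has a unique classical solution.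
   Context: $|x|$ denotes the Euclidean norm on $\mathbb{R}^N$, and $\Delta$ is the Laplace operator on $\mathbb{R}^N$. $C^{0,\alpha}_{\rm loc}(0,\infty)$ is the space of functions on $(0,\infty)$ that are locally Hölder continuous with exponent $\alpha$.
   Formalization: No C² solution exists for discontinuous ρ (e.g. the indicator of a ball), so "classical solution" here means C¹, solving in distributions on R^N, and C² and pointwise on open sets where ρ is locally Hölder; "decreasing" in (i) is strict and Φ is a supremum. *)

theory Defs
  imports "HOL-Analysis.Analysis"
begin

definition partial_deriv :: "'n::finite \<Rightarrow> (real^'n \<Rightarrow> real) \<Rightarrow> real^'n \<Rightarrow> real" where
  "partial_deriv i u x = frechet_derivative u (at x) (axis i 1)"

text \<open>\<open>C_on k U u\<close> says that \<open>u\<close> is of class \<open>C\<^sup>k\<close> on \<open>U\<close>; it is meant for open \<open>U\<close> only, since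
  derivatives are taken in the full space.\<close>

primrec C_on :: "nat \<Rightarrow> (real^'n::finite) set \<Rightarrow> (real^'n \<Rightarrow> real) \<Rightarrow> bool" where
  "C_on 0 U u \<longleftrightarrow> continuous_on U u"
| "C_on (Suc k) U u \<longleftrightarrow>
     (\<forall>x\<in>U. u differentiable (at x)) \<and> (\<forall>i. C_on k U (partial_deriv i u))"

definition laplacian :: "(real^'n::finite \<Rightarrow> real) \<Rightarrow> real^'n \<Rightarrow> real" where
  "laplacian u x = (\<Sum>i\<in>UNIV. partial_deriv i (partial_deriv i u) x)"

definition test_function :: "(real^'n::finite \<Rightarrow> real) \<Rightarrow> bool" where
  "test_function \<phi> \<longleftrightarrow> (\<forall>k. C_on k UNIV \<phi>) \<and> bounded {x. \<phi> x \<noteq> 0}"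

definition locally_holder_on :: "'a::metric_space set \<Rightarrow> real \<Rightarrow> ('a \<Rightarrow> real) \<Rightarrow> bool" where
  "locally_holder_on S \<alpha> g \<longleftrightarrow>
     (\<forall>K. compact K \<and> K \<subseteq> S \<longrightarrow> (\<exists>C. \<forall>x\<in>K. \<forall>y\<in>K. \<bar>g x - g y\<bar> \<le> C * dist x y powr \<alpha>))"

text \<open>Membership in \<open>L\<^sup>\<infinity>\<^sub>l\<^sub>o\<^sub>c\<close>, for a chosen representative.\<close>

definition Linf_loc :: "(real^'n::finite \<Rightarrow> real) \<Rightarrow> bool" where
  "Linf_loc \<rho> \<longleftrightarrow> \<rho> \<in> borel_measurable lebesgue \<and>
     (\<forall>K. compact K \<longrightarrow> (\<exists>M. AE x in lebesgue. x \<in> K \<longrightarrow> \<bar>\<rho> x\<bar> \<le> M))"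

text \<open>The maximum of a nonnegative function over the sphere of radius \<open>r\<close>. It is taken as a supremum
  in \<open>[0,\<infinity>]\<close>, because a representative of an \<open>L\<^sup>\<infinity>\<^sub>l\<^sub>o\<^sub>c\<close> function need not attain a maximum, or even
  be bounded, on every single sphere.\<close>

definition sphere_max :: "(real^'n::finite \<Rightarrow> real) \<Rightarrow> real \<Rightarrow> ennreal" where
  "sphere_max \<rho> r = (SUP x\<in>sphere 0 r. ennreal (\<rho> x))"

definition C2_solution_on ::
  "(real^'n::finite) set \<Rightarrow> (real^'n \<Rightarrow> real) \<Rightarrow> (real \<Rightarrow> real) \<Rightarrow> (real^'n \<Rightarrow> real) \<Rightarrow> bool" where
  "C2_solution_on U \<rho> f u \<longleftrightarrow> C_on 2 U u \<and> (\<forall>x\<in>U. - laplacian u x = \<rho> x * f (u x))"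

definition distributional_solution ::
  "(real^'n::finite \<Rightarrow> real) \<Rightarrow> (real \<Rightarrow> real) \<Rightarrow> (real^'n \<Rightarrow> real) \<Rightarrow> bool" where
  "distributional_solution \<rho> f u \<longleftrightarrow>
     (\<forall>\<phi>. test_function \<phi> \<longrightarrow>
        - (LINT x|lebesgue. u x * laplacian \<phi> x) = (LINT x|lebesgue. \<rho> x * f (u x) * \<phi> x))"

text \<open>Classical solutions of \<open>-\<Delta>u = \<rho>(x) f(u)\<close> with \<open>\<rho>\<close> in \<open>L\<^sup>\<infinity>\<^sub>l\<^sub>o\<^sub>c\<close>. No function whose Laplacian exists
  everywhere and is continuous can solve the equation when, say, \<open>\<rho>\<close> is the indicator function of
  a ball. So the solution is asked to be \<open>C\<^sup>1\<close> and to solve the equation in the sense of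
  distributions on the whole space, and to be \<open>C\<^sup>2\<close> and to solve it pointwise on every open set
  where \<open>\<rho>\<close> is locally Hoelder continuous. The lemmas at the end relate this to the usual notion:
  every \<open>C\<^sup>2\<close> pointwise solution is a classical solution in this sense, and both notions
  coincide if \<open>\<rho>\<close> is locally Hoelder continuous.\<close>

definition classical_solution ::
  "(real^'n::finite \<Rightarrow> real) \<Rightarrow> (real \<Rightarrow> real) \<Rightarrow> (real^'n \<Rightarrow> real) \<Rightarrow> bool" where
  "classical_solution \<rho> f u \<longleftrightarrow>
     C_on 1 UNIV u \<and> distributional_solution \<rho> f u \<and>
     (\<forall>U \<beta>. open U \<and> 0 < \<beta> \<and> \<beta> < 1 \<and> locally_holder_on U \<beta> \<rho> \<longrightarrow> C2_solution_on U \<rho> f u)"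

lemma C_on_subset: "C_on k V u \<Longrightarrow> U \<subseteq> V \<Longrightarrow> C_on k U u"
  by (induction k arbitrary: u) (auto intro: continuous_on_subset)

lemma C_on_1_continuous: "C_on (Suc k) UNIV u \<Longrightarrow> continuous_on UNIV u"
  by (auto intro: differentiable_imp_continuous_on simp: differentiable_on_def)

lemma partial_deriv_eq_0:
  assumes "open S" "x \<in> S" "\<And>y. y \<in> S \<Longrightarrow> g y = (0::real)"
  shows "partial_deriv i g x = 0"
proof -
  have "(g has_derivative (\<lambda>_. 0)) (at x)"
    by (rule has_derivative_transform_within_open[of "\<lambda>_. 0" _ _ UNIV S]) (use assms in auto)
  then have "frechet_derivative g (at x) = (\<lambda>_. 0)"
    by (metis frechet_derivative_at)
  then show ?thesis by (simp add: partial_deriv_def)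
qed

lemma partial_deriv_support:
  assumes "\<And>x. norm x > R \<Longrightarrow> g x = 0" "norm x > R"
  shows "partial_deriv i g x = 0"
proof (rule partial_deriv_eq_0)
  show "open {x::real^'a. norm x > R}"
    by (intro open_Collect_less continuous_intros)
qed (use assms in auto)

lemma integrable_continuous_support:
  assumes "continuous_on UNIV g" "\<And>x. norm x > R \<Longrightarrow> g x = (0::real)"
  shows "integrable lebesgue (g :: real^'n::finite \<Rightarrow> real)"
proof -
  have "set_integrable lborel (cball 0 R) g"
    unfolding set_integrable_def
    using borel_integrable_compact[of "cball 0 R" g] continuous_on_subset[OF assms(1)] by simp
  then have "integrable lborel (\<lambda>x. indicator (cball 0 R) x *\<^sub>R g x)"
    by (simp add: set_integrable_def)
  moreover have "(\<lambda>x. indicator (cball 0 R) x *\<^sub>R g x) = g"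
    using assms(2) by (auto simp: indicator_def fun_eq_iff)
  ultimately show ?thesis
    by (metis integrable_completion borel_measurable_integrable)
qed

lemma integral_partial_deriv_0:
  fixes g :: "real^'n::finite \<Rightarrow> real"
  assumes g: "C_on 1 UNIV g" and R: "\<And>x. norm x > R \<Longrightarrow> g x = 0"
  shows "(LINT x|lebesgue. partial_deriv i g x) = 0"
proof -
  define e :: "real^'n" where "e = axis i 1"
  have e1: "norm e = 1" by (simp add: e_def)
  have cg: "continuous_on UNIV g" and cp: "continuous_on UNIV (partial_deriv i g)"
    using g C_on_1_continuous[of 0 g] by auto
  have D: "((\<lambda>t. g (x + t *\<^sub>R e)) has_real_derivative partial_deriv i g (x + t *\<^sub>R e)) (at t)" for x t
  proof -
    have "g differentiable (at (x + t *\<^sub>R e))" using g by simp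
    then have d: "(g has_derivative frechet_derivative g (at (x + t *\<^sub>R e))) (at (x + t *\<^sub>R e))"
      by (simp add: frechet_derivative_works)
    have "((\<lambda>t. g (x + t *\<^sub>R e)) has_derivative
        (\<lambda>h. frechet_derivative g (at (x + t *\<^sub>R e)) (h *\<^sub>R e))) (at t)"
      by (rule has_derivative_compose[of "\<lambda>t. x + t *\<^sub>R e", OF _ d]) (auto intro!: derivative_eq_intros)
    moreover have "(\<lambda>h. frechet_derivative g (at (x + t *\<^sub>R e)) (h *\<^sub>R e)) =
        (*) (partial_deriv i g (x + t *\<^sub>R e))"
      using has_derivative_linear[OF d] by (auto simp: linear_cmul partial_deriv_def e_def fun_eq_iff)
    ultimately show ?thesis by (simp add: has_field_derivative_def)
  qed
  obtain B where B: "\<And>x. norm x \<le> R \<Longrightarrow> \<bar>partial_deriv i g x\<bar> \<le> B"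
  proof -
    have "compact (partial_deriv i g ` cball 0 R)"
      by (intro compact_continuous_image continuous_on_subset[OF cp]) auto
    then obtain a where "\<forall>x\<in>cball 0 R. \<bar>partial_deriv i g x\<bar> \<le> a"
      by (auto dest!: compact_imp_bounded simp: bounded_iff)
    then show ?thesis by (intro that[of a]) auto
  qed
  have B': "\<bar>partial_deriv i g x\<bar> \<le> max B 0" for x
    using B[of x] partial_deriv_support[of R g x i] R by (cases "norm x \<le> R") (auto simp: not_le)
  define h where "h n = inverse (real (Suc n))" for n
  have h: "0 < h n" "h n \<le> 1" for n by (auto simp: h_def divide_simps)
  have h0: "h \<longlonglongrightarrow> 0" unfolding h_def by (rule LIMSEQ_inverse_real_of_nat)
  define q where "q n x = (g (x + h n *\<^sub>R e) - g x) / h n" for n x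
  have ig: "integrable lborel g"
    using cg R integrable_continuous_support[OF cg R]
    by (metis borel_measurable_continuous_onI integrable_completion measurable_lborel2)
  have lim: "(\<lambda>n. q n x) \<longlonglongrightarrow> partial_deriv i g x" for x
  proof -
    have "((\<lambda>s. (g (x + s *\<^sub>R e) - g x) / s) \<longlongrightarrow> partial_deriv i g x) (at 0)"
      using D[of x 0] by (simp add: DERIV_def)
    moreover have "filterlim h (at 0) sequentially"
      using h0 h by (auto simp: filterlim_at less_imp_neq[symmetric] order.strict_iff_not intro!: always_eventually)
    ultimately show ?thesis unfolding q_def by (rule filterlim_compose)
  qed
  have bnd: "\<bar>q n x\<bar> \<le> indicator (cball 0 (R + 1)) x * max B 0" for n x
  proof (cases "norm x \<le> R + 1")
    case True
    obtain z where "g (x + h n *\<^sub>R e) - g (x + 0 *\<^sub>R e) = (h n - 0) * partial_deriv i g (x + z *\<^sub>R e)"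
      using MVT2[OF h(1)[of n], of "\<lambda>t. g (x + t *\<^sub>R e)" "\<lambda>t. partial_deriv i g (x + t *\<^sub>R e)"] D by blast
    then have "q n x = partial_deriv i g (x + z *\<^sub>R e)"
      using h(1)[of n] by (simp add: q_def)
    then show ?thesis using B' True by simp
  next
    case False
    have "norm x \<le> norm (x + h n *\<^sub>R e) + norm (h n *\<^sub>R e)"
      by (metis add_diff_cancel_right' norm_triangle_ineq4)
    with False h[of n] e1 have "norm (x + h n *\<^sub>R e) > R" "norm x > R" by auto
    then show ?thesis using R by (simp add: q_def)
  qed
  have meas: "q n \<in> borel_measurable lborel" for n
    unfolding q_def
    by (auto intro!: borel_measurable_continuous_onI continuous_intros
        continuous_on_compose2[OF cg] simp: less_imp_neq[OF h(1), symmetric])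
  have "(\<lambda>n. LINT x|lborel. q n x) \<longlonglongrightarrow> (LINT x|lborel. partial_deriv i g x)"
  proof (rule integral_dominated_convergence)
    show "integrable lborel (\<lambda>x::real^'n. indicator (cball 0 (R + 1)) x * max B 0)"
      using emeasure_bounded_finite[of "cball (0::real^'n) (R + 1)"]
      by (intro integrable_mult_left integrable_real_indicator) auto
  qed (use lim bnd meas cp in \<open>auto intro: borel_measurable_continuous_onI\<close>)
  moreover have "(LINT x|lborel. q n x) = 0" for n
  proof -
    have "integrable lborel (\<lambda>x. g (h n *\<^sub>R e + x))"
      "(LINT x|lborel. g (h n *\<^sub>R e + x)) = (LINT x|lborel. g x)"
      using ig lborel_distr_plus[of "h n *\<^sub>R e"]
        integrable_distr_eq[of "(+) (h n *\<^sub>R e)" lborel borel g]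
        integral_distr[of "(+) (h n *\<^sub>R e)" lborel borel g]
        borel_measurable_integrable[OF ig]
      by auto
    then show ?thesis using ig by (simp add: q_def add.commute)
  qed
  ultimately have "(LINT x|lborel. partial_deriv i g x) = 0"
    by (simp add: LIMSEQ_const_iff)
  moreover have "partial_deriv i g \<in> borel_measurable lborel"
    using cp by (auto intro: borel_measurable_continuous_onI)
  ultimately show ?thesis
    by (simp add: integral_completion)
qed

lemma partial_deriv_mult:
  assumes "a differentiable (at x)" "b differentiable (at x)"
  shows "(\<lambda>x. a x * b x) differentiable (at x)"
    and "partial_deriv i (\<lambda>x. a x * b x) x = partial_deriv i a x * b x + a x * partial_deriv i b x"
proof -
  have "((\<lambda>x. a x * b x) has_derivative
      (\<lambda>h. a x * frechet_derivative b (at x) h + frechet_derivative a (at x) h * b x)) (at x)"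
    using assms by (intro has_derivative_mult) (auto simp: frechet_derivative_works)
  then show "(\<lambda>x. a x * b x) differentiable (at x)"
    "partial_deriv i (\<lambda>x. a x * b x) x = partial_deriv i a x * b x + a x * partial_deriv i b x"
    by (auto simp: differentiable_def partial_deriv_def frechet_derivative_at[symmetric])
qed

lemma partial_deriv_diff:
  assumes "a differentiable (at x)" "b differentiable (at x)"
  shows "partial_deriv i (\<lambda>x. a x - b x) x = partial_deriv i a x - partial_deriv i b x"
proof -
  have "((\<lambda>x. a x - b x) has_derivative
      (\<lambda>h. frechet_derivative a (at x) h - frechet_derivative b (at x) h)) (at x)"
    using assms by (intro has_derivative_diff) (auto simp: frechet_derivative_works)
  then show ?thesis
    by (auto simp: partial_deriv_def frechet_derivative_at[symmetric])
qed

lemma C_on_1_mult: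
  assumes "C_on 1 UNIV a" "C_on 1 UNIV b"
  shows "C_on 1 UNIV (\<lambda>x. a x * b x)"
proof -
  have "partial_deriv i (\<lambda>x. a x * b x) = (\<lambda>x. partial_deriv i a x * b x + a x * partial_deriv i b x)" for i
    using assms by (auto simp: partial_deriv_mult(2))
  moreover have "continuous_on UNIV a" "continuous_on UNIV b"
    using assms C_on_1_continuous[of 0] by auto
  ultimately show ?thesis
    using assms by (auto simp: partial_deriv_mult(1) intro!: continuous_intros)
qed

lemma C_on_1_diff:
  assumes "C_on 1 UNIV a" "C_on 1 UNIV b"
  shows "C_on 1 UNIV (\<lambda>x. a x - b x)"
proof -
  have "partial_deriv i (\<lambda>x. a x - b x) = (\<lambda>x. partial_deriv i a x - partial_deriv i b x)" for i
    using assms by (auto simp: partial_deriv_diff)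
  then show ?thesis
    using assms by (auto intro!: continuous_intros differentiable_diff)
qed

lemma laplacian_symmetric:
  fixes u \<phi> :: "real^'n::finite \<Rightarrow> real"
  assumes u: "C_on 2 UNIV u" and \<phi>: "test_function \<phi>"
  shows "(LINT x|lebesgue. u x * laplacian \<phi> x) = (LINT x|lebesgue. laplacian u x * \<phi> x)"
proof -
  have \<phi>2: "C_on 2 UNIV \<phi>" using \<phi> by (simp add: test_function_def)
  obtain R where R: "\<And>x. norm x > R \<Longrightarrow> \<phi> x = 0"
    using \<phi> unfolding test_function_def bounded_iff by (metis (mono_tags) mem_Collect_eq not_le)
  have C1: "C_on 1 UNIV w" "C_on 1 UNIV (partial_deriv i w)" if "C_on 2 UNIV w"
    for w :: "real^'n \<Rightarrow> real" and i
    using that C_on_1_continuous[of 0 "partial_deriv _ w"] by (auto simp: numeral_2_eq_2)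
  have cl: "continuous_on UNIV (laplacian w)" if "C_on 2 UNIV w" for w :: "real^'n \<Rightarrow> real"
    using that by (auto simp: laplacian_def[abs_def] numeral_2_eq_2 intro!: continuous_intros)
  have cc: "continuous_on UNIV w" if "C_on 2 UNIV w" for w :: "real^'n \<Rightarrow> real"
    using C1(1)[OF that] C_on_1_continuous[of 0 w] by simp
  define g where "g i x = u x * partial_deriv i \<phi> x - \<phi> x * partial_deriv i u x" for i x
  have gC: "C_on 1 UNIV (g i)" for i
    unfolding g_def[abs_def] using u \<phi>2 by (intro C_on_1_diff C_on_1_mult C1)
  have g0: "g i x = 0" if "norm x > R" for i x
    using R that partial_deriv_support[of R \<phi> x i] by (simp add: g_def)
  have pg: "partial_deriv i (g i) x =
      u x * partial_deriv i (partial_deriv i \<phi>) x - \<phi> x * partial_deriv i (partial_deriv i u) x" for i x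
  proof -
    have d: "w differentiable (at x)" "partial_deriv i w differentiable (at x)"
      if "C_on 2 UNIV w" for w :: "real^'n \<Rightarrow> real"
      using C1[OF that] by auto
    show ?thesis
      unfolding g_def[abs_def] using d[OF u] d[OF \<phi>2]
      by (simp add: partial_deriv_diff partial_deriv_mult)
  qed
  have ip: "integrable lebesgue (partial_deriv i (g i))" for i
    using gC[of i] partial_deriv_support[of R "g i", OF g0]
    by (intro integrable_continuous_support[of _ R]) auto
  have "(\<Sum>i\<in>UNIV. LINT x|lebesgue. partial_deriv i (g i) x) = 0"
    using integral_partial_deriv_0[OF gC g0] by simp
  also have "(\<Sum>i\<in>UNIV. LINT x|lebesgue. partial_deriv i (g i) x) =
      (LINT x|lebesgue. (\<Sum>i\<in>UNIV. partial_deriv i (g i) x))"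
    using ip by (intro Bochner_Integration.integral_sum[symmetric]) auto
  also have "(\<lambda>x. \<Sum>i\<in>UNIV. partial_deriv i (g i) x) =
      (\<lambda>x. u x * laplacian \<phi> x - laplacian u x * \<phi> x)"
    by (auto simp: pg laplacian_def sum_subtractf sum_distrib_left sum_distrib_right mult.commute)
  also have "(LINT x|lebesgue. u x * laplacian \<phi> x - laplacian u x * \<phi> x) =
      (LINT x|lebesgue. u x * laplacian \<phi> x) - (LINT x|lebesgue. laplacian u x * \<phi> x)"
  proof (rule Bochner_Integration.integral_diff)
    have "laplacian \<phi> x = 0" if "norm x > R" for x
      using that R by (auto simp: laplacian_def intro!: sum.neutral partial_deriv_support[of R])
    then show "integrable lebesgue (\<lambda>x. u x * laplacian \<phi> x)"
      by (intro integrable_continuous_support[of _ R] continuous_intros cl cc u \<phi>2) auto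
    show "integrable lebesgue (\<lambda>x. laplacian u x * \<phi> x)"
      using R by (intro integrable_continuous_support[of _ R] continuous_intros cl cc u \<phi>2) auto
  qed
  finally show ?thesis by simp
qed

lemma C2_solution_imp_classical_solution:
  assumes "C2_solution_on UNIV \<rho> f u"
  shows "classical_solution \<rho> f u"
  unfolding classical_solution_def
proof (intro conjI allI impI)
  have u: "C_on 2 UNIV u" and eq: "\<And>x. \<rho> x * f (u x) = - laplacian u x"
    using assms by (auto simp: C2_solution_on_def)
  show "C_on 1 UNIV u"
    using u C_on_1_continuous[of 0 "partial_deriv _ u"] by (auto simp: numeral_2_eq_2)
  show "distributional_solution \<rho> f u"
    unfolding distributional_solution_def by (simp add: eq laplacian_symmetric[OF u])
next
  fix U :: "(real^'a) set"
  show "C2_solution_on U \<rho> f u"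
    using assms by (auto simp: C2_solution_on_def intro: C_on_subset)
qed

lemma classical_solution_iff_C2_solution:
  assumes "0 < \<beta>" "\<beta> < 1" "locally_holder_on UNIV \<beta> \<rho>"
  shows "classical_solution \<rho> f u \<longleftrightarrow> C2_solution_on UNIV \<rho> f u"
  using assms C2_solution_imp_classical_solution[of \<rho> f u]
  by (auto simp: classical_solution_def)

end

theory Submission
  imports Defs
begin

text \<open>A solution is a fixed point of the monotone map \<open>u \<mapsto> G[\<rho> f(u)]\<close>, where \<open>G\<close> is the Newtonian
  potential. Integrability of \<open>r\<^bsup>N-1\<^esup> \<Phi>(r)\<close> gives \<open>G[\<rho>] \<le> C (1 + |x|)\<^bsup>2-N\<^esup>\<close>: from
  \<open>|x - y| |y| \<ge> |x| |y\<^sub>\<perp>|\<close>, with \<open>y\<^sub>\<perp>\<close> the component of \<open>y\<close> orthogonal to \<open>x\<close>, the kernel \<open>|x - y|\<^bsup>2-N\<^esup>\<close> is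
  bounded by \<open>|x|\<^bsup>2-N\<^esup>\<close> times an integrable function of \<open>y / |y|\<close>. As \<open>f(u) / u\<close> tends to \<open>0\<close> at infinity
  and to infinity at \<open>0\<close>, large constants are supersolutions and small multiples of \<open>(1 + |x|)\<^bsup>2-N\<^esup>\<close> are
  subsolutions, so monotone iteration converges to a fixed point. Regularity of the
  potential is obtained from the smooth kernels \<open>(|z|\<^sup>2 + e)\<^bsup>1-N/2\<^esup>\<close> as \<open>e \<rightarrow> 0\<close>. Conversely, every solution is a
  fixed point, because a weakly harmonic function vanishing at infinity is zero; and two fixed points,
  both comparable to \<open>(1 + |x|)\<^bsup>2-N\<^esup>\<close>, coincide since \<open>f(u) / u\<close> is strictly decreasing.\<close>

section \<open>Polar integration and the radial bound for the Newton kernel\<close>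

text \<open>The obstacle is regularity. \<open>\<rho>\<close> is merely bounded on compact sets, so
  the source need not be continuous, and the second derivatives of the Newton kernel have the
  critical order N, which is not locally integrable. All derivatives are therefore taken on the
  smooth kernels, and a single estimate passes to the limit: e scales like |z|^2, so replacing a
  regularized kernel by its limit costs a factor e^t |z|^(-2t) for any t in (0,1], and t is chosen
  small enough to keep the singularity integrable. Orders N-2 and N-1 are harmless for every locally
  bounded density; order N needs the density to be Hoelder continuous, which is why the equation
  holds pointwise only on open sets where \<open>\<rho>\<close> has this property. The same kernels
  yield the fundamental solution, since their Laplacian is one integrable profile rescaled by sqrt
  e. The comparison of two fixed points uses positivity of the kernel and no maximum principle. On
  the unbounded domain, strict inequality alone would not leave room to enlarge a multiple of one
  below the other; a surplus measured in the decay profile does.\<close>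

lemma nn_integral_powr_dyadic:
  fixes d :: "'a \<Rightarrow> real"
  assumes [measurable]: "d \<in> borel_measurable M" "A \<in> sets M"
    and d: "\<And>x. x \<in> A \<Longrightarrow> 0 \<le> d x \<and> d x \<le> T"
    and "T > 0" "C \<ge> 0" "0 \<le> p" "p < m"
    and tube: "\<And>t. 0 < t \<Longrightarrow> t \<le> T \<Longrightarrow> emeasure M {x \<in> A. d x \<le> t} \<le> ennreal (C * t powr m)"
  shows "(\<integral>\<^sup>+x\<in>A. ennreal (d x powr - p) \<partial>M)
    \<le> ennreal (C * T powr (m - p) * 2 powr p / (1 - 2 powr (p - m)))"
proof -
  \<comment> \<open>Dyadic levels: where \<open>t (Suc j) < d x \<le> t j\<close> the integrand is
    at most \<open>c j\<close>. With the tube bound the j-th term is a constant times the j-th power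
    of \<open>2 powr (p - m)\<close>, so the series is geometric with ratio below 1.\<close>
  define t where "t j = T * 2 powr - real j" for j :: nat
  define S where "S j = {x \<in> A. d x \<le> t j}" for j
  define c where "c j = t (Suc j) powr - p" for j
  have t: "0 < t j" "t j \<le> T" for j
    using \<open>T > 0\<close> powr_mono[of "- real j" 0 2] by (auto simp: t_def mult_le_cancel_left1)
  have S_sets [measurable]: "S j \<in> sets M" for j
  proof -
    have "S j = {x \<in> space M. d x \<le> t j} \<inter> A"
      using sets.sets_into_space[OF assms(2)] by (auto simp: S_def)
    then show ?thesis by simp
  qed
  have pw: "ennreal (d x powr - p) * indicator A x \<le> (\<Sum>j. ennreal (c j) * indicator (S j) x)" for x
  proof (cases "x \<in> A \<and> d x > 0")
    case True
    define j where "j = nat \<lfloor>log 2 (T / d x)\<rfloor>"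
    have l0: "0 \<le> log 2 (T / d x)" using True d[of x] \<open>T > 0\<close> by (simp add: zero_le_log_cancel_iff)
    have 1: "real j \<le> log 2 (T / d x)" "log 2 (T / d x) < real (Suc j)"
      using l0 by (auto simp: j_def) linarith+
    have "2 powr real j \<le> T / d x" "T / d x < 2 powr real (Suc j)"
      using 1 True \<open>T > 0\<close> by (auto simp: le_log_iff log_less_iff)
    then have *: "d x * 2 powr real j \<le> T" "T < d x * 2 powr real (Suc j)"
      using True by (simp_all add: field_simps del: of_nat_Suc)
    have t_eq: "t i = T / 2 powr real i" for i
      by (simp only: t_def powr_minus_divide) simp
    have dj: "d x \<le> t j" "t (Suc j) < d x"
      unfolding t_eq using * by (subst pos_le_divide_eq, simp_all) (subst pos_divide_less_eq, simp_all)
    have "d x powr - p \<le> c j"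
      unfolding c_def using dj t(1)[of "Suc j"] \<open>0 \<le> p\<close> by (intro powr_mono2') auto
    then have "ennreal (d x powr - p) * indicator A x \<le> ennreal (c j) * indicator (S j) x"
      using True dj by (simp add: S_def ennreal_leI)
    also have "\<dots> = (\<Sum>i\<in>{j}. ennreal (c i) * indicator (S i) x)"
      by (simp del: sum_mult_indicator)
    also have "\<dots> \<le> (\<Sum>j. ennreal (c j) * indicator (S j) x)"
      by (rule sum_le_suminf) auto
    finally show ?thesis .
  next
    \<comment> \<open>Either \<open>x\<close> lies outside \<open>A\<close>, or
      \<open>d x = 0\<close> and the integrand is zero because
      \<open>0 powr - p = 0\<close>.\<close>
    case False
    then show ?thesis using d[of x] by (cases "x \<in> A") auto
  qed
  have "(\<integral>\<^sup>+x\<in>A. ennreal (d x powr - p) \<partial>M) \<le> (\<integral>\<^sup>+x. (\<Sum>j. ennreal (c j) * indicator (S j) x) \<partial>M)"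
    by (intro nn_integral_mono pw)
  also have "\<dots> = (\<Sum>j. \<integral>\<^sup>+x. ennreal (c j) * indicator (S j) x \<partial>M)"
    by (intro nn_integral_suminf) auto
  also have "\<dots> = (\<Sum>j. ennreal (c j) * emeasure M (S j))"
    by (simp add: nn_integral_cmult_indicator)
  also have "\<dots> \<le> (\<Sum>j. ennreal (C * T powr (m - p) * 2 powr p * (2 powr (p - m)) ^ j))"
  proof (intro suminf_le summableI)
    fix j
    have "ennreal (c j) * emeasure M (S j) \<le> ennreal (c j) * ennreal (C * t j powr m)"
      unfolding S_def using tube[OF t[of j]] by (intro mult_left_mono) auto
    also have "\<dots> = ennreal (c j * (C * t j powr m))"
      using \<open>C \<ge> 0\<close> by (simp add: ennreal_mult c_def)
    also have "c j * (C * t j powr m) = C * T powr (m - p) * 2 powr p * (2 powr (p - m)) ^ j"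
    proof -
      have "(2 powr (p - m)) ^ j = 2 powr ((p - m) * real j)"
        by (simp add: powr_realpow[symmetric] powr_powr)
      moreover have "c j = T powr - p * 2 powr (p * real (Suc j))"
        using \<open>T > 0\<close> by (simp add: c_def t_def powr_mult powr_powr algebra_simps)
      moreover have "t j powr m = T powr m * 2 powr (- m * real j)"
        using \<open>T > 0\<close> by (simp add: t_def powr_mult powr_powr algebra_simps)
      moreover have "T powr (m - p) = T powr m * T powr - p"
        by (simp add: powr_add[symmetric])
      moreover have "2 powr (p * real (Suc j)) * 2 powr (- m * real j) = (2::real) powr p * 2 powr ((p - m) * real j)"
        by (simp add: powr_add[symmetric] algebra_simps)
      ultimately show ?thesis by (simp add: mult_ac)
    qed
    finally show "ennreal (c j) * emeasure M (S j) \<le> ennreal (C * T powr (m - p) * 2 powr p * (2 powr (p - m)) ^ j)" .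
  qed
  also have "\<dots> = ennreal (C * T powr (m - p) * 2 powr p * (1 / (1 - 2 powr (p - m))))"
    using \<open>C \<ge> 0\<close> \<open>p < m\<close>
    by (intro suminf_ennreal_eq sums_mult geometric_sums) (auto simp: powr_less_one)
  finally show ?thesis by simp
qed

lemma nn_integral_lborel_scale:
  fixes F :: "'a::euclidean_space \<Rightarrow> ennreal"
  assumes [measurable]: "F \<in> borel_measurable borel" and c: "c > 0"
  shows "(\<integral>\<^sup>+x. F x \<partial>lborel) = ennreal (c ^ DIM('a)) * (\<integral>\<^sup>+x. F (t + c *\<^sub>R x) \<partial>lborel)"
  using c
  by (subst lborel_affine[of c t])
     (simp_all add: nn_integral_density nn_integral_distr nn_integral_cmult ennreal_power[symmetric])

lemma lborel_integral_scale:
  fixes F :: "'a::euclidean_space \<Rightarrow> real"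
  assumes [measurable]: "F \<in> borel_measurable borel" and c: "c > 0"
  shows "(LINT x|lborel. F x) = c ^ DIM('a) * (LINT x|lborel. F (t + c *\<^sub>R x))"
proof -
  have "(LINT x|lborel. F x) = (LINT x|density (distr lborel borel (\<lambda>x. t + c *\<^sub>R x)) (\<lambda>_. ennreal (c ^ DIM('a))). F x)"
    using c lborel_affine[of c t] by (simp add: ennreal_power)
  also have "\<dots> = c ^ DIM('a) * (LINT x|lborel. F (t + c *\<^sub>R x))"
    using c by (subst integral_density) (simp_all add: integral_distr)
  finally show ?thesis .
qed

text \<open>Polar coordinates without surface measure: the image under \<open>norm\<close> of the
  measure with density \<open>s\<close>, and the measure with density \<open>D\<close> on the line,
  both give \<open>{..r}\<close> the mass \<open>r ^ N * I\<close> for \<open>r > 0\<close>, by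
  scaling and homogeneity on one side and by the primitive of N r^(N-1) on the other. So they
  coincide. \<open>s\<close> is the angular factor; its finite integral gives the generating sets
  finite mass.\<close>

lemma nn_integral_homogeneous_polar:
  fixes s :: "'a::euclidean_space \<Rightarrow> ennreal" and \<Phi> :: "real \<Rightarrow> ennreal"
  assumes [measurable]: "s \<in> borel_measurable borel" "\<Phi> \<in> borel_measurable borel"
    and hom: "\<And>c y. c > 0 \<Longrightarrow> s (c *\<^sub>R y) = s y"
    and fin: "(\<integral>\<^sup>+y\<in>cball 0 1. s y \<partial>lborel) < \<infinity>"
  shows "(\<integral>\<^sup>+y. s y * \<Phi> (norm y) \<partial>lborel) =
    (\<integral>\<^sup>+y\<in>cball 0 1. s y \<partial>lborel) *
    (\<integral>\<^sup>+r\<in>{0<..}. ennreal (DIM('a) * r ^ (DIM('a) - 1)) * \<Phi> r \<partial>lborel)"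
proof -
  define N where "N = DIM('a)"
  define I where "I = (\<integral>\<^sup>+y\<in>cball 0 1. s y \<partial>lborel)"
  have N: "N > 0" by (simp add: N_def)
  define M1 where "M1 = distr (density lborel s) borel norm"
  define D where "D r = I * (ennreal (N * r ^ (N - 1)) * indicator {0<..} r)" for r :: real
  have [measurable]: "D \<in> borel_measurable borel" by (simp add: D_def[abs_def])
  define M2 where "M2 = density lborel D"
  have [measurable]: "cball (0::'a) r \<in> sets borel" for r by simp
  have e1: "emeasure M1 {..r} = (\<integral>\<^sup>+y\<in>cball 0 r. s y \<partial>lborel)" for r
  proof -
    have "emeasure M1 {..r} = emeasure (density lborel s) (norm -` {..r})"
      unfolding M1_def by (subst emeasure_distr) auto
    also have "(norm -` {..r} :: 'a set) = cball 0 r" by auto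
    finally show ?thesis by (simp add: emeasure_density)
  qed
  have e2: "emeasure M2 {..r} = (\<integral>\<^sup>+y\<in>{..r}. D y \<partial>lborel)" for r
    by (simp add: M2_def emeasure_density)
  have a: "emeasure M1 {..r} = ennreal (r ^ N) * I" if "r > 0" for r
  proof -
    have "(\<integral>\<^sup>+y\<in>cball 0 r. s y \<partial>lborel) =
        ennreal (r ^ N) * (\<integral>\<^sup>+y. s (0 + r *\<^sub>R y) * indicator (cball 0 r) (0 + r *\<^sub>R y) \<partial>lborel)"
      unfolding N_def by (intro nn_integral_lborel_scale that) measurable
    also have "(\<lambda>y. s (0 + r *\<^sub>R y) * indicator (cball 0 r) (0 + r *\<^sub>R y)) = (\<lambda>y. s y * indicator (cball 0 1) y)"
      using that hom by (auto simp: indicator_def fun_eq_iff mult_le_cancel_left1)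
    finally show ?thesis by (simp add: e1 I_def)
  qed
  have b: "emeasure M2 {..r} = ennreal (r ^ N) * I" if "r > 0" for r
  proof -
    have "(\<integral>\<^sup>+y\<in>{..r}. D y \<partial>lborel) = (\<integral>\<^sup>+y. I * (ennreal (N * y ^ (N - 1)) * indicator {0..r} y) \<partial>lborel)"
    proof (intro nn_integral_cong_AE)
      have "AE y in lborel. y \<noteq> (0::real)" by (rule AE_lborel_singleton)
      then show "AE y in lborel. D y * indicator {..r} y = I * (ennreal (N * y ^ (N - 1)) * indicator {0..r} y)"
        by eventually_elim (auto simp: D_def indicator_def)
    qed
    also have "\<dots> = I * (\<integral>\<^sup>+y. ennreal (N * y ^ (N - 1)) * indicator {0..r} y \<partial>lborel)"
      by (intro nn_integral_cmult) auto
    also have "(\<integral>\<^sup>+y. ennreal (N * y ^ (N - 1)) * indicator {0..r} y \<partial>lborel) = ennreal (r ^ N - 0 ^ N)"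
      using that by (intro nn_integral_FTC_Icc) (auto intro!: derivative_eq_intros)
    finally show ?thesis using N by (simp add: e2 zero_power mult.commute)
  qed
  have M12: "M1 = M2"
  proof (rule measure_eqI_generator_eq[of "range atMost" UNIV])
    show "Int_stable (range (atMost :: real \<Rightarrow> real set))"
      by (auto simp: Int_stable_def)
    fix X :: "real set" assume "X \<in> range atMost"
    then obtain r where X: "X = {..r}" by auto
    show "emeasure M1 X = emeasure M2 X"
    proof (cases "r > 0")
      case False
      then have "cball 0 r \<subseteq> {0::'a}"
        by (auto simp: not_less) (metis norm_le_zero_iff order_trans)
      then have "AE y in lborel. s y * indicator (cball 0 r) y = 0"
        using AE_lborel_singleton[of "0::'a"] by (auto elim!: eventually_mono simp: indicator_def)
      then have "emeasure M1 X = 0"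
        unfolding X e1 by (subst nn_integral_0_iff_AE) auto
      moreover have "(\<lambda>y. D y * indicator {..r} y) = (\<lambda>y. 0)"
        using False by (auto simp: D_def indicator_def fun_eq_iff)
      ultimately show ?thesis by (simp add: X e2)
    qed (simp add: X a b)
  next
    show "range (\<lambda>n. {..real (Suc n)}) \<subseteq> range atMost" by auto
    show "(\<Union>n. {..real (Suc n)}) = UNIV"
    proof (intro equalityI subsetI UNIV_I)
      fix x :: real
      obtain n where "x \<le> real n" using real_arch_simple by blast
      then have "x \<le> real (Suc n)" by simp
      then show "x \<in> (\<Union>n. {..real (Suc n)})" by blast
    qed
    show "emeasure M1 {..real (Suc n)} \<noteq> \<infinity>" for n
      using fin by (subst a) (auto simp: I_def ennreal_mult_eq_top_iff)
  qed (auto simp: M1_def M2_def borel_eq_atMost)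
  have "(\<integral>\<^sup>+y. s y * \<Phi> (norm y) \<partial>lborel) = (\<integral>\<^sup>+r. \<Phi> r \<partial>M1)"
    unfolding M1_def by (simp add: nn_integral_distr nn_integral_density)
  also have "\<dots> = (\<integral>\<^sup>+r. D r * \<Phi> r \<partial>lborel)"
    unfolding M12 by (simp add: M2_def nn_integral_density)
  also have "\<dots> = (\<integral>\<^sup>+r. I * (ennreal (N * r ^ (N - 1)) * \<Phi> r * indicator {0<..} r) \<partial>lborel)"
    by (intro nn_integral_cong) (auto simp: D_def indicator_def mult.assoc)
  also have "\<dots> = I * (\<integral>\<^sup>+r\<in>{0<..}. ennreal (N * r ^ (N - 1)) * \<Phi> r \<partial>lborel)"
    by (intro nn_integral_cmult) auto
  finally show ?thesis by (simp add: I_def N_def)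
qed

lemma nn_integral_norm_powr_bound:
  fixes p R :: real
  assumes "0 \<le> p" "p < DIM('a)" "R > 0"
  shows "\<exists>C\<ge>0. \<forall>x::'a::euclidean_space. (\<integral>\<^sup>+y\<in>cball x R. ennreal (norm (x - y) powr - p) \<partial>lborel) \<le> ennreal C"
proof (intro exI conjI allI)
  define m where "m = real DIM('a)"
  define V where "V = unit_ball_vol (DIM('a))"
  show "(\<integral>\<^sup>+y\<in>cball x R. ennreal (norm (x - y) powr - p) \<partial>lborel)
      \<le> ennreal (V * R powr (m - p) * 2 powr p / (1 - 2 powr (p - m)))" for x :: 'a
  proof (rule nn_integral_powr_dyadic)
    fix t :: real assume t: "0 < t" "t \<le> R"
    have "{y \<in> cball x R. norm (x - y) \<le> t} = cball x t"
      using t by (auto simp: dist_norm)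
    then show "emeasure lborel {y \<in> cball x R. norm (x - y) \<le> t} \<le> ennreal (V * t powr m)"
      using t by (simp add: emeasure_cball V_def m_def powr_realpow)
  qed (use assms in \<open>auto simp: m_def V_def dist_norm\<close>)
  have "2 powr (p - m) < 1" using assms by (intro powr_less_one) (auto simp: m_def)
  then show "0 \<le> V * R powr (m - p) * 2 powr p / (1 - 2 powr (p - m))"
    by (auto simp: V_def)
qed

section \<open>Volume of tubes around an axis, and the radial kernel bound\<close>

lemma norm_diff_component_sq:
  assumes "norm e = 1"
  shows "(norm (y - (e \<bullet> y) *\<^sub>R e))\<^sup>2 = (norm y)\<^sup>2 - (e \<bullet> y)\<^sup>2"
  using assms unfolding power2_norm_eq_inner
  by (simp add: inner_diff inner_commute norm_eq_1 power2_eq_square algebra_simps)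

text \<open>Balls of radius \<open>2 * t\<close> centred on the axis at the multiples of
  \<open>t\<close> cover the tube. At most 5 / t of them are used, each of volume of order t^N,
  which leaves the exponent \<open>DIM('a) - 1\<close>.\<close>

lemma emeasure_tube_le:
  fixes e :: "'a::euclidean_space"
  assumes e: "norm e = 1" and t: "0 < t" "t \<le> 1"
  shows "emeasure lborel {y \<in> cball 0 1. norm (y - (e \<bullet> y) *\<^sub>R e) \<le> t}
    \<le> ennreal (5 * 2 ^ DIM('a) * unit_ball_vol (DIM('a)) * t powr (real DIM('a) - 1))"
proof -
  define J where "J = {- \<lceil>1 / t\<rceil>..\<lceil>1 / t\<rceil>}"
  have "emeasure lborel {y \<in> cball 0 1. norm (y - (e \<bullet> y) *\<^sub>R e) \<le> t}
      \<le> emeasure lborel (\<Union>k\<in>J. cball ((of_int k * t) *\<^sub>R e) (2 * t))"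
  proof (rule emeasure_mono)
    show "{y \<in> cball 0 1. norm (y - (e \<bullet> y) *\<^sub>R e) \<le> t} \<subseteq> (\<Union>k\<in>J. cball ((of_int k * t) *\<^sub>R e) (2 * t))"
    proof clarify
      fix y :: 'a assume y: "y \<in> cball 0 1" "norm (y - (e \<bullet> y) *\<^sub>R e) \<le> t"
      define k where "k = \<lfloor>(e \<bullet> y) / t\<rfloor>"
      have "\<bar>e \<bullet> y\<bar> \<le> 1"
        using Cauchy_Schwarz_ineq2[of e y] e y by simp
      then have "- (1 / t) \<le> (e \<bullet> y) / t" "(e \<bullet> y) / t \<le> 1 / t"
        using t by (auto simp: abs_le_iff field_simps)
      then have "k \<in> J" unfolding J_def k_def atLeastAtMost_iff by linarith
      moreover have "norm (y - (of_int k * t) *\<^sub>R e) \<le> 2 * t"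
      proof -
        have "of_int k \<le> (e \<bullet> y) / t" "(e \<bullet> y) / t \<le> of_int k + 1"
          unfolding k_def by linarith+
        then have "of_int k * t \<le> e \<bullet> y" "e \<bullet> y \<le> (of_int k + 1) * t"
          using t by (simp_all add: pos_le_divide_eq pos_divide_le_eq)
        then have "\<bar>e \<bullet> y - of_int k * t\<bar> \<le> t" by (simp add: algebra_simps)
        moreover have "norm (y - (of_int k * t) *\<^sub>R e) \<le>
            norm (y - (e \<bullet> y) *\<^sub>R e) + norm ((e \<bullet> y - of_int k * t) *\<^sub>R e)"
          by (rule order_trans[OF _ norm_triangle_ineq]) (simp add: algebra_simps)
        ultimately show ?thesis using y e by simp
      qed
      ultimately show "y \<in> (\<Union>k\<in>J. cball ((of_int k * t) *\<^sub>R e) (2 * t))"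
        by (auto simp: dist_norm norm_minus_commute)
    qed
  qed auto
  also have "\<dots> \<le> (\<Sum>k\<in>J. emeasure lborel (cball ((of_int k * t) *\<^sub>R e) (2 * t)))"
    by (intro emeasure_subadditive_finite) (auto simp: J_def)
  also have "\<dots> = ennreal (real (card J) * (unit_ball_vol (DIM('a)) * (2 * t) ^ DIM('a)))"
    using t by (simp add: emeasure_cball ennreal_mult' flip: ennreal_of_nat_eq_real_of_nat)
  also have "\<dots> \<le> ennreal (5 / t * (unit_ball_vol (DIM('a)) * (2 * t) ^ DIM('a)))"
  proof (intro ennreal_leI mult_right_mono)
    have "real (card J) \<le> 2 * (1 / t + 1) + 1"
    proof -
      define z where "z = \<lceil>1 / t\<rceil>"
      have "0 < z" using t by (simp add: z_def zero_less_ceiling)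
      then have "real (card J) = 2 * of_int z + 1"
        unfolding J_def z_def[symmetric] by simp
      then have "real (card J) = 2 * of_int \<lceil>1 / t\<rceil> + 1" by (simp add: z_def)
      moreover have "of_int \<lceil>w\<rceil> \<le> w + 1" for w :: real by linarith
      ultimately show ?thesis by (metis add_right_mono mult_left_mono zero_le_numeral)
    qed
    also have "\<dots> \<le> 5 / t" using t by (simp add: field_simps)
    finally show "real (card J) \<le> 5 / t" .
  qed (use t in auto)
  also have "5 / t * (unit_ball_vol (DIM('a)) * (2 * t) ^ DIM('a)) =
      5 * 2 ^ DIM('a) * unit_ball_vol (DIM('a)) * t powr (real DIM('a) - 1)"
    using t by (simp add: powr_diff powr_realpow power_mult_distrib)
  finally show ?thesis .
qed

text \<open>The angular factor is \<open>(norm y / d y) powr (N - 2)\<close>, with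
  \<open>d y\<close> the distance from \<open>y\<close> to the axis through \<open>x\<close>. It is
  singular at most on that axis, and the exponent \<open>N - 2\<close> stays below the exponent
  \<open>N - 1\<close> with which tubes shrink. Hence its integral over the unit ball is bounded
  independently of \<open>x\<close>.\<close>

lemma newtonian_kernel_radial_bound:
  defines "N \<equiv> DIM('a::euclidean_space)"
  assumes N: "N \<ge> 2"
  shows "\<exists>C\<ge>0. \<forall>(x::'a) \<Phi>. x \<noteq> 0 \<longrightarrow> \<Phi> \<in> borel_measurable borel \<longrightarrow>
    (\<integral>\<^sup>+y. ennreal (norm (x - y) powr (2 - real N)) * \<Phi> (norm y) \<partial>lborel) \<le>
    ennreal (C * norm x powr (2 - real N)) * (\<integral>\<^sup>+r\<in>{0<..}. ennreal (r ^ (N - 1)) * \<Phi> r \<partial>lborel)"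
proof -
  \<comment> \<open>The constant of \<open>nn_integral_powr_dyadic\<close> on the unit ball for
    \<open>T = 1\<close>, \<open>m = N - 1\<close>, \<open>p = N - 2\<close> and the constant of
    \<open>emeasure_tube_le\<close>.\<close>
  define C1 where "C1 = 5 * 2 ^ N * unit_ball_vol N * 1 powr ((real N - 1) - (real N - 2)) * 2 powr (real N - 2) / (1 - 2 powr ((real N - 2) - (real N - 1)))"
  have C1: "C1 \<ge> 0" by (auto simp: C1_def powr_minus)
  show ?thesis
  proof (intro exI conjI allI impI)
    show "0 \<le> C1 * N" using C1 by simp
    fix x :: 'a and \<Phi> :: "real \<Rightarrow> ennreal"
    assume x: "x \<noteq> 0" and [measurable]: "\<Phi> \<in> borel_measurable borel"
    define e where "e = (1 / norm x) *\<^sub>R x"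
    have e: "norm e = 1" and xe: "x = norm x *\<^sub>R e" using x by (auto simp: e_def)
    define d where "d y = norm (y - (e \<bullet> y) *\<^sub>R e)" for y
    have [measurable]: "d \<in> borel_measurable borel" by (simp add: d_def[abs_def])
    define s where "s y = ennreal ((norm y / d y) powr (real N - 2))" for y
    have [measurable]: "s \<in> borel_measurable borel" by (simp add: s_def[abs_def])
    have dle: "d y \<le> norm y" for y
      using norm_diff_component_sq[OF e, of y]
      unfolding d_def by - (rule power2_le_imp_le, auto)
    have "(\<integral>\<^sup>+y\<in>cball 0 1. s y \<partial>lborel) \<le> (\<integral>\<^sup>+y\<in>cball 0 1. ennreal (d y powr - (real N - 2)) \<partial>lborel)"
    proof (intro nn_integral_mono)
      fix y :: 'a
      have "(norm y / d y) powr (real N - 2) \<le> d y powr - (real N - 2)" if "norm y \<le> 1"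
      proof -
        have "(norm y / d y) powr (real N - 2) \<le> (1 / d y) powr (real N - 2)"
          using that N by (intro powr_mono2 divide_right_mono) (auto simp: d_def)
        then show ?thesis by (simp add: powr_divide powr_minus_divide d_def del: minus_diff_eq)
      qed
      then show "s y * indicator (cball 0 1) y \<le> ennreal (d y powr - (real N - 2)) * indicator (cball 0 1) y"
        by (auto simp: s_def indicator_def intro!: ennreal_leI)
    qed
    also have "\<dots> \<le> ennreal C1"
      unfolding C1_def
    proof (rule nn_integral_powr_dyadic)
      fix t :: real assume "0 < t" "t \<le> 1"
      from emeasure_tube_le[OF e this]
      show "emeasure lborel {x \<in> cball 0 1. d x \<le> t} \<le> ennreal (5 * 2 ^ N * unit_ball_vol N * t powr (real N - 1))"
        using N by (simp add: d_def N_def)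
    next
      fix y :: 'a assume "y \<in> cball 0 1"
      then show "0 \<le> d y \<and> d y \<le> 1" using dle[of y] by (auto simp: d_def)
    qed (use N in auto)
    finally have I: "(\<integral>\<^sup>+y\<in>cball 0 1. s y \<partial>lborel) \<le> ennreal C1" .
    have hom: "s (c *\<^sub>R y) = s y" if "c > 0" for c y
    proof -
      have "c *\<^sub>R y - (e \<bullet> (c *\<^sub>R y)) *\<^sub>R e = c *\<^sub>R (y - (e \<bullet> y) *\<^sub>R e)"
        by (simp add: algebra_simps)
      then have "d (c *\<^sub>R y) = c * d y" using that unfolding d_def by simp
      then show ?thesis using that by (simp add: s_def)
    qed
    have "(\<integral>\<^sup>+y. ennreal (norm (x - y) powr (2 - real N)) * \<Phi> (norm y) \<partial>lborel) \<le>
        (\<integral>\<^sup>+y. ennreal (norm x powr (2 - real N)) * (s y * \<Phi> (norm y)) \<partial>lborel)"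
    proof (rule nn_integral_mono_AE)
      \<comment> \<open>On the axis \<open>d y = 0\<close>, so \<open>s y = 0\<close> by the
        conventions for division and \<open>powr\<close>, and the pointwise bound may fail. The axis
        is a null set because \<open>N \<ge> 2\<close>.\<close>
      have "negligible (span {e})"
        using N by (intro negligible_lowdim) (auto simp: dim_span N_def intro: le_less_trans[OF dim_le_card'])
      then have "AE y in lborel. y \<notin> span {e}"
        by (auto simp: negligible_iff_null_sets null_sets_completion_iff closed_span intro: AE_not_in)
      then show "AE y in lborel. ennreal (norm (x - y) powr (2 - real N)) * \<Phi> (norm y)
          \<le> ennreal (norm x powr (2 - real N)) * (s y * \<Phi> (norm y))"
      proof eventually_elim
        fix y assume y: "y \<notin> span {e}"
        have "y \<noteq> (e \<bullet> y) *\<^sub>R e" using y by (metis span_base span_mul singletonI)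
        then have dy: "d y > 0" by (auto simp: d_def)
        have y0: "y \<noteq> 0" using y span_zero by metis
        have "(norm x * d y)\<^sup>2 \<le> (norm (x - y) * norm y)\<^sup>2"
        proof -
          have "(norm x * d y)\<^sup>2 = (norm x)\<^sup>2 * (norm y)\<^sup>2 - (x \<bullet> y)\<^sup>2"
          proof -
            have "x \<bullet> y = norm x * (e \<bullet> y)" by (subst xe) simp
            then show ?thesis
              by (simp add: power_mult_distrib d_def norm_diff_component_sq[OF e] algebra_simps)
          qed
          moreover have "(norm (x - y))\<^sup>2 = (norm x)\<^sup>2 - 2 * (x \<bullet> y) + (norm y)\<^sup>2"
            unfolding power2_norm_eq_inner by (simp add: inner_diff inner_commute)
          \<comment> \<open>The two sides differ by the square of \<open>Y - p\<close>, here of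
            |y|^2 - \<open>x \<bullet> y\<close>.\<close>
          moreover have "X * Y - p\<^sup>2 \<le> (X - 2 * p + Y) * Y" for X Y p :: real
            using zero_le_power2[of "Y - p"] by (simp add: power2_eq_square algebra_simps)
          ultimately show ?thesis by (simp only: power_mult_distrib)
        qed
        then have *: "norm x * d y \<le> norm (x - y) * norm y"
          by (rule power2_le_imp_le) simp
        then have **: "norm x * (d y / norm y) \<le> norm (x - y)"
          using y0 by (simp add: pos_divide_le_eq)
        have pos: "0 < norm x * (d y / norm y)" using x dy y0 by simp
        have "norm (x - y) powr (2 - real N) \<le> (norm x * (d y / norm y)) powr (2 - real N)"
          using N pos ** by (intro powr_mono2') auto
        also have "\<dots> = norm x powr (2 - real N) * (norm y / d y) powr (real N - 2)"
        proof -
          have "(d y / norm y) powr (2 - real N) = (norm y / d y) powr (real N - 2)"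
            using dy y0 powr_minus[of "d y / norm y" "real N - 2"] N
            by (simp add: powr_divide inverse_eq_divide)
          then show ?thesis by (simp add: powr_mult del: times_divide_eq_right)
        qed
        finally have "ennreal (norm (x - y) powr (2 - real N)) \<le> ennreal (norm x powr (2 - real N)) * s y"
          unfolding s_def by (simp only: ennreal_mult[OF powr_ge_zero powr_ge_zero, symmetric] ennreal_leI)
        then show "ennreal (norm (x - y) powr (2 - real N)) * \<Phi> (norm y)
            \<le> ennreal (norm x powr (2 - real N)) * (s y * \<Phi> (norm y))"
          unfolding mult.assoc[symmetric] by (intro mult_right_mono) auto
      qed
    qed
    also have "\<dots> = ennreal (norm x powr (2 - real N)) * (\<integral>\<^sup>+y. s y * \<Phi> (norm y) \<partial>lborel)"
      by (intro nn_integral_cmult) auto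
    also have "(\<integral>\<^sup>+y. s y * \<Phi> (norm y) \<partial>lborel) = (\<integral>\<^sup>+y\<in>cball 0 1. s y \<partial>lborel) *
        (\<integral>\<^sup>+r\<in>{0<..}. ennreal (N * r ^ (N - 1)) * \<Phi> r \<partial>lborel)"
      unfolding N_def using le_less_trans[OF I ennreal_less_top] hom
      by (intro nn_integral_homogeneous_polar) simp_all
    also have "(\<integral>\<^sup>+r\<in>{0<..}. ennreal (N * r ^ (N - 1)) * \<Phi> r \<partial>lborel) =
        (\<integral>\<^sup>+r. ennreal N * (ennreal (r ^ (N - 1)) * \<Phi> r * indicator {0<..} r) \<partial>lborel)"
      by (intro nn_integral_cong) (auto simp: ennreal_mult' mult.assoc)
    also have "\<dots> = ennreal N * (\<integral>\<^sup>+r\<in>{0<..}. ennreal (r ^ (N - 1)) * \<Phi> r \<partial>lborel)"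
      by (intro nn_integral_cmult) auto
    also have "ennreal (norm x powr (2 - real N)) * ((\<integral>\<^sup>+y\<in>cball 0 1. s y \<partial>lborel) *
          (ennreal N * (\<integral>\<^sup>+r\<in>{0<..}. ennreal (r ^ (N - 1)) * \<Phi> r \<partial>lborel)))
        \<le> ennreal (norm x powr (2 - real N)) * (ennreal C1 *
          (ennreal N * (\<integral>\<^sup>+r\<in>{0<..}. ennreal (r ^ (N - 1)) * \<Phi> r \<partial>lborel)))"
      using I by (intro mult_left_mono mult_right_mono) auto
    also have "\<dots> = ennreal (C1 * N * norm x powr (2 - real N)) *
        (\<integral>\<^sup>+r\<in>{0<..}. ennreal (r ^ (N - 1)) * \<Phi> r \<partial>lborel)"
      using C1 by (simp add: ennreal_mult' mult_ac)
    finally show "(\<integral>\<^sup>+y. ennreal (norm (x - y) powr (2 - real N)) * \<Phi> (norm y) \<partial>lborel) \<le>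
      ennreal (C1 * N * norm x powr (2 - real N)) * (\<integral>\<^sup>+r\<in>{0<..}. ennreal (r ^ (N - 1)) * \<Phi> r \<partial>lborel)" .
  qed
qed

section \<open>Convolutions and limits of partial derivatives\<close>

lemma borel_imp_lebesgue_measurable:
  "f \<in> borel_measurable borel \<Longrightarrow> f \<in> borel_measurable (lebesgue :: 'a::euclidean_space measure)"
  by (simp add: measurable_completion)

lemma integrable_norm_powr:
  fixes p R :: real
  assumes "0 \<le> p" "p < DIM('a)" "R > 0"
  shows "\<exists>C\<ge>0. \<forall>x::'a::euclidean_space.
    integrable lebesgue (\<lambda>y. norm (x - y) powr - p * indicator (cball x R) y) \<and>
    (LINT y|lebesgue. norm (x - y) powr - p * indicator (cball x R) y) \<le> C"
proof -
  obtain C where C: "C \<ge> 0"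
    "\<And>x::'a. (\<integral>\<^sup>+y\<in>cball x R. ennreal (norm (x - y) powr - p) \<partial>lborel) \<le> ennreal C"
    using nn_integral_norm_powr_bound[OF assms] by blast
  show ?thesis
  proof (intro exI conjI allI)
    fix x :: 'a
    let ?f = "\<lambda>y. norm (x - y) powr - p * indicator (cball x R) y"
    have [measurable]: "cball x R \<in> sets borel" by simp
    have [measurable]: "?f \<in> borel_measurable borel" by measurable
    have nn: "(\<integral>\<^sup>+y. ennreal (?f y) \<partial>lborel) \<le> ennreal C"
      using C(2)[of x] by (simp add: ennreal_mult' ennreal_indicator)
    have int: "integrable lborel ?f"
      using nn le_less_trans[OF nn ennreal_less_top] by (intro integrableI_nonneg) auto
    then show "integrable lebesgue ?f" by (rule integrable_completion[THEN iffD2, rotated]) auto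
    have "ennreal (LINT y|lborel. ?f y) \<le> ennreal C"
      using nn by (subst nn_integral_eq_integral[OF int, symmetric]) auto
    then show "(LINT y|lebesgue. ?f y) \<le> C"
      using C by (subst integral_completion) auto
  qed (rule C)
qed

lemma has_derivative_partials:
  fixes u :: "real^'n::finite \<Rightarrow> real"
  assumes "u differentiable (at x)"
  shows "(u has_derivative (\<lambda>h. \<Sum>i\<in>UNIV. h $ i * partial_deriv i u x)) (at x)"
proof -
  have d: "(u has_derivative frechet_derivative u (at x)) (at x)"
    using assms by (simp add: frechet_derivative_works)
  have "frechet_derivative u (at x) h = (\<Sum>i\<in>UNIV. h $ i * partial_deriv i u x)" for h
  proof -
    have "frechet_derivative u (at x) h = frechet_derivative u (at x) (\<Sum>i\<in>UNIV. (h $ i) *\<^sub>R axis i 1)"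
      by (simp add: basis_expansion[of h, unfolded scalar_mult_eq_scaleR])
    then show ?thesis
      using has_derivative_linear[OF d] by (simp add: linear_sum linear_cmul partial_deriv_def)
  qed
  then have "frechet_derivative u (at x) = (\<lambda>h. \<Sum>i\<in>UNIV. h $ i * partial_deriv i u x)" by auto
  with d show ?thesis by simp
qed

lemma partial_derivI:
  assumes "(u has_derivative u') (at x)"
  shows "u differentiable (at x)" "partial_deriv i u x = u' (axis i 1)"
  using assms by (auto simp: differentiable_def partial_deriv_def frechet_derivative_at[symmetric])

lemma abs_sum_partials_le:
  fixes h :: "real^'n::finite" and B :: real
  assumes "\<And>i. \<bar>c i\<bar> \<le> B"
  shows "\<bar>\<Sum>i\<in>UNIV. h $ i * c i\<bar> \<le> CARD('n) * B * norm h"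
proof -
  have "\<bar>\<Sum>i\<in>UNIV. h $ i * c i\<bar> \<le> (\<Sum>i\<in>UNIV. \<bar>h $ i * c i\<bar>)" by (rule sum_abs)
  also have "\<dots> \<le> (\<Sum>i\<in>(UNIV :: 'n set). norm h * B)"
    unfolding abs_mult by (intro sum_mono mult_mono component_le_norm_cart assms) auto
  finally have "\<bar>\<Sum>i\<in>UNIV. h $ i * c i\<bar> \<le> (\<Sum>i\<in>(UNIV :: 'n set). norm h * B)" .
  then show ?thesis by (simp add: mult_ac)
qed

lemma lipschitz_partials_bounded:
  fixes K :: "real^'n::finite \<Rightarrow> real" and B :: real
  assumes S: "convex S" "open S" "x \<in> S" "y \<in> S"
    and "\<And>x. x \<in> S \<Longrightarrow> K differentiable (at x)" "\<And>i x. x \<in> S \<Longrightarrow> \<bar>partial_deriv i K x\<bar> \<le> B"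
  shows "\<bar>K x - K y\<bar> \<le> CARD('n) * B * norm (x - y)"
proof -
  have "norm (K x - K y) \<le> CARD('n) * B * norm (x - y)"
  proof (rule differentiable_bound[OF S(1)])
    fix z assume z: "z \<in> S"
    show "(K has_derivative (\<lambda>h. \<Sum>i\<in>UNIV. h $ i * partial_deriv i K z)) (at z within S)"
      using z assms by (intro has_derivative_at_withinI[OF has_derivative_partials]) auto
    show "onorm (\<lambda>h. \<Sum>i\<in>UNIV. h $ i * partial_deriv i K z) \<le> CARD('n) * B"
      using abs_sum_partials_le[of "\<lambda>i. partial_deriv i K z" B] assms z by (intro onorm_le) auto
  qed (use S in auto)
  then show ?thesis by simp
qed

lemma integrable_bounded_mult:
  fixes K g :: "'a::euclidean_space \<Rightarrow> real"
  assumes [measurable]: "K \<in> borel_measurable lebesgue" and "\<And>y. \<bar>K y\<bar> \<le> B" and g: "integrable lebesgue g"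
  shows "integrable lebesgue (\<lambda>y. K y * g y)"
proof (rule Bochner_Integration.integrable_bound)
  show "integrable lebesgue (\<lambda>y. B * g y)" using g by simp
  have "B \<ge> 0" using assms(2)[of undefined] by linarith
  then show "AE y in lebesgue. norm (K y * g y) \<le> norm (B * g y)"
    using assms(2) by (auto simp: abs_mult intro!: mult_right_mono)
qed (use g in auto)

lemma lebesgue_measurable_shift:
  fixes K :: "'a::euclidean_space \<Rightarrow> real"
  assumes "continuous_on UNIV K"
  shows "(\<lambda>y. K (x - y)) \<in> borel_measurable lebesgue"
  by (intro borel_imp_lebesgue_measurable borel_measurable_continuous_onI
      continuous_on_compose2[OF assms] continuous_intros) auto

lemma continuous_conv:
  fixes K g :: "'a::euclidean_space \<Rightarrow> real"
  assumes K: "continuous_on UNIV K" "\<And>x. \<bar>K x\<bar> \<le> B" and g: "integrable lebesgue g"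
  shows "continuous_on UNIV (\<lambda>x. LINT y|lebesgue. K (x - y) * g y)"
  unfolding continuous_on_eq_continuous_at[OF open_UNIV]
proof (intro ballI, unfold continuous_at_sequentially, intro allI impI)
  fix x and s :: "nat \<Rightarrow> 'a" assume s: "s \<longlonglongrightarrow> x"
  note [measurable] = lebesgue_measurable_shift[OF K(1)] borel_measurable_integrable[OF g]
  have B: "B \<ge> 0" using K(2)[of undefined] by linarith
  have "(\<lambda>n. LINT y|lebesgue. K (s n - y) * g y) \<longlonglongrightarrow> (LINT y|lebesgue. K (x - y) * g y)"
  proof (rule integral_dominated_convergence[where w = "\<lambda>y. B * \<bar>g y\<bar>"])
    show "AE y in lebesgue. (\<lambda>n. K (s n - y) * g y) \<longlonglongrightarrow> K (x - y) * g y"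
    proof (intro AE_I2 tendsto_intros)
      fix y
      have "isCont K (x - y)" using K(1) by (simp add: continuous_on_eq_continuous_at)
      then show "(\<lambda>n. K (s n - y)) \<longlonglongrightarrow> K (x - y)"
        by (rule isCont_tendsto_compose) (intro tendsto_intros s)
    qed
    show "AE y in lebesgue. norm (K (s n - y) * g y) \<le> B * \<bar>g y\<bar>" for n
      using K(2) by (auto simp: abs_mult intro!: mult_right_mono)
  qed (use g in \<open>auto intro!: borel_measurable_times\<close>)
  then show "((\<lambda>x. LINT y|lebesgue. K (x - y) * g y) \<circ> s) \<longlonglongrightarrow> (LINT y|lebesgue. K (x - y) * g y)"
    by (simp add: o_def)
qed

text \<open>The remainder of the first-order expansion of \<open>K\<close>, divided by the length of
  the increment, tends to zero pointwise and is at most \<open>2 * CARD('n) * B\<close> by the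
  Lipschitz bound. Dominated convergence against \<open>g\<close> then gives the total derivative,
  not only the partial ones.\<close>

lemma conv_partial_deriv:
  fixes K g :: "real^'n::finite \<Rightarrow> real"
  assumes K: "C_on 1 UNIV K" "\<And>x. \<bar>K x\<bar> \<le> B" "\<And>i x. \<bar>partial_deriv i K x\<bar> \<le> B"
    and g: "integrable lebesgue g"
  shows "(\<lambda>x. LINT y|lebesgue. K (x - y) * g y) differentiable (at x)" (is "?A differentiable _")
    and "partial_deriv i (\<lambda>x. LINT y|lebesgue. K (x - y) * g y) x =
      (LINT y|lebesgue. partial_deriv i K (x - y) * g y)"
proof -
  have cK: "continuous_on UNIV K" and cp: "continuous_on UNIV (partial_deriv i K)" for i
    using K(1) C_on_1_continuous[of 0 K] by auto
  note [measurable] = lebesgue_measurable_shift[OF cK] lebesgue_measurable_shift[OF cp] borel_measurable_integrable[OF g]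
  have B: "B \<ge> 0" using K(2)[of undefined] by linarith
  define c where "c i = (LINT y|lebesgue. partial_deriv i K (x - y) * g y)" for i
  have iK: "integrable lebesgue (\<lambda>y. K (x - y) * g y)" for x
    by (rule integrable_bounded_mult) (use K g in auto)
  have ip: "integrable lebesgue (\<lambda>y. partial_deriv i K (x - y) * g y)" for x i
    by (rule integrable_bounded_mult) (use K g in auto)
  have lip: "\<bar>K a - K b\<bar> \<le> CARD('n) * B * norm (a - b)" for a b
    using lipschitz_partials_bounded[of UNIV a b K B] K by auto
  have "(?A has_derivative (\<lambda>h. \<Sum>i\<in>UNIV. h $ i * c i)) (at x)"
    unfolding has_derivative_at
  proof (intro conjI)
    show "bounded_linear (\<lambda>h. \<Sum>i\<in>UNIV. h $ i * c i)"
      by (intro bounded_linear_sum bounded_linear_mult_left bounded_linear_vec_nth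
          bounded_linear_compose[OF bounded_linear_mult_left])
    show "((\<lambda>h. norm (?A (x + h) - ?A x - (\<Sum>i\<in>UNIV. h $ i * c i)) / norm h) \<longlongrightarrow> 0) (at 0)"
      unfolding tendsto_at_iff_sequentially
    proof (intro allI impI)
      fix s :: "nat \<Rightarrow> real^'n" assume s0: "\<forall>n. s n \<in> UNIV - {0}" and s: "s \<longlonglongrightarrow> 0"
      define r where "r n y = (K (x + s n - y) - K (x - y) -
        (\<Sum>i\<in>UNIV. s n $ i * partial_deriv i K (x - y))) / norm (s n)" for n y
      have eq: "(?A (x + s n) - ?A x - (\<Sum>i\<in>UNIV. s n $ i * c i)) / norm (s n) =
          (LINT y|lebesgue. r n y * g y)" for n
      proof -
        have "?A (x + s n) - ?A x - (\<Sum>i\<in>UNIV. s n $ i * c i) =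
          (LINT y|lebesgue. K (x + s n - y) * g y - K (x - y) * g y -
            (\<Sum>i\<in>UNIV. s n $ i * (partial_deriv i K (x - y) * g y)))"
          unfolding c_def using iK ip
          by (subst Bochner_Integration.integral_diff, simp, simp)
             (simp add: Bochner_Integration.integral_diff Bochner_Integration.integral_sum)
        also have "\<dots> / norm (s n) = (LINT y|lebesgue. r n y * g y)"
          unfolding integral_divide_zero[symmetric]
          by (intro Bochner_Integration.integral_cong)
             (auto simp: r_def field_simps sum_distrib_left sum_distrib_right)
        finally show ?thesis .
      qed
      have "(\<lambda>n. LINT y|lebesgue. r n y * g y) \<longlonglongrightarrow> (LINT y::real^'n|lebesgue. 0)"
      proof (rule integral_dominated_convergence[where w = "\<lambda>y. (2 * CARD('n) * B) * \<bar>g y\<bar>"])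
        show "AE y in lebesgue. (\<lambda>n. r n y * g y) \<longlonglongrightarrow> 0"
        proof (intro AE_I2 tendsto_mult_left_zero)
          fix y
          have "(K has_derivative (\<lambda>h. \<Sum>i\<in>UNIV. h $ i * partial_deriv i K (x - y))) (at (x - y))"
            using K(1) by (intro has_derivative_partials) simp
          then have "((\<lambda>h. norm (K (x - y + h) - K (x - y) - (\<Sum>i\<in>UNIV. h $ i * partial_deriv i K (x - y))) / norm h) \<longlongrightarrow> 0) (at 0)"
            unfolding has_derivative_at by simp
          then have "(\<lambda>n. norm (K (x - y + s n) - K (x - y) - (\<Sum>i\<in>UNIV. s n $ i * partial_deriv i K (x - y))) / norm (s n)) \<longlonglongrightarrow> 0"
            using s s0 unfolding tendsto_at_iff_sequentially o_def by blast
          also have "(\<lambda>n. norm (K (x - y + s n) - K (x - y) - (\<Sum>i\<in>UNIV. s n $ i * partial_deriv i K (x - y))) / norm (s n)) = (\<lambda>n. \<bar>r n y\<bar>)"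
            by (simp add: r_def fun_eq_iff algebra_simps)
          finally show "(\<lambda>n. r n y) \<longlonglongrightarrow> 0" by (simp add: tendsto_rabs_zero_iff)
        qed
        show "AE y in lebesgue. norm (r n y * g y) \<le> (2 * CARD('n) * B) * \<bar>g y\<bar>" for n
        proof (intro AE_I2)
          fix y
          have n: "norm (s n) > 0" using s0 by auto
          have "\<bar>K (x + s n - y) - K (x - y) - (\<Sum>i\<in>UNIV. s n $ i * partial_deriv i K (x - y))\<bar>
              \<le> CARD('n) * B * norm (s n) + CARD('n) * B * norm (s n)"
            using lip[of "x + s n - y" "x - y"] abs_sum_partials_le[of "\<lambda>i. partial_deriv i K (x - y)" B "s n"] K(3)
            by (simp add: algebra_simps)
          also have "\<dots> = 2 * CARD('n) * B * norm (s n)" by simp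
          finally have "\<bar>r n y\<bar> \<le> 2 * CARD('n) * B"
            using n by (simp add: r_def abs_divide pos_divide_le_eq)
          then show "norm (r n y * g y) \<le> (2 * CARD('n) * B) * \<bar>g y\<bar>"
            by (auto simp: abs_mult intro!: mult_right_mono)
        qed
        show "(\<lambda>y. r n y * g y) \<in> borel_measurable lebesgue" for n
          unfolding r_def by measurable
      qed (use g in auto)
      then have "(\<lambda>n. norm (LINT y|lebesgue. r n y * g y)) \<longlonglongrightarrow> 0"
        using tendsto_norm_zero by fastforce
      then show "((\<lambda>h. norm (?A (x + h) - ?A x - (\<Sum>i\<in>UNIV. h $ i * c i)) / norm h) \<circ> s) \<longlonglongrightarrow> 0"
        by (simp add: o_def eq[symmetric])
    qed
  qed
  from partial_derivI(1)[OF this] partial_derivI(2)[OF this, of i]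
  show "?A differentiable (at x)" "partial_deriv i ?A x = (LINT y|lebesgue. partial_deriv i K (x - y) * g y)"
    by (auto simp: c_def axis_def if_distrib[of "\<lambda>t. t * _"] cong: if_cong)
qed

text \<open>With finitely many coordinates, uniform convergence of the partial derivatives is
  uniform convergence of the total ones. This carries derivatives of regularized potentials over to
  the limit.\<close>

lemma uniform_limit_partials:
  fixes A :: "nat \<Rightarrow> real^'n::finite \<Rightarrow> real"
  assumes S: "open S" "convex S"
    and d: "\<And>n x. x \<in> S \<Longrightarrow> A n differentiable (at x)"
    and u: "\<And>i. uniform_limit S (\<lambda>n. partial_deriv i (A n)) (D i) sequentially"
    and l: "\<And>x. x \<in> S \<Longrightarrow> (\<lambda>n. A n x) \<longlonglongrightarrow> a x"
    and x: "x \<in> S"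
  shows "a differentiable (at x)" "partial_deriv i a x = D i x"
proof -
  have "\<exists>g. \<forall>x\<in>S. (\<lambda>n. A n x) \<longlonglongrightarrow> g x \<and> (g has_derivative (\<lambda>h. \<Sum>i\<in>UNIV. h $ i * D i x)) (at x within S)"
  proof (rule has_derivative_sequence[OF S(2)])
    show "(A n has_derivative (\<lambda>h. \<Sum>i\<in>UNIV. h $ i * partial_deriv i (A n) x)) (at x within S)" if "x \<in> S" for n x
      using d[OF that] by (intro has_derivative_at_withinI[OF has_derivative_partials])
    fix e :: real assume "e > 0"
    define e' where "e' = e / CARD('n)"
    have e': "e' > 0" using \<open>e > 0\<close> by (simp add: e'_def)
    have "\<forall>\<^sub>F n in sequentially. \<forall>i\<in>UNIV. \<forall>x\<in>S. dist (partial_deriv i (A n) x) (D i x) < e'"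
      using u e' by (intro eventually_ball_finite) (auto simp: uniform_limit_iff)
    then show "\<forall>\<^sub>F n in sequentially. \<forall>x\<in>S. \<forall>h. norm ((\<Sum>i\<in>UNIV. h $ i * partial_deriv i (A n) x) - (\<Sum>i\<in>UNIV. h $ i * D i x)) \<le> e * norm h"
    proof eventually_elim
      case (elim n)
      show ?case
      proof (intro ballI allI)
        fix x h assume "x \<in> S"
        then have "\<bar>partial_deriv i (A n) x - D i x\<bar> \<le> e'" for i
          using elim by (auto simp: dist_real_def less_imp_le)
        from abs_sum_partials_le[of "\<lambda>i. partial_deriv i (A n) x - D i x", OF this, of h]
        show "norm ((\<Sum>i\<in>UNIV. h $ i * partial_deriv i (A n) x) - (\<Sum>i\<in>UNIV. h $ i * D i x)) \<le> e * norm h"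
          by (simp add: e'_def sum_subtractf[symmetric] right_diff_distrib)
      qed
    qed
  qed (use x l in auto)
  then obtain g where g: "\<And>x. x \<in> S \<Longrightarrow> (\<lambda>n. A n x) \<longlonglongrightarrow> g x"
    "\<And>x. x \<in> S \<Longrightarrow> (g has_derivative (\<lambda>h. \<Sum>i\<in>UNIV. h $ i * D i x)) (at x within S)" by blast
  have ga: "g y = a y" if "y \<in> S" for y
    by (rule LIMSEQ_unique[OF g(1)[OF that] l[OF that]])
  have "(g has_derivative (\<lambda>h. \<Sum>i\<in>UNIV. h $ i * D i x)) (at x)"
    using g(2)[OF x] unfolding at_within_open[OF x S(1)] .
  then have "(a has_derivative (\<lambda>h. \<Sum>i\<in>UNIV. h $ i * D i x)) (at x)"
    by (rule has_derivative_transform_within_open[OF _ S(1) x]) (simp add: ga)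
  from partial_derivI(1)[OF this] partial_derivI(2)[OF this, of i]
  show "a differentiable (at x)" "partial_deriv i a x = D i x"
    by (auto simp: axis_def if_distrib[of "\<lambda>t. t * _"] cong: if_cong)
qed

section \<open>The regularized Newton kernel\<close>

lemma has_derivative_q_powr:
  fixes z :: "'a::euclidean_space"
  assumes "e > 0"
  shows "((\<lambda>z. (z \<bullet> z + e) powr p) has_derivative (\<lambda>h. p * (z \<bullet> z + e) powr (p - 1) * (2 * (z \<bullet> h)))) (at z)"
proof -
  have q: "z \<bullet> z + e > 0" using assms by (simp add: add_nonneg_pos)
  have "((\<lambda>t. t powr p) has_real_derivative p * (z \<bullet> z + e) powr (p - 1)) (at (z \<bullet> z + e))"
    using q by (rule has_real_derivative_powr)
  moreover have "((\<lambda>z. z \<bullet> z + e) has_derivative (\<lambda>h. 2 * (z \<bullet> h))) (at z)"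
    by (auto intro!: derivative_eq_intros simp: inner_commute)
  ultimately show ?thesis
    using has_derivative_compose[of "\<lambda>z. z \<bullet> z + e" "\<lambda>h. 2 * (z \<bullet> h)" z UNIV "\<lambda>t. t powr p"]
    by (simp add: has_field_derivative_def)
qed

text \<open>Since \<open>0 powr p = 0\<close>, for \<open>e = 0\<close> this is the Newton kernel, with value \<open>0\<close> at the origin.\<close>

definition nker :: "real \<Rightarrow> real^'n::finite \<Rightarrow> real" where
  "nker e z = (z \<bullet> z + e) powr - (real CARD('n) / 2 - 1)"

text \<open>\<open>nker1\<close> and \<open>nker2\<close> are the first and second partial
  derivatives of \<open>nker e\<close> for \<open>e > 0\<close>. As explicit formulas they also make
  sense for \<open>e = 0\<close>, where, off the origin, they are the limits of the regularized
  kernels.\<close>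

definition nker1 :: "'n \<Rightarrow> real \<Rightarrow> real^'n::finite \<Rightarrow> real" where
  "nker1 i e z = (2 - real CARD('n)) * z $ i * (z \<bullet> z + e) powr - (real CARD('n) / 2)"

definition nker2 :: "'n \<Rightarrow> 'n \<Rightarrow> real \<Rightarrow> real^'n::finite \<Rightarrow> real" where
  "nker2 i j e z = (2 - real CARD('n)) * ((if i = j then 1 else 0) * (z \<bullet> z + e) powr - (real CARD('n) / 2)
    - CARD('n) * z $ i * z $ j * (z \<bullet> z + e) powr - (real CARD('n) / 2 + 1))"

lemma nker_partial_deriv:
  fixes z :: "real^'n::finite"
  assumes "e > 0"
  shows "nker e differentiable (at z)" "partial_deriv i (nker e) z = nker1 i e z"
proof -
  have "(nker e has_derivative (\<lambda>h. - (real CARD('n) / 2 - 1) * (z \<bullet> z + e) powr (- (real CARD('n) / 2 - 1) - 1) * (2 * (z \<bullet> h)))) (at z)"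
    unfolding nker_def[abs_def] by (rule has_derivative_q_powr[OF assms])
  from partial_derivI(1)[OF this] partial_derivI(2)[OF this, of i]
  show "nker e differentiable (at z)" "partial_deriv i (nker e) z = nker1 i e z"
    by (auto simp: nker1_def inner_axis algebra_simps)
qed

lemma nker1_partial_deriv:
  fixes z :: "real^'n::finite"
  assumes "e > 0"
  shows "nker1 i e differentiable (at z)" "partial_deriv j (nker1 i e) z = nker2 i j e z"
proof -
  have "((\<lambda>z. (2 - real CARD('n)) * z $ i * (z \<bullet> z + e) powr - (real CARD('n) / 2)) has_derivative
     (\<lambda>h. ((2 - real CARD('n)) * z $ i) * (- (real CARD('n) / 2) * (z \<bullet> z + e) powr (- (real CARD('n) / 2) - 1) * (2 * (z \<bullet> h))) +
          ((2 - real CARD('n)) * h $ i) * (z \<bullet> z + e) powr - (real CARD('n) / 2))) (at z)"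
    by (intro has_derivative_mult has_derivative_q_powr[OF assms] bounded_linear_imp_has_derivative
        bounded_linear_compose[OF bounded_linear_mult_right bounded_linear_vec_nth])
  moreover have ex: "- (real CARD('n) / 2) - 1 = - (real CARD('n) / 2 + 1)" by simp
  ultimately have "((\<lambda>z. (2 - real CARD('n)) * z $ i * (z \<bullet> z + e) powr - (real CARD('n) / 2)) has_derivative
     (\<lambda>h. ((2 - real CARD('n)) * z $ i) * (- (real CARD('n) / 2) * (z \<bullet> z + e) powr - (real CARD('n) / 2 + 1) * (2 * (z \<bullet> h))) +
          ((2 - real CARD('n)) * h $ i) * (z \<bullet> z + e) powr - (real CARD('n) / 2))) (at z)"
    by (simp only:)
  then have d: "(nker1 i e has_derivative
     (\<lambda>h. ((2 - real CARD('n)) * z $ i) * (- (real CARD('n) / 2) * (z \<bullet> z + e) powr - (real CARD('n) / 2 + 1) * (2 * (z \<bullet> h))) +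
          ((2 - real CARD('n)) * h $ i) * (z \<bullet> z + e) powr - (real CARD('n) / 2))) (at z)"
    unfolding nker1_def[abs_def] .
  have ax: "z \<bullet> axis j 1 = z $ j" "axis j 1 $ i = (if i = j then 1 else (0::real))"
    by (simp add: inner_axis) (simp add: axis_def)
  show "nker1 i e differentiable (at z)" "partial_deriv j (nker1 i e) z = nker2 i j e z"
    unfolding partial_derivI(2)[OF d] using partial_derivI(1)[OF d]
    by (simp, simp add: nker2_def ax algebra_simps)
qed

lemma continuous_on_q_powr:
  "e > 0 \<Longrightarrow> continuous_on S (\<lambda>z::'a::euclidean_space. (z \<bullet> z + e) powr p)"
  by (intro continuous_intros) (metis add_nonneg_pos inner_ge_zero less_irrefl)

lemma nker_C2:
  assumes "e > 0"
  shows "C_on 2 UNIV (nker e :: real^'n::finite \<Rightarrow> real)"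
    and "C_on 1 UNIV (nker e :: real^'n::finite \<Rightarrow> real)"
    and "C_on 1 UNIV (nker1 i e :: real^'n::finite \<Rightarrow> real)"
    and "partial_deriv i (nker e) = nker1 i e"
    and "partial_deriv j (nker1 i e) = nker2 i j e"
proof -
  show 1: "partial_deriv i (nker e) = nker1 i e" "partial_deriv j (nker1 i e) = nker2 i j e" for i j :: 'n
    using nker_partial_deriv[OF assms] nker1_partial_deriv[OF assms] by (auto simp: fun_eq_iff)
  have c: "continuous_on UNIV (nker2 i j e)" "continuous_on UNIV (nker1 i e)" for i j :: 'n
    unfolding nker2_def[abs_def] nker1_def[abs_def]
    by (intro continuous_intros continuous_on_q_powr assms; simp add: continuous_on_component)+
  have d: "nker e differentiable (at z)" "nker1 i e differentiable (at z)" for i and z :: "real^'n"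
    using nker_partial_deriv(1)[OF assms] nker1_partial_deriv(1)[OF assms] by auto
  show "C_on 2 UNIV (nker e :: real^'n::finite \<Rightarrow> real)" "C_on 1 UNIV (nker e :: real^'n::finite \<Rightarrow> real)"
    "C_on 1 UNIV (nker1 i e :: real^'n::finite \<Rightarrow> real)"
    using c d
    by (simp_all add: numeral_2_eq_2 1)
qed

lemma borel_measurable_nker [measurable]:
  "nker e \<in> borel_measurable borel" "nker1 i e \<in> borel_measurable borel" "nker2 i j e \<in> borel_measurable borel"
  unfolding nker_def[abs_def] nker1_def[abs_def] nker2_def[abs_def] by measurable

text \<open>Splitting a factor \<open>z \<bullet> z + e\<close> off the lower power cancels
  everything but \<open>e\<close>. For \<open>e = 0\<close> the sum is zero even at the origin,
  thanks to \<open>0 powr p = 0\<close>; for \<open>e > 0\<close> it is a rescaled integrable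
  profile.\<close>

lemma laplacian_nker:
  fixes z :: "real^'n::finite"
  assumes "e \<ge> 0"
  shows "(\<Sum>i\<in>UNIV. nker2 i i e z) =
    - ((real CARD('n) - 2) * CARD('n)) * e * (z \<bullet> z + e) powr - (real CARD('n) / 2 + 1)"
proof -
  let ?N = "real CARD('n)"
  have s: "(\<Sum>i\<in>UNIV. z $ i * z $ i) = z \<bullet> z" by (simp add: inner_vec_def)
  have "(\<Sum>i\<in>UNIV. nker2 i i e z) = (2 - ?N) * (?N * (z \<bullet> z + e) powr - (?N / 2)
      - ?N * (\<Sum>i\<in>UNIV. z $ i * z $ i) * (z \<bullet> z + e) powr - (?N / 2 + 1))"
    by (simp add: nker2_def sum_subtractf sum_distrib_left sum_distrib_right right_diff_distrib mult_ac)
  also have "(z \<bullet> z + e) powr - (?N / 2) = (z \<bullet> z + e) * (z \<bullet> z + e) powr - (?N / 2 + 1)"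
  proof (cases "z \<bullet> z + e = 0")
    case False
    then have "z \<bullet> z + e > 0" using assms by (metis add_nonneg_nonneg inner_ge_zero order_le_less)
    then show ?thesis using powr_add[of "z \<bullet> z + e" 1 "- (?N / 2 + 1)"] by simp
  qed simp
  finally show ?thesis by (simp add: s algebra_simps)
qed

section \<open>Kernel bounds uniform in the regularization parameter\<close>

lemma powr_diff_le:
  fixes s e p :: real
  assumes "s > 0" "e \<ge> 0" "p \<ge> 0"
  shows "\<bar>(s + e) powr - p - s powr - p\<bar> \<le> p * e * s powr (- p - 1)"
proof (cases "e = 0")
  case False
  have "\<exists>z>s. z < s + e \<and> (s + e) powr - p - s powr - p = (s + e - s) * (- p * z powr (- p - 1))"
    using assms False by (intro MVT2) (auto intro!: derivative_eq_intros)
  then obtain z where z: "z > s" "(s + e) powr - p - s powr - p = e * (- p * z powr (- p - 1))" by auto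
  have "z powr (- p - 1) \<le> s powr (- p - 1)"
    using z assms by (intro powr_mono2') auto
  then have "e * (p * z powr (- p - 1)) \<le> e * (p * s powr (- p - 1))"
    using assms by (intro mult_left_mono) auto
  then show ?thesis using z assms by (simp add: abs_mult mult_ac)
qed simp

text \<open>\<open>k\<close> is the order of the singularity. Since \<open>e\<close> is added to
  |z|^2, a factor \<open>e\<close> in the error costs two further powers of \<open>norm z\<close>.
  Exempting \<open>z = 0\<close> costs only a null set in the convolutions.\<close>

definition kernel_bound :: "(real \<Rightarrow> 'a::euclidean_space \<Rightarrow> real) \<Rightarrow> real \<Rightarrow> real \<Rightarrow> bool" where
  "kernel_bound K k C \<longleftrightarrow> C \<ge> 0 \<and> (\<forall>e. K e \<in> borel_measurable borel) \<and>
    (\<forall>e z. e \<ge> 0 \<longrightarrow> z \<noteq> 0 \<longrightarrow> \<bar>K e z\<bar> \<le> C * norm z powr - k \<and>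
      \<bar>K e z - K 0 z\<bar> \<le> C * e * norm z powr (- k - 2))"

lemma q_powr_bounds:
  fixes z :: "'a::euclidean_space"
  assumes "z \<noteq> 0" "e \<ge> 0" "p \<ge> 0"
  shows "0 \<le> (z \<bullet> z + e) powr - p" "(z \<bullet> z + e) powr - p \<le> norm z powr - (2 * p)"
    and "\<bar>(z \<bullet> z + e) powr - p - (z \<bullet> z + 0) powr - p\<bar> \<le> p * e * norm z powr (- (2 * p) - 2)"
proof -
  have n: "(z \<bullet> z) powr a = norm z powr (2 * a)" for a
    using assms(1) by (simp add: power2_norm_eq_inner[symmetric] powr_powr flip: powr_numeral)
  show "0 \<le> (z \<bullet> z + e) powr - p" by simp
  have "(z \<bullet> z + e) powr - p \<le> (z \<bullet> z) powr - p"
    using assms by (intro powr_mono2') auto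
  then show "(z \<bullet> z + e) powr - p \<le> norm z powr - (2 * p)" by (simp add: n)
  show "\<bar>(z \<bullet> z + e) powr - p - (z \<bullet> z + 0) powr - p\<bar> \<le> p * e * norm z powr (- (2 * p) - 2)"
    using powr_diff_le[of "z \<bullet> z" e p] assms by (simp add: n algebra_simps)
qed

lemma kernel_bound_mult:
  assumes K: "kernel_bound K k C" and c: "c \<in> borel_measurable borel" "\<And>z. z \<noteq> 0 \<Longrightarrow> \<bar>c z\<bar> \<le> D * norm z powr m" "D \<ge> 0"
  shows "kernel_bound (\<lambda>e z. c z * K e z) (k - m) (D * C)"
  unfolding kernel_bound_def
proof (intro conjI allI impI)
  fix e :: real and z :: 'a assume a: "e \<ge> 0" "z \<noteq> 0"
  have b: "\<bar>K e z\<bar> \<le> C * norm z powr - k" "\<bar>K e z - K 0 z\<bar> \<le> C * e * norm z powr (- k - 2)" and C: "C \<ge> 0"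
    using K a by (auto simp: kernel_bound_def)
  have "\<bar>c z * K e z\<bar> \<le> (D * norm z powr m) * (C * norm z powr - k)"
    unfolding abs_mult using b c(3) c(2)[OF a(2)] C by (intro mult_mono) auto
  also have "\<dots> = D * C * norm z powr - (k - m)"
    by (simp add: powr_add[symmetric] mult_ac)
  finally show "\<bar>c z * K e z\<bar> \<le> D * C * norm z powr - (k - m)" .
  have "\<bar>c z * (K e z - K 0 z)\<bar> \<le> (D * norm z powr m) * (C * e * norm z powr (- k - 2))"
    unfolding abs_mult using b c(3) c(2)[OF a(2)] C a by (intro mult_mono) auto
  also have "\<dots> = D * C * e * (norm z powr m * norm z powr (- k - 2))" by simp
  also have "norm z powr m * norm z powr (- k - 2) = norm z powr (- (k - m) - 2)"
    by (simp add: powr_add[symmetric] algebra_simps)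
  finally show "\<bar>c z * K e z - c z * K 0 z\<bar> \<le> D * C * e * norm z powr (- (k - m) - 2)"
    by (simp add: right_diff_distrib)
qed (use K c in \<open>auto simp: kernel_bound_def intro!: borel_measurable_times\<close>)

lemma kernel_bound_add:
  assumes "kernel_bound K k C" "kernel_bound K' k C'"
  shows "kernel_bound (\<lambda>e z. K e z + K' e z) k (C + C')"
  unfolding kernel_bound_def
proof (intro conjI allI impI)
  fix e :: real and z :: 'a assume a: "e \<ge> 0" "z \<noteq> 0"
  have b: "\<bar>K e z\<bar> \<le> C * norm z powr - k" "\<bar>K e z - K 0 z\<bar> \<le> C * e * norm z powr (- k - 2)"
    "\<bar>K' e z\<bar> \<le> C' * norm z powr - k" "\<bar>K' e z - K' 0 z\<bar> \<le> C' * e * norm z powr (- k - 2)"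
    using assms a by (auto simp: kernel_bound_def)
  show "\<bar>K e z + K' e z\<bar> \<le> (C + C') * norm z powr - k"
    using b(1,3) unfolding distrib_right by linarith
  show "\<bar>K e z + K' e z - (K 0 z + K' 0 z)\<bar> \<le> (C + C') * e * norm z powr (- k - 2)"
    using b(2,4) unfolding distrib_right by linarith
qed (use assms in \<open>auto simp: kernel_bound_def intro!: borel_measurable_add\<close>)

lemma kernel_bound_q_powr:
  assumes "p \<ge> 0"
  shows "kernel_bound (\<lambda>e (z::'a::euclidean_space). (z \<bullet> z + e) powr - p) (2 * p) (p + 1)"
  unfolding kernel_bound_def
proof (intro conjI allI impI)
  fix e :: real and z :: 'a assume a: "e \<ge> 0" "z \<noteq> 0"
  note b = q_powr_bounds[OF a(2,1) assms]
  have "1 * norm z powr - (2 * p) \<le> (p + 1) * norm z powr - (2 * p)"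
    using assms by (intro mult_right_mono) auto
  then show "\<bar>(z \<bullet> z + e) powr - p\<bar> \<le> (p + 1) * norm z powr - (2 * p)"
    using b(1,2) by linarith
  have "p * e * norm z powr (- (2 * p) - 2) \<le> (p + 1) * e * norm z powr (- (2 * p) - 2)"
    using assms a by (intro mult_right_mono) auto
  then show "\<bar>(z \<bullet> z + e) powr - p - (z \<bullet> z + 0) powr - p\<bar> \<le> (p + 1) * e * norm z powr (- (2 * p) - 2)"
    using b(3) by linarith
qed (use assms in auto)

text \<open>Each differentiation raises the order by one. The orders \<open>CARD('n) - 2\<close> and
  \<open>CARD('n) - 1\<close> are locally integrable, while \<open>nker2\<close> reaches the
  critical order, at which the density has to supply a Hoelder gain.\<close>

lemma kernel_bound_nker:
  assumes N: "CARD('n::finite) \<ge> 3"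
  shows "\<exists>C. kernel_bound (nker :: real \<Rightarrow> real^'n \<Rightarrow> real) (real CARD('n) - 2) C"
    and "\<exists>C. kernel_bound (nker1 i :: real \<Rightarrow> real^'n \<Rightarrow> real) (real CARD('n) - 1) C"
    and "\<exists>C. kernel_bound (nker2 i j :: real \<Rightarrow> real^'n \<Rightarrow> real) (real CARD('n)) C"
proof -
  let ?N = "real CARD('n)"
  have N3: "?N \<ge> 3" using N by simp
  note q = kernel_bound_q_powr[where 'a = "real^'n"]
  have "nker = (\<lambda>e (z::real^'n). (z \<bullet> z + e) powr - (?N / 2 - 1))"
    by (simp add: nker_def fun_eq_iff)
  with q[of "?N / 2 - 1"] N3
  show "\<exists>C. kernel_bound (nker :: real \<Rightarrow> real^'n \<Rightarrow> real) (?N - 2) C" by auto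
  have "kernel_bound (\<lambda>e (z::real^'n). ((2 - ?N) * z $ i) * (z \<bullet> z + e) powr - (?N / 2)) (2 * (?N / 2) - 1) (?N * (?N / 2 + 1))"
  proof (rule kernel_bound_mult[OF q])
    show "\<bar>(2 - ?N) * z $ i\<bar> \<le> ?N * norm z powr 1" if "z \<noteq> 0" for z :: "real^'n"
      using N3 unfolding abs_mult by (intro mult_mono) (auto simp: component_le_norm_cart)
  qed (use N3 in auto)
  then have "kernel_bound (nker1 i :: real \<Rightarrow> real^'n \<Rightarrow> real) (?N - 1) (?N * (?N / 2 + 1))"
    by (simp add: nker1_def[abs_def])
  then show "\<exists>C. kernel_bound (nker1 i :: real \<Rightarrow> real^'n \<Rightarrow> real) (?N - 1) C" ..
  have a: "kernel_bound (\<lambda>e (z::real^'n). ((2 - ?N) * (if i = j then 1 else 0)) * (z \<bullet> z + e) powr - (?N / 2)) (2 * (?N / 2) - 0) (?N * (?N / 2 + 1))"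
    by (rule kernel_bound_mult[OF q]) (use N3 in auto)
  have b: "kernel_bound (\<lambda>e (z::real^'n). ((?N - 2) * ?N * z $ i * z $ j) * (z \<bullet> z + e) powr - (?N / 2 + 1)) (2 * (?N / 2 + 1) - 2) (?N * ?N * (?N / 2 + 1 + 1))"
  proof (rule kernel_bound_mult[OF q])
    fix z :: "real^'n" assume "z \<noteq> 0"
    have "\<bar>(?N - 2) * ?N * (z $ i * z $ j)\<bar> \<le> (?N * ?N) * (norm z * norm z)"
      using N3 unfolding abs_mult by (intro mult_mono) (auto simp: component_le_norm_cart)
    then show "\<bar>(?N - 2) * ?N * z $ i * z $ j\<bar> \<le> ?N * ?N * norm z powr 2"
      by (simp add: power2_eq_square mult_ac)
  qed (use N3 in auto)
  from kernel_bound_add[OF a, of _ "?N * ?N * (?N / 2 + 1 + 1)"] b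
  have "kernel_bound (\<lambda>e (z::real^'n). ((2 - ?N) * (if i = j then 1 else 0)) * (z \<bullet> z + e) powr - (?N / 2) +
      ((?N - 2) * ?N * z $ i * z $ j) * (z \<bullet> z + e) powr - (?N / 2 + 1)) ?N (?N * (?N / 2 + 1) + ?N * ?N * (?N / 2 + 1 + 1))"
    by simp
  also have "(\<lambda>e (z::real^'n). ((2 - ?N) * (if i = j then 1 else 0)) * (z \<bullet> z + e) powr - (?N / 2) +
      ((?N - 2) * ?N * z $ i * z $ j) * (z \<bullet> z + e) powr - (?N / 2 + 1)) = nker2 i j"
  proof (intro ext)
    fix e and z :: "real^'n"
    have "(2 - ?N) * d * Q + (?N - 2) * ?N * z $ i * z $ j * P =
        (2 - ?N) * (d * Q - ?N * z $ i * z $ j * P)" for d P Q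
      by (simp add: algebra_simps)
    then show "((2 - ?N) * (if i = j then 1 else 0)) * (z \<bullet> z + e) powr - (?N / 2) +
      ((?N - 2) * ?N * z $ i * z $ j) * (z \<bullet> z + e) powr - (?N / 2 + 1) = nker2 i j e z"
      unfolding nker2_def by (simp only:)
  qed
  finally show "\<exists>C. kernel_bound (nker2 i j :: real \<Rightarrow> real^'n \<Rightarrow> real) ?N C" ..
qed

text \<open>These bounds blow up as \<open>e\<close> tends to zero and serve only to differentiate
  under the integral for one fixed \<open>e\<close>. Each coordinate of \<open>z\<close> is absorbed
  as half a power of \<open>z \<bullet> z + e\<close>.\<close>

lemma nker_bounded:
  assumes N: "CARD('n::finite) \<ge> 3" and "e > 0"
  shows "\<exists>B. (\<forall>z::real^'n. \<bar>nker e z\<bar> \<le> B) \<and> (\<forall>i (z::real^'n). \<bar>nker1 i e z\<bar> \<le> B) \<and>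
    (\<forall>i j (z::real^'n). \<bar>nker2 i j e z\<bar> \<le> B)"
proof -
  let ?N = "real CARD('n)"
  have N3: "?N \<ge> 3" using N by simp
  have q: "(z \<bullet> z + e) powr - p \<le> e powr - p" if "p \<ge> 0" for p and z :: "real^'n"
    using that \<open>e > 0\<close> by (intro powr_mono2') auto
  have c: "\<bar>z $ i\<bar> \<le> (z \<bullet> z + e) powr (1/2)" for i and z :: "real^'n"
  proof -
    have "\<bar>z $ i\<bar> \<le> norm z" by (rule component_le_norm_cart)
    also have "\<dots> \<le> sqrt (z \<bullet> z + e)" using \<open>e > 0\<close> by (simp add: norm_eq_sqrt_inner)
    finally show ?thesis using \<open>e > 0\<close> by (simp add: powr_half_sqrt)
  qed
  define B0 where "B0 = e powr - (?N / 2 - 1)"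
  define B1 where "B1 = ?N * e powr - (?N / 2 - 1 / 2)"
  define B2 where "B2 = (?N + ?N * ?N) * e powr - (?N / 2)"
  have b0: "\<bar>nker e z\<bar> \<le> B0" for z :: "real^'n"
    using q[of "?N / 2 - 1" z] N3 by (simp add: nker_def B0_def)
  have b1: "\<bar>nker1 i e z\<bar> \<le> B1" for i and z :: "real^'n"
  proof -
    have "\<bar>nker1 i e z\<bar> = (?N - 2) * (\<bar>z $ i\<bar> * (z \<bullet> z + e) powr - (?N / 2))"
      using N3 by (simp add: nker1_def abs_mult)
    also have "\<dots> \<le> ?N * ((z \<bullet> z + e) powr (1/2) * (z \<bullet> z + e) powr - (?N / 2))"
      using N3 c by (intro mult_mono) auto
    also have "(z \<bullet> z + e) powr (1/2) * (z \<bullet> z + e) powr - (?N / 2) = (z \<bullet> z + e) powr - (?N / 2 - 1 / 2)"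
      by (simp add: powr_add[symmetric] algebra_simps)
    also have "?N * \<dots> \<le> B1"
      unfolding B1_def using q[of "?N / 2 - 1 / 2" z] N3 by (intro mult_left_mono) auto
    finally show ?thesis .
  qed
  have b2: "\<bar>nker2 i j e z\<bar> \<le> B2" for i j and z :: "real^'n"
  proof -
    let ?A = "(if i = j then 1 else 0) * (z \<bullet> z + e) powr - (?N / 2)"
    let ?B = "?N * (z $ i * z $ j) * (z \<bullet> z + e) powr - (?N / 2 + 1)"
    have A: "\<bar>?A\<bar> \<le> e powr - (?N / 2)" using q[of "?N / 2" z] by auto
    have "\<bar>z $ i * z $ j\<bar> \<le> (z \<bullet> z + e) powr (1/2) * (z \<bullet> z + e) powr (1/2)"
      unfolding abs_mult by (intro mult_mono c) auto
    then have "\<bar>?B\<bar> \<le> ?N * ((z \<bullet> z + e) powr (1/2) * (z \<bullet> z + e) powr (1/2)) * (z \<bullet> z + e) powr - (?N / 2 + 1)"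
      unfolding abs_mult[of "?N * (z $ i * z $ j)"] abs_mult[of "?N"]
      by (intro mult_mono) auto
    also have "\<dots> = ?N * (z \<bullet> z + e) powr - (?N / 2)"
      unfolding mult.assoc powr_add[symmetric] by (simp add: algebra_simps)
    also have "\<dots> \<le> ?N * e powr - (?N / 2)"
      using q[of "?N / 2" z] by (intro mult_left_mono) auto
    finally have B: "\<bar>?B\<bar> \<le> ?N * e powr - (?N / 2)" .
    have "nker2 i j e z = (2 - ?N) * (?A - ?B)"
      unfolding nker2_def by (simp only: mult.assoc)
    then have "\<bar>nker2 i j e z\<bar> = (?N - 2) * \<bar>?A - ?B\<bar>" using N3 by (simp add: abs_mult)
    also have "\<dots> \<le> ?N * (e powr - (?N / 2) + ?N * e powr - (?N / 2))"
      using N3 by (intro mult_mono order_trans[OF abs_triangle_ineq4 add_mono[OF A B]]) auto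
    finally show ?thesis by (simp add: B2_def algebra_simps)
  qed
  show ?thesis
    by (intro exI[of _ "max B0 (max B1 B2)"]) (use b0 b1 b2 in \<open>auto simp: le_max_iff_disj\<close>)
qed

section \<open>First derivatives of Newtonian potentials\<close>

text \<open>For \<open>e\<close> at most |z|^2 the linear bound is weakened to the power
  \<open>t\<close>; for larger \<open>e\<close> the bounds on the two kernels separately suffice.
  The gain \<open>e powr t\<close> costs only \<open>2 * t\<close> powers of \<open>norm z\<close>,
  whereas the linear bound costs two and could destroy integrability.\<close>

lemma kernel_bound_interpolate:
  assumes K: "kernel_bound K k C" and t: "0 < t" "t \<le> 1" and z: "z \<noteq> 0" "e \<ge> 0"
  shows "\<bar>K e z - K 0 z\<bar> \<le> 2 * C * e powr t * norm z powr - (k + 2 * t)"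
proof -
  have C: "C \<ge> 0" and b: "\<bar>K e z\<bar> \<le> C * norm z powr - k" "\<bar>K 0 z\<bar> \<le> C * norm z powr - k"
    "\<bar>K e z - K 0 z\<bar> \<le> C * e * norm z powr (- k - 2)"
    using K z by (auto simp: kernel_bound_def)
  have n2: "(norm z)\<^sup>2 powr a = norm z powr (2 * a)" for a
    using z by (simp add: powr_powr flip: powr_numeral)
  show ?thesis
  proof (cases "e \<le> (norm z)\<^sup>2")
    case True
    show ?thesis
    proof (cases "e = 0")
      case False
      have "e = e powr t * e powr (1 - t)" using False z by (simp add: powr_add[symmetric])
      also have "\<dots> \<le> e powr t * (norm z)\<^sup>2 powr (1 - t)"
        using True z t by (intro mult_left_mono powr_mono2) auto
      finally have "C * e * norm z powr (- k - 2) \<le> C * (e powr t * norm z powr (2 * (1 - t))) * norm z powr (- k - 2)"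
        using C n2 by (intro mult_right_mono mult_left_mono) auto
      also have "\<dots> = C * e powr t * (norm z powr (2 * (1 - t)) * norm z powr (- k - 2))" by simp
      also have "norm z powr (2 * (1 - t)) * norm z powr (- k - 2) = norm z powr - (k + 2 * t)"
        by (simp add: powr_add[symmetric] algebra_simps)
      also have "C * e powr t * norm z powr - (k + 2 * t) \<le> 2 * C * e powr t * norm z powr - (k + 2 * t)"
        using C by (intro mult_right_mono) auto
      finally show ?thesis using b(3) by linarith
    qed (use C in simp)
  next
    case False
    have "\<bar>K e z - K 0 z\<bar> \<le> 2 * C * norm z powr - k" using b by linarith
    also have "norm z powr - k = norm z powr (2 * t) * norm z powr - (k + 2 * t)"
      by (simp add: powr_add[symmetric])
    also have "norm z powr (2 * t) \<le> e powr t"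
      using powr_mono2[of t "(norm z)\<^sup>2" e] False t by (simp add: n2)
    finally show ?thesis using C by (simp add: mult_left_mono mult_right_mono mult.assoc)
  qed
qed

text \<open>Split at distance \<open>R\<close>: near \<open>x\<close> the vanishing of
  \<open>w x\<close> to order \<open>\<theta>\<close> lowers the singularity to
  \<open>k - \<theta>\<close>, below the dimension; far away the kernel is bounded and
  \<open>w x\<close> is integrable. The density may depend on \<open>x\<close> so that, for second
  derivatives, a multiple of a cutoff centred at \<open>x\<close> can be subtracted from it.\<close>

lemma
  fixes K :: "real \<Rightarrow> 'a::euclidean_space \<Rightarrow> real" and w :: "'a \<Rightarrow> 'a \<Rightarrow> real"
  assumes K: "kernel_bound K k C" and k: "0 \<le> \<theta>" "\<theta> \<le> k" "k - \<theta> < DIM('a)"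
    and R: "R > 0" and H: "H \<ge> 0"
    and w1: "\<And>x. x \<in> S \<Longrightarrow> integrable lebesgue (w x)"
    and w2: "\<And>x. x \<in> S \<Longrightarrow> AE y in lebesgue. norm (x - y) \<le> R \<longrightarrow> y \<noteq> x \<longrightarrow> \<bar>w x y\<bar> \<le> H * norm (x - y) powr \<theta>"
    and w3: "\<And>x. x \<in> S \<Longrightarrow> (LINT y|lebesgue. \<bar>w x y\<bar>) \<le> W"
  shows kernel_convolution_integrable:
      "\<And>x e. x \<in> S \<Longrightarrow> e \<ge> 0 \<Longrightarrow> integrable lebesgue (\<lambda>y. K e (x - y) * w x y)"
    and kernel_convolution_limit:
      "uniform_limit S (\<lambda>n x. LINT y|lebesgue. K (inverse (real (Suc n))) (x - y) * w x y)
         (\<lambda>x. LINT y|lebesgue. K 0 (x - y) * w x y) sequentially"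
proof -
  have C: "C \<ge> 0" and Km [measurable]: "K e \<in> borel_measurable borel" for e
    using K by (auto simp: kernel_bound_def)
  have Kx: "(\<lambda>y. K e (x - y)) \<in> borel_measurable lebesgue" for e x
    by (intro borel_imp_lebesgue_measurable) simp
  have nx: "AE y in lebesgue. y \<noteq> x" for x :: 'a
    using AE_lborel_singleton[of x] by (rule AE_completion)
  have dom: "AE y in lebesgue. \<bar>L y * w x y\<bar> \<le>
      D * H * (norm (x - y) powr - (q - \<theta>) * indicator (cball x R) y) + D' * \<bar>w x y\<bar>"
    if x: "x \<in> S" and D: "D \<ge> 0" "D' \<ge> 0"
      and L: "\<And>y. y \<noteq> x \<Longrightarrow> \<bar>L y\<bar> \<le> D * norm (x - y) powr - q"
        "\<And>y. norm (x - y) > R \<Longrightarrow> \<bar>L y\<bar> \<le> D'" for L D D' q x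
    using w2[OF x] nx[of x]
  proof eventually_elim
    case (elim y)
    show ?case
    proof (cases "norm (x - y) \<le> R")
      case True
      have "\<bar>L y * w x y\<bar> \<le> (D * norm (x - y) powr - q) * (H * norm (x - y) powr \<theta>)"
        unfolding abs_mult using True elim L(1) D by (intro mult_mono) auto
      also have "\<dots> = D * H * (norm (x - y) powr - (q - \<theta>))"
        by (simp add: powr_add[symmetric] mult_ac)
      finally have "\<bar>L y * w x y\<bar> \<le> D * H * (norm (x - y) powr - (q - \<theta>))" .
      moreover have "0 \<le> D' * \<bar>w x y\<bar>" using D by simp
      ultimately show ?thesis using True by (simp add: dist_norm)
    next
      case False
      then have "\<bar>L y * w x y\<bar> \<le> D' * \<bar>w x y\<bar>"
        unfolding abs_mult using L(2)[of y] by (intro mult_right_mono) auto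
      then show ?thesis using False by (simp add: dist_norm)
    qed
  qed
  show int: "integrable lebesgue (\<lambda>y. K e (x - y) * w x y)" if x: "x \<in> S" and e: "e \<ge> 0" for x e
  proof -
    obtain C0 where C0: "\<And>x::'a. integrable lebesgue (\<lambda>y. norm (x - y) powr - (k - \<theta>) * indicator (cball x R) y)"
      using integrable_norm_powr[of "k - \<theta>" R, where 'a = 'a] k R by auto
    have "AE y in lebesgue. \<bar>K e (x - y) * w x y\<bar> \<le>
      C * H * (norm (x - y) powr - (k - \<theta>) * indicator (cball x R) y) + C * R powr - k * \<bar>w x y\<bar>"
    proof (rule dom[OF x])
      show "\<bar>K e (x - y)\<bar> \<le> C * norm (x - y) powr - k" if "y \<noteq> x" for y
        using K e that by (simp add: kernel_bound_def)
      moreover have "norm (x - y) powr - k \<le> R powr - k" if "norm (x - y) > R" for y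
        using that R k by (intro powr_mono2') auto
      ultimately show "\<bar>K e (x - y)\<bar> \<le> C * R powr - k" if "norm (x - y) > R" for y
        using that R C by (metis norm_zero diff_self less_asym mult_left_mono order_trans)
    qed (use C in auto)
    then show ?thesis
      using w1[OF x] C0[of x] Kx[of e x]
      by (intro Bochner_Integration.integrable_bound[where g = "\<lambda>y. K e (x - y) * w x y" and
        f = "\<lambda>y. C * H * (norm (x - y) powr - (k - \<theta>) * indicator (cball x R) y) + C * R powr - k * \<bar>w x y\<bar>"])
        (auto elim!: eventually_mono)
  qed
  \<comment> \<open>At most a quarter of the room between \<open>k - \<theta>\<close> and the
    dimension, so the exponent \<open>k + 2 * t - \<theta>\<close> remains integrable.\<close>
  define t where "t = min 1 ((DIM('a) - (k - \<theta>)) / 4)"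
  have t: "0 < t" "t \<le> 1" using k by (auto simp: t_def)
  have "t \<le> (DIM('a) - (k - \<theta>)) / 4" unfolding t_def by (rule min.cobounded2)
  then have t3: "k + 2 * t - \<theta> < DIM('a)" using k by simp
  obtain C1 where C1: "C1 \<ge> 0"
    "\<And>x::'a. integrable lebesgue (\<lambda>y. norm (x - y) powr - (k + 2 * t - \<theta>) * indicator (cball x R) y)"
    "\<And>x::'a. (LINT y|lebesgue. norm (x - y) powr - (k + 2 * t - \<theta>) * indicator (cball x R) y) \<le> C1"
    using integrable_norm_powr[of "k + 2 * t - \<theta>" R, where 'a = 'a] k R t t3 by force
  define B where "B = 2 * C * H * C1 + C * R powr (- k - 2) * W"
  have bound: "\<bar>(LINT y|lebesgue. K e (x - y) * w x y) - (LINT y|lebesgue. K 0 (x - y) * w x y)\<bar> \<le> B * e powr t"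
    if x: "x \<in> S" and e: "0 < e" "e \<le> 1" for x e
  proof -
    let ?F = "\<lambda>y. 2 * C * e powr t * H * (norm (x - y) powr - (k + 2 * t - \<theta>) * indicator (cball x R) y) +
        C * e powr t * R powr (- k - 2) * \<bar>w x y\<bar>"
    \<comment> \<open>The far part converges linearly in \<open>e\<close>; as
      \<open>e \<le> 1\<close> and \<open>t \<le> 1\<close>, this is covered by the rate
      \<open>e powr t\<close>.\<close>
    have e1: "e \<le> e powr t" using e t powr_mono'[of t 1 e] by simp
    have ae: "AE y in lebesgue. \<bar>(K e (x - y) - K 0 (x - y)) * w x y\<bar> \<le> ?F y"
    proof (rule dom[OF x])
      show "\<bar>K e (x - y) - K 0 (x - y)\<bar> \<le> 2 * C * e powr t * norm (x - y) powr - (k + 2 * t)" if "y \<noteq> x" for y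
        using kernel_bound_interpolate[OF K t(1,2)] e that by simp
      show "\<bar>K e (x - y) - K 0 (x - y)\<bar> \<le> C * e powr t * R powr (- k - 2)" if "norm (x - y) > R" for y
      proof -
        have "x - y \<noteq> 0" using that R by auto
        then have "\<bar>K e (x - y) - K 0 (x - y)\<bar> \<le> C * e * norm (x - y) powr (- k - 2)"
          using K e by (auto simp: kernel_bound_def)
        also have "\<dots> \<le> C * e powr t * R powr (- k - 2)"
          using that R k C e e1 powr_mono2'[of "- k - 2" R "norm (x - y)"] by (intro mult_mono) auto
        finally show ?thesis .
      qed
    qed (use C in auto)
    have i: "integrable lebesgue (\<lambda>y. (K e (x - y) - K 0 (x - y)) * w x y)"
      using int[OF x, of e] int[OF x, of 0] e by (simp add: left_diff_distrib)
    have F: "integrable lebesgue ?F" using C1(2) w1[OF x] by simp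
    have "(LINT y|lebesgue. K e (x - y) * w x y) - (LINT y|lebesgue. K 0 (x - y) * w x y) =
        (LINT y|lebesgue. (K e (x - y) - K 0 (x - y)) * w x y)"
      using int[OF x, of e] int[OF x, of 0] e by (simp add: left_diff_distrib)
    also have "\<bar>\<dots>\<bar> \<le> (LINT y|lebesgue. \<bar>(K e (x - y) - K 0 (x - y)) * w x y\<bar>)"
      by (rule integral_abs_bound)
    also have "\<dots> \<le> (LINT y|lebesgue. ?F y)"
      using i F ae by (intro integral_mono_AE integrable_abs) auto
    also have "\<dots> = 2 * C * e powr t * H * (LINT y|lebesgue. norm (x - y) powr - (k + 2 * t - \<theta>) * indicator (cball x R) y)
        + C * e powr t * R powr (- k - 2) * (LINT y|lebesgue. \<bar>w x y\<bar>)"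
      using C1(2)[of x] w1[OF x] by (subst Bochner_Integration.integral_add) (auto intro!: integrable_mult_right)
    also have "\<dots> \<le> 2 * C * e powr t * H * C1 + C * e powr t * R powr (- k - 2) * W"
      using C H w3[OF x] C1(3)[of x] by (intro add_mono mult_left_mono) auto
    also have "\<dots> = B * e powr t" by (simp add: B_def algebra_simps)
    finally show ?thesis .
  qed
  have lim: "(\<lambda>n. B * inverse (real (Suc n)) powr t) \<longlonglongrightarrow> 0"
  proof -
    have "(\<lambda>n. inverse (real (Suc n)) powr t) \<longlonglongrightarrow> 0 powr t"
      using t by (intro tendsto_powr' LIMSEQ_inverse_real_of_nat tendsto_const) auto
    from tendsto_mult_left[OF this, of B] show ?thesis by simp
  qed
  show "uniform_limit S (\<lambda>n x. LINT y|lebesgue. K (inverse (real (Suc n))) (x - y) * w x y)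
         (\<lambda>x. LINT y|lebesgue. K 0 (x - y) * w x y) sequentially"
  proof (rule uniform_limitI)
    fix \<epsilon> :: real assume "\<epsilon> > 0"
    then have "\<forall>\<^sub>F n in sequentially. B * inverse (real (Suc n)) powr t < \<epsilon>"
      using order_tendstoD(2)[OF lim] by auto
    then show "\<forall>\<^sub>F n in sequentially. \<forall>x\<in>S. dist (LINT y|lebesgue. K (inverse (real (Suc n))) (x - y) * w x y)
        (LINT y|lebesgue. K 0 (x - y) * w x y) < \<epsilon>"
    proof eventually_elim
      case (elim n)
      have "inverse (real (Suc n)) \<le> 1" by (simp add: field_simps)
      with elim bound[of _ "inverse (real (Suc n))"] show ?case
        unfolding dist_real_def by (force intro: le_less_trans)
    qed
  qed
qed

text \<open>The unnormalized Newtonian potential: in the sense of distributions its Laplacian is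
  \<open>- newton_const\<close> times \<open>g\<close>. The compensating division is part of
  \<open>source\<close>.\<close>

definition npot :: "(real^'n::finite \<Rightarrow> real) \<Rightarrow> real^'n \<Rightarrow> real" where
  "npot g x = (LINT y|lebesgue. nker 0 (x - y) * g y)"

text \<open>Local boundedness tames the singularity of the kernel, integrability the tail. The class
  is stable under multiplication by bounded measurable functions, so it contains the sources of all
  bounded positive measurable \<open>u\<close> once it contains \<open>\<rho>\<close>.\<close>

definition potential_density :: "(real^'n::finite \<Rightarrow> real) \<Rightarrow> bool" where
  "potential_density g \<longleftrightarrow> integrable lebesgue g \<and>
    (\<forall>R. \<exists>M. AE y in lebesgue. norm y \<le> R \<longrightarrow> \<bar>g y\<bar> \<le> M)"

text \<open>Shaped as the near-diagonal hypothesis of \<open>kernel_convolution_limit\<close> with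
  \<open>\<theta> = 0\<close>. The premise \<open>y \<noteq> x\<close> is there because
  \<open>0 powr 0 = 0\<close>.\<close>

lemma potential_density_near:
  assumes "potential_density g"
  shows "\<exists>M\<ge>0. \<forall>x. norm x \<le> R \<longrightarrow> (AE y in lebesgue. norm (x - y) \<le> 1 \<longrightarrow> y \<noteq> x \<longrightarrow> \<bar>g y\<bar> \<le> M * norm (x - y) powr 0)"
proof -
  obtain M where M: "AE y in lebesgue. norm y \<le> R + 1 \<longrightarrow> \<bar>g y\<bar> \<le> M"
    using assms by (auto simp: potential_density_def)
  show ?thesis
  proof (intro exI[of _ "max M 0"] conjI allI impI)
    fix x :: "real^'a" assume x: "norm x \<le> R"
    show "AE y in lebesgue. norm (x - y) \<le> 1 \<longrightarrow> y \<noteq> x \<longrightarrow> \<bar>g y\<bar> \<le> max M 0 * norm (x - y) powr 0"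
      using M
    proof eventually_elim
      case (elim y)
      have "norm y \<le> norm x + norm (x - y)"
        by (metis add.commute norm_minus_commute norm_triangle_sub)
      then show ?case using elim x by auto
    qed
  qed simp
qed

lemma kernel_density_limit:
  fixes K :: "real \<Rightarrow> real^'n::finite \<Rightarrow> real"
  assumes K: "kernel_bound K k C" "0 \<le> k" "k < CARD('n)" and g: "potential_density g"
  shows "e \<ge> 0 \<Longrightarrow> integrable lebesgue (\<lambda>y. K e (x - y) * g y)"
    and "uniform_limit (ball 0 R) (\<lambda>n x. LINT y|lebesgue. K (inverse (real (Suc n))) (x - y) * g y)
         (\<lambda>x. LINT y|lebesgue. K 0 (x - y) * g y) sequentially"
proof -
  have gi: "integrable lebesgue g" using g by (simp add: potential_density_def)
  obtain M1 where M1: "M1 \<ge> 0" "\<And>z. norm z \<le> norm x \<Longrightarrow> AE y in lebesgue. norm (z - y) \<le> 1 \<longrightarrow> y \<noteq> z \<longrightarrow> \<bar>g y\<bar> \<le> M1 * norm (z - y) powr 0"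
    using potential_density_near[OF g, of "norm x"] by blast
  obtain M2 where M2: "M2 \<ge> 0" "\<And>z. norm z \<le> R \<Longrightarrow> AE y in lebesgue. norm (z - y) \<le> 1 \<longrightarrow> y \<noteq> z \<longrightarrow> \<bar>g y\<bar> \<le> M2 * norm (z - y) powr 0"
    using potential_density_near[OF g, of R] by blast
  show "integrable lebesgue (\<lambda>y. K e (x - y) * g y)" if "e \<ge> 0"
    by (rule kernel_convolution_integrable[OF K(1), where \<theta> = 0 and R = 1 and H = M1 and S = "{x}" and w = "\<lambda>_. g"
        and W = "LINT y|lebesgue. \<bar>g y\<bar>"]) (use K M1 gi that in auto)
  show "uniform_limit (ball 0 R) (\<lambda>n x. LINT y|lebesgue. K (inverse (real (Suc n))) (x - y) * g y)
         (\<lambda>x. LINT y|lebesgue. K 0 (x - y) * g y) sequentially"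
    by (rule kernel_convolution_limit[OF K(1), where \<theta> = 0 and R = 1 and H = M2 and w = "\<lambda>_. g"
        and W = "LINT y|lebesgue. \<bar>g y\<bar>"]) (use K M2 gi in auto)
qed

lemma regularized_potential:
  fixes g :: "real^'n::finite \<Rightarrow> real"
  assumes N: "CARD('n) \<ge> 3" and e: "e > 0" and g: "integrable lebesgue g"
  shows "(\<lambda>x. LINT y|lebesgue. nker e (x - y) * g y) differentiable (at x)"
    and "partial_deriv i (\<lambda>x. LINT y|lebesgue. nker e (x - y) * g y) = (\<lambda>x. LINT y|lebesgue. nker1 i e (x - y) * g y)"
    and "(\<lambda>x. LINT y|lebesgue. nker1 i e (x - y) * g y) differentiable (at x)"
    and "partial_deriv j (\<lambda>x. LINT y|lebesgue. nker1 i e (x - y) * g y) = (\<lambda>x. LINT y|lebesgue. nker2 i j e (x - y) * g y)"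
    and "continuous_on UNIV (\<lambda>x. LINT y|lebesgue. nker2 i j e (x - y) * g y)"
    and "integrable lebesgue (\<lambda>y. nker2 i j e (x - y) * g y)"
proof -
  obtain B where B: "\<And>z::real^'n. \<bar>nker e z\<bar> \<le> B" "\<And>i (z::real^'n). \<bar>nker1 i e z\<bar> \<le> B" "\<And>i j (z::real^'n). \<bar>nker2 i j e z\<bar> \<le> B"
    using nker_bounded[OF N e] by blast
  note C2 = nker_C2[OF e]
  show "(\<lambda>x. LINT y|lebesgue. nker e (x - y) * g y) differentiable (at x)"
    by (rule conv_partial_deriv(1)[OF C2(2) B(1) _ g]) (simp add: C2(4) B)
  show "partial_deriv i (\<lambda>x. LINT y|lebesgue. nker e (x - y) * g y) = (\<lambda>x. LINT y|lebesgue. nker1 i e (x - y) * g y)"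
    using conv_partial_deriv(2)[OF C2(2) B(1) _ g] B(2) by (auto simp: C2(4))
  show "(\<lambda>x. LINT y|lebesgue. nker1 i e (x - y) * g y) differentiable (at x)"
    by (rule conv_partial_deriv(1)[OF C2(3) B(2) _ g]) (simp add: C2(5) B)
  show "partial_deriv j (\<lambda>x. LINT y|lebesgue. nker1 i e (x - y) * g y) = (\<lambda>x. LINT y|lebesgue. nker2 i j e (x - y) * g y)"
    using conv_partial_deriv(2)[OF C2(3) B(2) _ g] B(3) by (auto simp: C2(5))
  have "C_on (Suc 0) UNIV (nker1 i e :: real^'n \<Rightarrow> real)" using C2(3) by simp
  then have c: "continuous_on UNIV (nker2 i j e)" by (simp add: C2(5))
  show "continuous_on UNIV (\<lambda>x. LINT y|lebesgue. nker2 i j e (x - y) * g y)"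
    by (rule continuous_conv[OF c B(3) g])
  show "integrable lebesgue (\<lambda>y. nker2 i j e (x - y) * g y)"
    by (rule integrable_bounded_mult[OF lebesgue_measurable_shift[OF c] B(3) g])
qed

text \<open>Both \<open>nker\<close> and \<open>nker1\<close> have order below the dimension, so the
  regularized potentials and their gradients converge uniformly on balls for every potential
  density. The limit gradient inherits continuity.\<close>

lemma npot_C1:
  fixes g :: "real^'n::finite \<Rightarrow> real"
  assumes N: "CARD('n) \<ge> 3" and g: "potential_density g"
  shows "npot g differentiable (at x)"
    and "partial_deriv i (npot g) = (\<lambda>x. LINT y|lebesgue. nker1 i 0 (x - y) * g y)"
    and "C_on 1 UNIV (npot g)"
proof -
  have gi: "integrable lebesgue g" using g by (simp add: potential_density_def)
  let ?e = "\<lambda>n. inverse (real (Suc n))"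
  have e: "?e n > 0" for n by simp
  note reg = regularized_potential[OF N e gi]
  have lim1: "uniform_limit (ball 0 R) (\<lambda>n x. LINT y|lebesgue. nker1 i (?e n) (x - y) * g y)
         (\<lambda>x. LINT y|lebesgue. nker1 i 0 (x - y) * g y) sequentially" for i R
    using kernel_bound_nker(2)[OF N, of i] kernel_density_limit(2)[OF _ _ _ g] N by fastforce
  have lim0: "uniform_limit (ball 0 R) (\<lambda>n x. LINT y|lebesgue. nker (?e n) (x - y) * g y)
         (\<lambda>x. LINT y|lebesgue. nker 0 (x - y) * g y) sequentially" for R
    using kernel_bound_nker(1)[OF N] kernel_density_limit(2)[OF _ _ _ g] N by fastforce
  have d: "npot g differentiable (at x)" and p: "partial_deriv i (npot g) x = (LINT y|lebesgue. nker1 i 0 (x - y) * g y)" for x i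
  proof -
    let ?S = "ball (0::real^'n) (norm x + 1)"
    have l: "(\<lambda>n. LINT y|lebesgue. nker (?e n) (z - y) * g y) \<longlonglongrightarrow> npot g z" if "z \<in> ?S" for z
      unfolding npot_def by (rule tendsto_uniform_limitI[OF lim0 that])
    have u: "uniform_limit ?S (\<lambda>n. partial_deriv i (\<lambda>x. LINT y|lebesgue. nker (?e n) (x - y) * g y))
         (\<lambda>x. LINT y|lebesgue. nker1 i 0 (x - y) * g y) sequentially" for i
      unfolding reg(2) by (rule lim1)
    from uniform_limit_partials[OF _ _ reg(1) u l, of x]
    show "npot g differentiable (at x)" "partial_deriv i (npot g) x = (LINT y|lebesgue. nker1 i 0 (x - y) * g y)"
      by auto
  qed
  show "npot g differentiable (at x)" "partial_deriv i (npot g) = (\<lambda>x. LINT y|lebesgue. nker1 i 0 (x - y) * g y)"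
    using d p by auto
  have "isCont (\<lambda>x. LINT y|lebesgue. nker1 i 0 (x - y) * g y) x" for i x
  proof -
    have "continuous_on (ball 0 (norm x + 1)) (\<lambda>x. LINT y|lebesgue. nker1 i 0 (x - y) * g y)"
    proof (rule uniform_limit_theorem[OF _ lim1])
      show "\<forall>\<^sub>F n in sequentially. continuous_on (ball 0 (norm x + 1)) (\<lambda>x. LINT y|lebesgue. nker1 i (?e n) (x - y) * g y)"
        using reg(3) by (intro always_eventually allI differentiable_imp_continuous_on)
          (auto simp: differentiable_on_def intro: differentiable_at_withinI)
    qed simp
    then show ?thesis by (rule continuous_on_interior) simp
  qed
  then show "C_on 1 UNIV (npot g)"
    using d p by (auto simp: continuous_on_eq_continuous_at fun_eq_iff cong: continuous_on_cong)
qed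

section \<open>Test functions\<close>

text \<open>Differentiating \<open>exp (- (1 / t))\<close> produces powers of 1 / t; carrying them
  as an index closes the family under derivatives, up to linear combinations.\<close>

definition bexp :: "nat \<Rightarrow> real \<Rightarrow> real" where
  "bexp m t = (if t > 0 then (1 / t) ^ m * exp (- (1 / t)) else 0)"

lemma bexp_DERIV: "(bexp m has_real_derivative bexp (m + 2) t - m * bexp (m + 1) t) (at t)"
proof -
  consider "t > 0" | "t < 0" | "t = 0" by linarith
  then show ?thesis
  proof cases
    case 1
    define r where "r = 1 / t"
    have r: "((\<lambda>t. 1 / t) has_real_derivative - r\<^sup>2) (at t)"
      using 1 by (auto intro!: derivative_eq_intros simp: r_def power2_eq_square)
    have "((\<lambda>t. (1 / t) ^ m * exp (- (1 / t))) has_real_derivative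
        real m * (- r\<^sup>2 * r ^ (m - Suc 0)) * exp (- r) + exp (- r) * (- (- r\<^sup>2)) * r ^ m) (at t)"
      unfolding r_def by (intro DERIV_mult DERIV_power DERIV_fun_exp DERIV_minus r[unfolded r_def])
    also have "real m * (- r\<^sup>2 * r ^ (m - Suc 0)) * exp (- r) + exp (- r) * (- (- r\<^sup>2)) * r ^ m =
        bexp (m + 2) t - m * bexp (m + 1) t"
      using 1 by (cases m) (simp_all add: bexp_def r_def[symmetric] power2_eq_square algebra_simps)
    finally have "((\<lambda>t. (1 / t) ^ m * exp (- (1 / t))) has_real_derivative bexp (m + 2) t - m * bexp (m + 1) t) (at t)" .
    then show ?thesis
      by (rule DERIV_cong_ev[THEN iffD1, rotated -1])
         (use 1 eventually_nhds_in_open[of "{0<..}" t] in \<open>auto elim!: eventually_mono simp: bexp_def\<close>)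
  next
    case 2
    have "((\<lambda>_. 0) has_real_derivative bexp (m + 2) t - m * bexp (m + 1) t) (at t)"
      using 2 by (simp add: bexp_def)
    then show ?thesis
      by (rule DERIV_cong_ev[THEN iffD1, rotated -1])
         (use 2 eventually_nhds_in_open[of "{..<0}" t] in \<open>auto elim!: eventually_mono simp: bexp_def\<close>)
  next
    \<comment> \<open>At the origin the difference quotient is zero on the left; on the right, with
      u = 1 / h, it is u^(m+1) / exp u, which tends to zero.\<close>
    case 3
    have "((\<lambda>h. bexp m h / h) \<longlongrightarrow> 0) (at_left 0)"
      by (rule tendsto_eventually) (auto simp: eventually_at_filter bexp_def)
    moreover have "((\<lambda>h. bexp m h / h) \<longlongrightarrow> 0) (at_right 0)"
    proof -
      have "((\<lambda>h. (inverse h) ^ (m + 1) / exp (inverse h)) \<longlongrightarrow> (0::real)) (at_right 0)"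
        by (rule filterlim_compose[OF tendsto_power_div_exp_0 filterlim_inverse_at_top_right])
      then show ?thesis
        by (rule Lim_transform_eventually)
           (auto simp: eventually_at_filter bexp_def field_simps exp_minus)
    qed
    ultimately have "((\<lambda>h. bexp m h / h) \<longlongrightarrow> 0) (at 0)"
      by (rule filterlim_split_at)
    then show ?thesis using 3 by (simp add: DERIV_def bexp_def)
  qed
qed

lemma bexp_nonneg: "0 \<le> bexp m t"
  by (simp add: bexp_def)

lemma continuous_bexp: "continuous_on S (bexp m)"
  by (intro continuous_at_imp_continuous_on ballI DERIV_isCont[OF bexp_DERIV])

text \<open>A class that contains the bump function and is closed under partial derivatives, so
  smoothness of every order follows by induction on the order alone.\<close>

inductive bump_algebra :: "real^'n::finite \<Rightarrow> real \<Rightarrow> (real^'n \<Rightarrow> real) \<Rightarrow> bool" for a s where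
  const: "bump_algebra a s (\<lambda>x. c)"
| coord: "bump_algebra a s (\<lambda>x. x $ i)"
| bexp: "bump_algebra a s (\<lambda>x. bexp m (1 - ((x - a) \<bullet> (x - a)) / s\<^sup>2))"
| add: "bump_algebra a s u \<Longrightarrow> bump_algebra a s v \<Longrightarrow> bump_algebra a s (\<lambda>x. u x + v x)"
| mult: "bump_algebra a s u \<Longrightarrow> bump_algebra a s v \<Longrightarrow> bump_algebra a s (\<lambda>x. u x * v x)"

lemma bexp_partial_deriv:
  fixes a x :: "real^'n::finite"
  shows "(\<lambda>x. bexp m (1 - ((x - a) \<bullet> (x - a)) / s\<^sup>2)) differentiable (at x)"
    and "partial_deriv i (\<lambda>x. bexp m (1 - ((x - a) \<bullet> (x - a)) / s\<^sup>2)) x =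
      (bexp (m + 2) (1 - ((x - a) \<bullet> (x - a)) / s\<^sup>2) - m * bexp (m + 1) (1 - ((x - a) \<bullet> (x - a)) / s\<^sup>2))
        * (- 2 / s\<^sup>2 * (x $ i - a $ i))"
proof -
  let ?t = "\<lambda>x. 1 - ((x - a) \<bullet> (x - a)) / s\<^sup>2"
  have d: "(?t has_derivative (\<lambda>h. - (2 * ((x - a) \<bullet> h)) / s\<^sup>2)) (at x)"
  proof -
    have "((\<lambda>x. 1 - inverse (s\<^sup>2) * ((x - a) \<bullet> (x - a))) has_derivative
        (\<lambda>h. - (inverse (s\<^sup>2) * (2 * ((x - a) \<bullet> h))))) (at x)"
      by (auto intro!: derivative_eq_intros simp: inner_commute)
    then show ?thesis by (simp add: divide_inverse mult_ac)
  qed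
  have "((\<lambda>x. bexp m (?t x)) has_derivative
      (\<lambda>h. (bexp (m + 2) (?t x) - m * bexp (m + 1) (?t x)) * (- (2 * ((x - a) \<bullet> h)) / s\<^sup>2))) (at x)"
    using has_derivative_compose[OF d, of "bexp m"] bexp_DERIV[of m "?t x"]
    unfolding has_field_derivative_def by blast
  note * = partial_derivI[OF this]
  have "(x - a) \<bullet> axis i 1 = x $ i - a $ i" by (simp add: inner_axis)
  with * show "(\<lambda>x. bexp m (?t x)) differentiable (at x)"
    "partial_deriv i (\<lambda>x. bexp m (?t x)) x = (bexp (m + 2) (?t x) - m * bexp (m + 1) (?t x)) * (- 2 / s\<^sup>2 * (x $ i - a $ i))"
    by auto
qed

lemma partial_deriv_add:
  assumes "u differentiable (at x)" "v differentiable (at x)"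
  shows "partial_deriv i (\<lambda>x. u x + v x) x = partial_deriv i u x + partial_deriv i v x"
proof -
  have "((\<lambda>x. u x + v x) has_derivative
      (\<lambda>h. frechet_derivative u (at x) h + frechet_derivative v (at x) h)) (at x)"
    using assms by (intro has_derivative_add) (auto simp: frechet_derivative_works)
  then show ?thesis
    by (auto simp: partial_deriv_def frechet_derivative_at[symmetric])
qed

lemma bump_algebra_partial_deriv:
  "bump_algebra a s u \<Longrightarrow> (\<forall>x. u differentiable (at x)) \<and> (\<forall>i. bump_algebra a s (partial_deriv i u))"
proof (induction rule: bump_algebra.induct)
  case (const c)
  have "partial_deriv i (\<lambda>x::real^'a. c) = (\<lambda>x. 0)" for i
    using partial_derivI(2)[OF has_derivative_const] by auto
  then show ?case by (auto intro: bump_algebra.const)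
next
  case (coord j)
  have d: "((\<lambda>x::real^'a. x $ j) has_derivative (\<lambda>h. h $ j)) (at x)" for x
    by (rule bounded_linear_imp_has_derivative[OF bounded_linear_vec_nth])
  have "partial_deriv i (\<lambda>x::real^'a. x $ j) = (\<lambda>x. axis i 1 $ j)" for i
    using partial_derivI(2)[OF d] by auto
  then show ?case using partial_derivI(1)[OF d] by (auto intro: bump_algebra.const)
next
  case (bexp m)
  let ?t = "\<lambda>x. 1 - ((x - a) \<bullet> (x - a)) / s\<^sup>2"
  have "partial_deriv i (\<lambda>x. bexp m (?t x)) = (\<lambda>x. (bexp (m + 2) (?t x) + (- real m) * bexp (m + 1) (?t x)) * (- 2 / s\<^sup>2 * (x $ i + - a $ i)))" for i
    by (auto simp: bexp_partial_deriv(2))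
  moreover have "bump_algebra a s (\<lambda>x. (bexp (m + 2) (?t x) + (- real m) * bexp (m + 1) (?t x)) * (- 2 / s\<^sup>2 * (x $ i + - a $ i)))" for i
    by (intro bump_algebra.intros)
  ultimately show ?case using bexp_partial_deriv(1) by auto
next
  case (add u v)
  then have "partial_deriv i (\<lambda>x. u x + v x) = (\<lambda>x. partial_deriv i u x + partial_deriv i v x)" for i
    by (auto intro!: partial_deriv_add)
  with add show ?case by (auto intro: bump_algebra.add)
next
  case (mult u v)
  then have "partial_deriv i (\<lambda>x. u x * v x) = (\<lambda>x. partial_deriv i u x * v x + u x * partial_deriv i v x)" for i
    by (auto intro!: partial_deriv_mult(2))
  with mult show ?case by (auto intro!: bump_algebra.add bump_algebra.mult partial_deriv_mult(1))
qed

lemma bump_algebra_C_on: "bump_algebra a s u \<Longrightarrow> C_on k UNIV u"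
proof (induction k arbitrary: u)
  case 0
  then show ?case
    using bump_algebra_partial_deriv[OF 0]
    by (auto intro!: differentiable_imp_continuous_on simp: differentiable_on_def)
next
  case (Suc k)
  then show ?case using bump_algebra_partial_deriv[OF Suc.prems] by auto
qed

definition bump :: "real^'n::finite \<Rightarrow> real \<Rightarrow> real^'n \<Rightarrow> real" where
  "bump a s x = bexp 0 (1 - ((x - a) \<bullet> (x - a)) / s\<^sup>2)"

lemma bump_eq_0: "s > 0 \<Longrightarrow> norm (x - a) \<ge> s \<Longrightarrow> bump a s x = 0"
proof -
  assume "s > 0" "norm (x - a) \<ge> s"
  then have "s\<^sup>2 \<le> (x - a) \<bullet> (x - a)"
    unfolding power2_norm_eq_inner[symmetric] by (intro power_mono) auto
  with \<open>s > 0\<close> have "1 \<le> ((x - a) \<bullet> (x - a)) / s\<^sup>2" by (subst pos_le_divide_eq) auto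
  then show ?thesis by (simp add: bump_def bexp_def)
qed

lemma test_function_bump:
  assumes "s > 0"
  shows "test_function (\<lambda>x. c * bump a s x)"
proof -
  have "bump_algebra a s (\<lambda>x. c * bump a s x)"
    unfolding bump_def by (intro bump_algebra.intros)
  moreover have "{x. c * bump a s x \<noteq> 0} \<subseteq> ball a s"
    using bump_eq_0[OF assms, of _ a] by (auto simp: dist_norm norm_minus_commute not_le[symmetric])
  ultimately show ?thesis
    by (auto simp: test_function_def intro: bump_algebra_C_on bounded_subset[OF bounded_ball])
qed

lemma test_functionD:
  fixes \<phi> :: "real^'n::finite \<Rightarrow> real"
  assumes \<phi>: "test_function \<phi>"
  shows "C_on k UNIV \<phi>" "continuous_on UNIV \<phi>" "continuous_on UNIV (partial_deriv i \<phi>)" "continuous_on UNIV (laplacian \<phi>)"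
    and "\<exists>R>0. \<forall>x. norm x > R \<longrightarrow> \<phi> x = 0 \<and> partial_deriv i \<phi> x = 0 \<and> laplacian \<phi> x = 0"
proof -
  show C: "C_on k UNIV \<phi>" for k using \<phi> by (simp add: test_function_def)
  show "continuous_on UNIV \<phi>" using C[of 0] by simp
  show "continuous_on UNIV (partial_deriv i \<phi>)" using C[of 1] by simp
  show "continuous_on UNIV (laplacian \<phi>)"
    using C[of 2] by (auto simp: laplacian_def[abs_def] numeral_2_eq_2 intro!: continuous_intros)
  obtain R where R: "\<And>x. norm x > R \<Longrightarrow> \<phi> x = 0"
    using \<phi> unfolding test_function_def bounded_iff by (metis (mono_tags) mem_Collect_eq not_le)
  have "\<phi> x = 0 \<and> partial_deriv i \<phi> x = 0 \<and> laplacian \<phi> x = 0" if "norm x > max R 1" for x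
  proof -
    have *: "norm y > max R 1 \<Longrightarrow> \<phi> y = 0" for y using R by auto
    have **: "norm y > max R 1 \<Longrightarrow> partial_deriv j \<phi> y = 0" for y j
      using partial_deriv_support[of "max R 1" \<phi>] * by auto
    have "partial_deriv j (partial_deriv j \<phi>) x = 0" for j
      using partial_deriv_support[of "max R 1" "partial_deriv j \<phi>"] ** that by auto
    then show ?thesis using * ** that by (simp add: laplacian_def)
  qed
  then show "\<exists>R>0. \<forall>x. norm x > R \<longrightarrow> \<phi> x = 0 \<and> partial_deriv i \<phi> x = 0 \<and> laplacian \<phi> x = 0"
    by (intro exI[of _ "max R 1"]) auto
qed

lemma continuous_support_bounded:
  fixes h :: "'a::euclidean_space \<Rightarrow> real"
  assumes "continuous_on UNIV h" "\<And>x. norm x > R \<Longrightarrow> h x = 0"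
  shows "\<exists>B\<ge>0. \<forall>x. \<bar>h x\<bar> \<le> B"
proof -
  have "compact (h ` cball 0 R)"
    by (intro compact_continuous_image continuous_on_subset[OF assms(1)]) auto
  then obtain B where "\<forall>x\<in>cball 0 R. \<bar>h x\<bar> \<le> B"
    by (auto dest!: compact_imp_bounded simp: bounded_iff)
  then have "\<bar>h x\<bar> \<le> max B 0" for x
    using assms(2)[of x] by (cases "norm x \<le> R") (auto simp: le_max_iff_disj)
  then show ?thesis by (intro exI[of _ "max B 0"]) auto
qed

lemma potential_density_continuous_support:
  fixes h :: "real^'n::finite \<Rightarrow> real"
  assumes h: "continuous_on UNIV h" "\<And>x. norm x > R \<Longrightarrow> h x = 0"
  shows "potential_density h"
proof -
  obtain B where "\<And>x. \<bar>h x\<bar> \<le> B" using continuous_support_bounded[OF h] by blast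
  then show ?thesis
    unfolding potential_density_def using integrable_continuous_support[OF h] by auto
qed

lemma C_on_shift:
  fixes u :: "real^'n::finite \<Rightarrow> real"
  shows "C_on k UNIV u \<Longrightarrow> C_on k UNIV (\<lambda>x. u (x - y))"
    and "u differentiable (at (x - y)) \<Longrightarrow> partial_deriv i (\<lambda>x. u (x - y)) x = partial_deriv i u (x - y)"
proof -
  have d: "((\<lambda>x. u (x - y)) has_derivative frechet_derivative u (at (x - y))) (at x)"
    if "u differentiable (at (x - y))" for u :: "real^'n \<Rightarrow> real" and x
  proof -
    have "((\<lambda>x. x - y) has_derivative (\<lambda>h. h)) (at x)" by (auto intro!: derivative_eq_intros)
    from has_derivative_compose[OF this, of u] that show ?thesis
      by (simp add: frechet_derivative_works)
  qed
  show p: "u differentiable (at (x - y)) \<Longrightarrow> partial_deriv i (\<lambda>x. u (x - y)) x = partial_deriv i u (x - y)"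
    for u :: "real^'n \<Rightarrow> real" and i x
    using partial_derivI(2)[OF d] by (auto simp: partial_deriv_def)
  show "C_on k UNIV u \<Longrightarrow> C_on k UNIV (\<lambda>x. u (x - y))"
  proof (induction k arbitrary: u)
    case 0
    then show ?case by (auto intro!: continuous_on_compose2[of UNIV u] continuous_intros)
  next
    case (Suc k)
    have "partial_deriv i (\<lambda>x. u (x - y)) = (\<lambda>x. partial_deriv i u (x - y))" for i
      using Suc.prems p by auto
    moreover have "(\<lambda>x. u (x - y)) differentiable (at x)" for x
      using partial_derivI(1)[OF d] Suc.prems by simp
    ultimately show ?case using Suc by simp
  qed
qed

text \<open>The scaling acts on the argument of \<open>\<phi>\<close>, so dominated convergence
  works with \<open>p\<close> fixed. The mass of \<open>p\<close> is left as a factor because the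
  two profiles it is applied to are not normalized.\<close>

lemma approximate_identity:
  fixes p \<phi> :: "'a::euclidean_space \<Rightarrow> real"
  assumes p: "integrable lborel p" and \<phi>: "continuous_on UNIV \<phi>" "\<And>x. \<bar>\<phi> x\<bar> \<le> B" and s: "s \<longlonglongrightarrow> 0"
  shows "(\<lambda>n. LINT w|lborel. p w * \<phi> (y + s n *\<^sub>R w)) \<longlonglongrightarrow> (LINT w|lborel. p w) * \<phi> y"
proof -
  have [measurable]: "\<phi> \<in> borel_measurable borel" "p \<in> borel_measurable borel"
    using \<phi>(1) p by (auto intro: borel_measurable_continuous_onI)
  have "(\<lambda>n. LINT w|lborel. p w * \<phi> (y + s n *\<^sub>R w)) \<longlonglongrightarrow> (LINT w|lborel. p w * \<phi> y)"
  proof (rule integral_dominated_convergence[where w = "\<lambda>w. \<bar>p w\<bar> * B"])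
    show "AE w in lborel. (\<lambda>n. p w * \<phi> (y + s n *\<^sub>R w)) \<longlonglongrightarrow> p w * \<phi> y"
    proof (intro AE_I2 tendsto_mult tendsto_const)
      fix w
      have "(\<lambda>n. y + s n *\<^sub>R w) \<longlonglongrightarrow> y + 0 *\<^sub>R w" by (intro tendsto_intros s)
      moreover have "isCont \<phi> y" using \<phi>(1) by (simp add: continuous_on_eq_continuous_at)
      ultimately show "(\<lambda>n. \<phi> (y + s n *\<^sub>R w)) \<longlonglongrightarrow> \<phi> y"
        using isCont_tendsto_compose[of y \<phi>] by simp
    qed
    show "AE w in lborel. norm (p w * \<phi> (y + s n *\<^sub>R w)) \<le> \<bar>p w\<bar> * B" for n
      using \<phi>(2) by (auto simp: abs_mult intro!: mult_left_mono)
  qed (use p in auto)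
  then show ?thesis by simp
qed

section \<open>The fundamental solution\<close>

text \<open>The radial density N r^(N-1) (r^2 + 1)^(-N/2 - 1) has the primitive r^N (r^2 +
  1)^(-N/2), which goes from 0 at r = 0 to 1 at infinity; the angular part contributes the volume of
  the unit ball.\<close>

lemma poisson_kernel_integral:
  fixes N :: real
  defines "N \<equiv> real DIM('a::euclidean_space)"
  shows "integrable lborel (\<lambda>w::'a. (w \<bullet> w + 1) powr - (N / 2 + 1))"
    and "(LINT w::'a|lborel. (w \<bullet> w + 1) powr - (N / 2 + 1)) = unit_ball_vol N"
proof -
  let ?n = "DIM('a)"
  have N: "N > 0" by (simp add: N_def)
  have q: "r\<^sup>2 + 1 > 0" for r :: real by (simp add: add_nonneg_pos)
  define F where "F r = r ^ ?n * (r\<^sup>2 + 1) powr - (N / 2)" for r :: real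
  define g where "g r = N * r ^ (?n - 1) * (r\<^sup>2 + 1) powr - (N / 2 + 1)" for r :: real
  have deriv: "(F has_real_derivative g r) (at r)" for r
  proof -
    have "((\<lambda>r. r\<^sup>2 + 1) has_real_derivative 2 * r) (at r)"
      by (auto intro!: derivative_eq_intros)
    then have "((\<lambda>r. (r\<^sup>2 + 1) powr - (N / 2)) has_real_derivative - (N / 2) * (r\<^sup>2 + 1) powr (- (N / 2) - 1) * (2 * r)) (at r)"
      by (rule DERIV_chain2[where f = "\<lambda>t. t powr - (N / 2)" and g = "\<lambda>r. r\<^sup>2 + 1", OF has_real_derivative_powr[OF q]])
    then have "(F has_real_derivative (N * r ^ (?n - 1)) * (r\<^sup>2 + 1) powr - (N / 2)
        + (- (N / 2) * (r\<^sup>2 + 1) powr (- (N / 2) - 1) * (2 * r)) * r ^ ?n) (at r)"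
      unfolding F_def[abs_def] N_def by (intro DERIV_mult) (auto intro!: derivative_eq_intros)
    also have "(r\<^sup>2 + 1) powr - (N / 2) = (r\<^sup>2 + 1) * (r\<^sup>2 + 1) powr - (N / 2 + 1)"
      using powr_add[of "r\<^sup>2 + 1" 1 "- (N / 2 + 1)"] q[of r] by simp
    also have "- (N / 2) - 1 = - (N / 2 + 1)" by simp
    also have "r ^ ?n = r * r ^ (?n - 1)" by (simp add: power_eq_if)
    also have "N * r ^ (?n - 1) * ((r\<^sup>2 + 1) * (r\<^sup>2 + 1) powr - (N / 2 + 1)) +
        - (N / 2) * (r\<^sup>2 + 1) powr - (N / 2 + 1) * (2 * r) * (r * r ^ (?n - 1)) = g r"
      unfolding g_def power2_eq_square by (simp only: ring_distribs) simp
    finally show ?thesis .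
  qed
  have Flim: "(F \<longlongrightarrow> 1) at_top"
  proof -
    have "filterlim (\<lambda>r::real. r\<^sup>2 + 1) at_top at_top"
      by (rule filterlim_at_top_mono[OF filterlim_ident])
        (auto intro!: eventually_at_top_linorderI[of 1] simp: power2_eq_square add_increasing2 mult_le_cancel_left1)
    then have "((\<lambda>r::real. 1 - inverse (r\<^sup>2 + 1)) \<longlongrightarrow> 1 - 0) at_top"
      by (intro tendsto_diff tendsto_const filterlim_compose[OF tendsto_inverse_0_at_top[OF filterlim_ident]])
    then have "((\<lambda>r::real. (1 - inverse (r\<^sup>2 + 1)) powr (N / 2)) \<longlongrightarrow> 1 powr (N / 2)) at_top"
      by (intro tendsto_powr tendsto_const) auto
    moreover have "\<forall>\<^sub>F r in at_top. (1 - inverse (r\<^sup>2 + 1)) powr (N / 2) = F r"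
    proof (rule eventually_at_top_linorderI[of 1])
      fix r :: real assume r: "1 \<le> r"
      have "1 - inverse (r\<^sup>2 + 1) = r\<^sup>2 / (r\<^sup>2 + 1)" using q[of r] by (simp add: field_simps)
      moreover have "r\<^sup>2 powr (N / 2) = r ^ ?n"
      proof -
        have "r\<^sup>2 powr (N / 2) = (r powr 2) powr (N / 2)" using r by simp
        also have "\<dots> = r powr N" by (simp add: powr_powr)
        finally show ?thesis using r by (simp add: N_def powr_realpow)
      qed
      ultimately show "(1 - inverse (r\<^sup>2 + 1)) powr (N / 2) = F r"
        using q[of r] by (simp add: F_def powr_divide powr_minus_divide)
    qed
    ultimately show ?thesis by (auto intro: Lim_transform_eventually)
  qed
  have gm: "g \<in> borel_measurable borel" unfolding g_def[abs_def] by measurable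
  have radial: "(\<integral>\<^sup>+r\<in>{0<..}. ennreal (real ?n * r ^ (?n - 1)) * ennreal ((r\<^sup>2 + 1) powr - (N / 2 + 1)) \<partial>lborel) = 1"
  proof -
    have "(\<integral>\<^sup>+r\<in>{0<..}. ennreal (real ?n * r ^ (?n - 1)) * ennreal ((r\<^sup>2 + 1) powr - (N / 2 + 1)) \<partial>lborel) =
        (\<integral>\<^sup>+r. ennreal (g r) * indicator {0..} r \<partial>lborel)"
    proof (rule nn_integral_cong_AE)
      show "AE r in lborel. ennreal (real ?n * r ^ (?n - 1)) * ennreal ((r\<^sup>2 + 1) powr - (N / 2 + 1)) * indicator {0<..} r
          = ennreal (g r) * indicator {0..} r"
        using AE_lborel_singleton[of "0::real"]
        by eventually_elim (auto simp: g_def N_def indicator_def ennreal_mult)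
    qed
    also have "\<dots> = ennreal (1 - F 0)"
      by (rule nn_integral_FTC_atLeast[OF gm deriv _ Flim]) (use N in \<open>auto simp: g_def\<close>)
    finally show ?thesis by (simp add: F_def)
  qed
  let ?P = "\<lambda>w::'a. (w \<bullet> w + 1) powr - (N / 2 + 1)"
  have ball: "(\<integral>\<^sup>+y\<in>cball (0::'a) 1. 1 \<partial>lborel) = ennreal (unit_ball_vol N)"
    by (simp add: emeasure_cball N_def)
  have "(\<integral>\<^sup>+w. ennreal (?P w) \<partial>lborel) = (\<integral>\<^sup>+w. 1 * ennreal (((norm w)\<^sup>2 + 1) powr - (N / 2 + 1)) \<partial>(lborel :: 'a measure))"
    by (simp add: power2_norm_eq_inner)
  also have "\<dots> = (\<integral>\<^sup>+y\<in>cball (0::'a) 1. 1 \<partial>lborel) *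
      (\<integral>\<^sup>+r\<in>{0<..}. ennreal (real ?n * r ^ (?n - 1)) * ennreal ((r\<^sup>2 + 1) powr - (N / 2 + 1)) \<partial>lborel)"
    by (rule nn_integral_homogeneous_polar) (use ball in auto)
  also have "\<dots> = (\<integral>\<^sup>+y\<in>cball (0::'a) 1. 1 \<partial>lborel)"
    by (simp only: radial mult_1_right)
  finally have nn: "(\<integral>\<^sup>+w. ennreal (?P w) \<partial>lborel) = ennreal (unit_ball_vol N)"
    by (simp only: ball)
  show "integrable lborel ?P"
    by (rule integrableI_nn_integral_finite[OF _ _ nn]) auto
  have "(LINT w|lborel. ?P w) = enn2real (\<integral>\<^sup>+w. ennreal (?P w) \<partial>lborel)"
    by (rule integral_eq_nn_integral) auto
  then show "(LINT w|lborel. ?P w) = unit_ball_vol N"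
    unfolding nn using N by simp
qed

text \<open>\<open>CARD('n)\<close> times the volume of the unit ball is the area of the unit
  sphere; the whole product is, up to sign, the flux of the gradient of |x|^(2-N) through
  it.\<close>

definition newton_const :: "'n::finite itself \<Rightarrow> real" where
  "newton_const _ = (real CARD('n) - 2) * CARD('n) * unit_ball_vol CARD('n)"

lemma newton_const_pos: "CARD('n::finite) \<ge> 3 \<Longrightarrow> newton_const TYPE('n) > 0"
  by (simp add: newton_const_def)

text \<open>Substituting x = y + sqrt e w turns the Laplacian of \<open>nker e\<close> into the
  fixed profile \<open>P\<close> of mass \<open>- newton_const\<close>, so it acts as an approximate
  identity at \<open>y\<close>.\<close>

lemma laplacian_nker_tendsto:
  fixes \<phi> :: "real^'n::finite \<Rightarrow> real"
  assumes \<phi>: "continuous_on UNIV \<phi>" "\<And>x. \<bar>\<phi> x\<bar> \<le> B"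
  shows "(\<lambda>n. LINT x|lebesgue. (\<Sum>i\<in>UNIV. nker2 i i (inverse (real (Suc n))) (x - y)) * \<phi> x)
    \<longlonglongrightarrow> - newton_const TYPE('n) * \<phi> y"
proof -
  let ?N = "real CARD('n)"
  define P where "P w = - ((?N - 2) * ?N) * (w \<bullet> w + 1) powr - (?N / 2 + 1)" for w :: "real^'n"
  have P: "integrable lborel P" "(LINT w|lborel. P w) = - newton_const TYPE('n)"
    using poisson_kernel_integral[where 'a = "real^'n"] unfolding P_def
    by (simp_all add: newton_const_def)
  define s where "s n = sqrt (inverse (real (Suc n)))" for n
  have s0: "s \<longlonglongrightarrow> 0"
    using tendsto_real_sqrt[OF LIMSEQ_inverse_real_of_nat] by (simp add: s_def[abs_def])
  have [measurable]: "\<phi> \<in> borel_measurable borel"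
    using \<phi>(1) by (auto intro: borel_measurable_continuous_onI)
  have "(LINT x|lebesgue. (\<Sum>i\<in>UNIV. nker2 i i (inverse (real (Suc n))) (x - y)) * \<phi> x) =
      (LINT w|lborel. P w * \<phi> (y + s n *\<^sub>R w))" for n
  proof -
    have sn: "s n > 0" and s2: "(s n)\<^sup>2 = inverse (real (Suc n))" by (auto simp: s_def)
    have "(LINT x|lebesgue. (\<Sum>i\<in>UNIV. nker2 i i (inverse (real (Suc n))) (x - y)) * \<phi> x) =
      (LINT x|lborel. (\<Sum>i\<in>UNIV. nker2 i i (inverse (real (Suc n))) (x - y)) * \<phi> x)"
      by (rule integral_completion) measurable
    also have "\<dots> = s n ^ CARD('n) * (LINT w|lborel. (\<Sum>i\<in>UNIV. nker2 i i (inverse (real (Suc n))) (y + s n *\<^sub>R w - y)) * \<phi> (y + s n *\<^sub>R w))"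
    proof -
      have "(\<lambda>x. (\<Sum>i\<in>UNIV. nker2 i i (inverse (real (Suc n))) (x - y)) * \<phi> x) \<in> borel_measurable borel"
        by measurable
      from lborel_integral_scale[OF this sn, of y] show ?thesis by simp
    qed
    also have "\<dots> = (LINT w|lborel. s n ^ CARD('n) * ((\<Sum>i\<in>UNIV. nker2 i i (inverse (real (Suc n))) (s n *\<^sub>R w)) * \<phi> (y + s n *\<^sub>R w)))"
      by simp
    also have "\<dots> = (LINT w|lborel. P w * \<phi> (y + s n *\<^sub>R w))"
    proof (rule Bochner_Integration.integral_cong[OF refl])
      fix w :: "real^'n"
      have "(s n *\<^sub>R w) \<bullet> (s n *\<^sub>R w) + (s n)\<^sup>2 = (s n)\<^sup>2 * (w \<bullet> w + 1)"
        by (simp add: power2_eq_square algebra_simps)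
      then have "(\<Sum>i\<in>UNIV. nker2 i i ((s n)\<^sup>2) (s n *\<^sub>R w)) =
          - ((?N - 2) * ?N) * ((s n)\<^sup>2 * ((s n)\<^sup>2 powr - (?N / 2 + 1))) * (w \<bullet> w + 1) powr - (?N / 2 + 1)"
        by (simp add: laplacian_nker powr_mult)
      also have "(s n)\<^sup>2 * ((s n)\<^sup>2 powr - (?N / 2 + 1)) = inverse (s n ^ CARD('n))"
      proof -
        have "(s n)\<^sup>2 * ((s n)\<^sup>2 powr - (?N / 2 + 1)) = (s n)\<^sup>2 powr 1 * ((s n)\<^sup>2 powr - (?N / 2 + 1))" by simp
        also have "\<dots> = (s n)\<^sup>2 powr - (?N / 2)" unfolding powr_add[symmetric] by simp
        also have "\<dots> = (s n powr 2) powr - (?N / 2)" using sn by simp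
        also have "\<dots> = s n powr - ?N" by (simp add: powr_powr)
        also have "\<dots> = inverse (s n ^ CARD('n))" using sn by (simp add: powr_minus powr_realpow)
        finally show ?thesis .
      qed
      finally have "s n ^ CARD('n) * (\<Sum>i\<in>UNIV. nker2 i i ((s n)\<^sup>2) (s n *\<^sub>R w)) = P w"
        using sn by (simp add: P_def)
      then show "s n ^ CARD('n) * ((\<Sum>i\<in>UNIV. nker2 i i (inverse (real (Suc n))) (s n *\<^sub>R w)) * \<phi> (y + s n *\<^sub>R w))
          = P w * \<phi> (y + s n *\<^sub>R w)"
        unfolding s2 by (simp add: mult.assoc[symmetric])
    qed
    finally show ?thesis .
  qed
  then show ?thesis
    using approximate_identity[OF P(1) \<phi> s0, of y] by (simp add: P(2))
qed

lemma nker_even: "nker e (- z) = nker e z" "nker1 i e (- z) = - nker1 i e z" "nker2 i j e (- z) = nker2 i j e z"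
  by (simp_all add: nker_def nker1_def nker2_def)

text \<open>For the smooth kernel \<open>nker e\<close> the Laplacian moves from
  \<open>\<phi>\<close> to the kernel without any singular term. As \<open>e\<close> tends to zero,
  one side becomes the potential and the other picks out the value at \<open>y\<close>.\<close>

lemma fundamental_solution:
  fixes \<phi> :: "real^'n::finite \<Rightarrow> real"
  assumes N: "CARD('n) \<ge> 3" and \<phi>: "test_function \<phi>"
  shows "npot (laplacian \<phi>) y = - newton_const TYPE('n) * \<phi> y"
proof -
  let ?e = "\<lambda>n. inverse (real (Suc n))"
  obtain R where R: "\<And>x. norm x > R \<Longrightarrow> \<phi> x = 0 \<and> laplacian \<phi> x = 0"
    using test_functionD(5)[OF \<phi>] by blast
  have dens: "potential_density (laplacian \<phi>)"
    by (rule potential_density_continuous_support[of _ R]) (use test_functionD[OF \<phi>] R in auto)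
  have "(\<lambda>n. LINT x|lebesgue. nker (?e n) (y - x) * laplacian \<phi> x) \<longlonglongrightarrow> npot (laplacian \<phi>) y"
  proof -
    have "uniform_limit (ball 0 (norm y + 1)) (\<lambda>n y. LINT x|lebesgue. nker (?e n) (y - x) * laplacian \<phi> x)
         (\<lambda>y. LINT x|lebesgue. nker 0 (y - x) * laplacian \<phi> x) sequentially"
      using kernel_bound_nker(1)[OF N] kernel_density_limit(2)[OF _ _ _ dens] N by fastforce
    from tendsto_uniform_limitI[OF this, of y] show ?thesis by (simp add: npot_def)
  qed
  moreover have "(LINT x|lebesgue. nker (?e n) (y - x) * laplacian \<phi> x) =
      (LINT x|lebesgue. (\<Sum>i\<in>UNIV. nker2 i i (?e n) (x - y)) * \<phi> x)" for n
  proof -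
    define e where "e = ?e n"
    have e: "e > 0" by (simp add: e_def)
    note C2 = nker_C2[OF e, where 'n = 'n]
    let ?u = "\<lambda>x. nker e (x - y)"
    have p1: "partial_deriv i ?u = (\<lambda>x. nker1 i e (x - y))" for i
      using C_on_shift(2)[of "nker e" _ y i] C2(2) by (auto simp: C2(4))
    have p2: "partial_deriv i (\<lambda>x. nker1 i e (x - y)) = (\<lambda>x. nker2 i i e (x - y))" for i
      using C_on_shift(2)[of "nker1 i e" _ y i] C2(3) by (auto simp: C2(5))
    have "(LINT x|lebesgue. ?u x * laplacian \<phi> x) = (LINT x|lebesgue. laplacian ?u x * \<phi> x)"
      by (rule laplacian_symmetric[OF C_on_shift(1)[OF C2(1)] \<phi>])
    moreover have "nker e (y - x) = ?u x" for x
      using nker_even(1)[of e "x - y"] by simp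
    ultimately show ?thesis unfolding e_def[symmetric] by (simp add: laplacian_def p1 p2)
  qed
  moreover obtain B where "\<And>x. \<bar>\<phi> x\<bar> \<le> B"
    using continuous_support_bounded[of \<phi> R] test_functionD[OF \<phi>] R by metis
  ultimately show ?thesis
    using laplacian_nker_tendsto[of \<phi> B y] test_functionD(2)[OF \<phi>] LIMSEQ_unique by simp blast
qed

lemma nker_0_eq: "nker 0 (z :: real^'n::finite) = norm z powr (2 - real CARD('n))"
proof (cases "z = 0")
  case False
  have "nker 0 z = ((norm z) powr 2) powr - (real CARD('n) / 2 - 1)"
    using False by (simp add: nker_def power2_norm_eq_inner)
  also have "\<dots> = norm z powr (2 * - (real CARD('n) / 2 - 1))" by (rule powr_powr)
  also have "2 * - (real CARD('n) / 2 - 1) = 2 - real CARD('n)" by simp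
  finally show ?thesis .
qed (simp add: nker_def)

text \<open>Beyond distance 1 the kernel is at most 1, so the integral of
  \<open>\<bar>g y\<bar>\<close> controls that part. Within distance 1 the bound \<open>M\<close>
  multiplies an integral of the kernel that is bounded uniformly in the centre.\<close>

lemma npot_bound:
  assumes N: "CARD('n::finite) \<ge> 3"
  shows "\<exists>C\<ge>0. \<forall>(g :: real^'n \<Rightarrow> real) M x. integrable lebesgue g \<longrightarrow> M \<ge> 0 \<longrightarrow>
    (AE y in lebesgue. norm (x - y) \<le> 1 \<longrightarrow> \<bar>g y\<bar> \<le> M) \<longrightarrow> \<bar>npot g x\<bar> \<le> M * C + (LINT y|lebesgue. \<bar>g y\<bar>)"
proof -
  let ?N = "real CARD('n)"
  obtain C where C: "C \<ge> 0"
    "\<And>x::real^'n. integrable lebesgue (\<lambda>y. norm (x - y) powr - (?N - 2) * indicator (cball x 1) y)"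
    "\<And>x::real^'n. (LINT y|lebesgue. norm (x - y) powr - (?N - 2) * indicator (cball x 1) y) \<le> C"
    using integrable_norm_powr[of "?N - 2" 1, where 'a = "real^'n"] N by auto
  have nk: "nker 0 z = norm z powr - (?N - 2)" for z :: "real^'n"
    by (simp add: nker_0_eq)
  show ?thesis
  proof (intro exI[of _ C] conjI allI impI C(1))
    fix g :: "real^'n \<Rightarrow> real" and M x
    assume g: "integrable lebesgue g" and M: "M \<ge> 0" "AE y in lebesgue. norm (x - y) \<le> 1 \<longrightarrow> \<bar>g y\<bar> \<le> M"
    let ?b = "\<lambda>y. M * (norm (x - y) powr - (?N - 2) * indicator (cball x 1) y) + \<bar>g y\<bar>"
    have b: "integrable lebesgue ?b" using C(2) g by simp
    have ae: "AE y in lebesgue. \<bar>nker 0 (x - y) * g y\<bar> \<le> ?b y"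
      using M(2)
    proof eventually_elim
      case (elim y)
      have nn: "nker 0 (x - y) \<ge> 0" by (simp add: nker_def)
      show ?case
      proof (cases "norm (x - y) \<le> 1")
        case True
        then have "nker 0 (x - y) * \<bar>g y\<bar> \<le> nker 0 (x - y) * M" using elim nn by (intro mult_left_mono) auto
        then show ?thesis using True nn by (simp add: abs_mult nk dist_norm mult.commute add_increasing2)
      next
        case False
        then have "norm (x - y) powr - (?N - 2) \<le> 1 powr - (?N - 2)" using N by (intro powr_mono2') auto
        then have "nker 0 (x - y) * \<bar>g y\<bar> \<le> 1 * \<bar>g y\<bar>" unfolding nk by (intro mult_right_mono) auto
        then show ?thesis using False nn by (simp add: abs_mult dist_norm)
      qed
    qed
    have "(\<lambda>y. nker 0 (x - y)) \<in> borel_measurable lebesgue"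
      by (intro borel_imp_lebesgue_measurable) simp
    then have int: "integrable lebesgue (\<lambda>y. nker 0 (x - y) * g y)"
      using ae g by (intro Bochner_Integration.integrable_bound[OF b]) (auto elim!: eventually_mono)
    have "\<bar>npot g x\<bar> \<le> (LINT y|lebesgue. \<bar>nker 0 (x - y) * g y\<bar>)"
      unfolding npot_def by (rule integral_abs_bound)
    also have "\<dots> \<le> (LINT y|lebesgue. ?b y)"
      using int b ae by (intro integral_mono_AE integrable_abs) auto
    also have "\<dots> = M * (LINT y|lebesgue. norm (x - y) powr - (?N - 2) * indicator (cball x 1) y) + (LINT y|lebesgue. \<bar>g y\<bar>)"
      using C(2)[of x] g by (subst Bochner_Integration.integral_add) (auto intro!: integrable_mult_right)
    also have "\<dots> \<le> M * C + (LINT y|lebesgue. \<bar>g y\<bar>)"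
      using M C(3)[of x] by (intro add_right_mono mult_left_mono) auto
    finally show "\<bar>npot g x\<bar> \<le> M * C + (LINT y|lebesgue. \<bar>g y\<bar>)" .
  qed
qed

section \<open>Weak and classical solutions of the Poisson equation\<close>

lemma lebesgue_borel_representative:
  fixes g :: "'a::euclidean_space \<Rightarrow> real"
  assumes "g \<in> borel_measurable lebesgue"
  obtains g' where "g' \<in> borel_measurable borel" "AE x in lebesgue. g x = g' x"
proof -
  obtain g' where "g' \<in> borel_measurable lborel" "AE x in lborel. g x = g' x"
    using completion_ex_borel_measurable_real[OF assms] by blast
  then show ?thesis using that[of g'] AE_completion by auto
qed

text \<open>Fubini and the evenness of the kernel move the potential onto
  \<open>laplacian \<phi>\<close>, where \<open>fundamental_solution\<close> evaluates it.\<close>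

lemma npot_distributional:
  fixes g :: "real^'n::finite \<Rightarrow> real"
  assumes N: "CARD('n) \<ge> 3" and g: "potential_density g" and \<phi>: "test_function \<phi>"
  shows "(LINT x|lebesgue. npot g x * laplacian \<phi> x) = - newton_const TYPE('n) * (LINT x|lebesgue. g x * \<phi> x)"
proof -
  have gi: "integrable lebesgue g" using g by (simp add: potential_density_def)
  \<comment> \<open>Fubini is applied to Borel functions on \<open>lborel\<close>, so
    \<open>g\<close> is traded for a Borel function equal to it almost everywhere.\<close>
  obtain g' where g'm [measurable]: "g' \<in> borel_measurable borel" and g': "AE x in lebesgue. g x = g' x"
    using lebesgue_borel_representative[OF borel_measurable_integrable[OF gi]] by blast
  have g'i: "integrable lborel g'"
  proof -
    have "integrable lebesgue g'"
      using gi g' borel_imp_lebesgue_measurable[OF g'm]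
      by (subst integrable_cong_AE[of _ _ g]) (auto elim!: eventually_mono)
    then show ?thesis by (simp add: integrable_completion)
  qed
  obtain R where R: "\<And>x. norm x > R \<Longrightarrow> \<phi> x = 0 \<and> laplacian \<phi> x = 0"
    using test_functionD(5)[OF \<phi>] by blast
  have lc: "continuous_on UNIV (laplacian \<phi>)" by (rule test_functionD(4)[OF \<phi>])
  have [measurable]: "laplacian \<phi> \<in> borel_measurable borel" "\<phi> \<in> borel_measurable borel"
    using lc test_functionD(2)[OF \<phi>] by (auto intro: borel_measurable_continuous_onI)
  obtain B where B: "B \<ge> 0" "\<And>x. \<bar>laplacian \<phi> x\<bar> \<le> B"
    using continuous_support_bounded[OF lc, of R] R by blast
  have dl: "potential_density (laplacian \<phi>)" "potential_density (\<lambda>x. \<bar>laplacian \<phi> x\<bar>)"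
    using R by (auto intro!: potential_density_continuous_support[of _ R] lc continuous_on_rabs)
  have npot_lborel: "npot h x = (LINT y|lborel. nker 0 (x - y) * h y)"
    if [measurable]: "h \<in> borel_measurable borel" for h x
    unfolding npot_def by (rule integral_completion) measurable
  have npot_g: "npot g x = npot g' x" for x
    unfolding npot_def
    using g' borel_measurable_integrable[OF gi]
    by (intro integral_cong_AE borel_measurable_times borel_imp_lebesgue_measurable[of "\<lambda>y. nker 0 (x - y)"]
        borel_imp_lebesgue_measurable[OF g'm]) (auto elim!: eventually_mono)
  define F where "F y x = g' y * (nker 0 (y - x) * laplacian \<phi> x)" for y x :: "real^'n"
  have Fm: "(\<lambda>(y, x). F y x) \<in> borel_measurable (lborel \<Otimes>\<^sub>M lborel)"
    unfolding F_def by measurable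
  have int_in: "integrable lborel (\<lambda>x. nker 0 (y - x) * laplacian \<phi> x)" for y
  proof -
    have "integrable lebesgue (\<lambda>x. nker 0 (y - x) * laplacian \<phi> x)"
      using kernel_bound_nker(1)[OF N] kernel_density_limit(1)[OF _ _ _ dl(1), of nker _ _ 0 y] N by fastforce
    then show ?thesis by (subst (asm) integrable_completion) auto
  qed
  have J: "(LINT x|lborel. norm (F y x)) = \<bar>g' y\<bar> * npot (\<lambda>x. \<bar>laplacian \<phi> x\<bar>) y" for y
    by (simp add: F_def abs_mult npot_lborel nker_def)
  \<comment> \<open>Boundedness of the potential of \<open>\<bar>laplacian \<phi> x\<bar>\<close>
    makes the double integral converge absolutely for the integrable \<open>g'\<close>.\<close>
  have Jb: "\<exists>B'. \<forall>y. \<bar>npot (\<lambda>x. \<bar>laplacian \<phi> x\<bar>) y\<bar> \<le> B'"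
  proof -
    obtain C where C: "\<And>(g :: real^'n \<Rightarrow> real) M x. integrable lebesgue g \<Longrightarrow> M \<ge> 0 \<Longrightarrow>
      (AE y in lebesgue. norm (x - y) \<le> 1 \<longrightarrow> \<bar>g y\<bar> \<le> M) \<Longrightarrow> \<bar>npot g x\<bar> \<le> M * C + (LINT y|lebesgue. \<bar>g y\<bar>)"
      using npot_bound[where 'n = 'n, OF N] by blast
    have "\<bar>npot (\<lambda>x. \<bar>laplacian \<phi> x\<bar>) y\<bar> \<le> B * C + (LINT y|lebesgue. \<bar>\<bar>laplacian \<phi> y\<bar>\<bar>)" for y
      using dl(2) B by (intro C) (auto simp: potential_density_def)
    then show ?thesis by blast
  qed
  then obtain B' where B': "\<And>y. \<bar>npot (\<lambda>x. \<bar>laplacian \<phi> x\<bar>) y\<bar> \<le> B'" by blast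
  have cnp: "continuous_on UNIV (npot h)" if "potential_density h" for h :: "real^'n \<Rightarrow> real"
    using npot_C1(3)[OF N that] C_on_1_continuous[of 0 "npot h"] by simp
  have "integrable lborel (\<lambda>y. npot (\<lambda>x. \<bar>laplacian \<phi> x\<bar>) y * \<bar>g' y\<bar>)"
  proof (rule Bochner_Integration.integrable_bound)
    show "integrable lborel (\<lambda>y. B' * g' y)" using g'i by simp
    show "AE y in lborel. norm (npot (\<lambda>x. \<bar>laplacian \<phi> x\<bar>) y * \<bar>g' y\<bar>) \<le> norm (B' * g' y)"
      by (intro AE_I2) (auto simp: abs_mult intro!: mult_right_mono order_trans[OF B' abs_ge_self])
    show "(\<lambda>y. npot (\<lambda>x. \<bar>laplacian \<phi> x\<bar>) y * \<bar>g' y\<bar>) \<in> borel_measurable lborel"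
      using borel_measurable_continuous_onI[OF cnp[OF dl(2)]] by simp
  qed
  then have "integrable (lborel \<Otimes>\<^sub>M lborel) (\<lambda>(y, x). F y x)"
    unfolding mult.commute[of "npot _ _"] J[symmetric]
    using int_in by (intro lborel_pair.Fubini_integrable[OF Fm]) (simp_all add: F_def)
  then have Fub: "(LINT x|lborel. LINT y|lborel. F y x) = (LINT y|lborel. LINT x|lborel. F y x)"
    by (rule lborel_pair.Fubini_integral)
  have "(LINT x|lebesgue. npot g x * laplacian \<phi> x) = (LINT x|lborel. npot g x * laplacian \<phi> x)"
    using borel_measurable_continuous_onI[OF cnp[OF g]] by (intro integral_completion) simp
  also have "\<dots> = (LINT x|lborel. LINT y|lborel. F y x)"
  proof (rule Bochner_Integration.integral_cong[OF refl])
    fix x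
    have "npot g x * laplacian \<phi> x = (LINT y|lborel. nker 0 (x - y) * g' y * laplacian \<phi> x)"
      by (simp add: npot_g npot_lborel)
    also have "\<dots> = (LINT y|lborel. F y x)"
    proof (rule Bochner_Integration.integral_cong[OF refl])
      fix y
      show "nker 0 (x - y) * g' y * laplacian \<phi> x = F y x"
        using nker_even(1)[of 0 "x - y"] by (simp add: F_def)
    qed
    finally show "npot g x * laplacian \<phi> x = (LINT y|lborel. F y x)" .
  qed
  also have "\<dots> = (LINT y|lborel. g' y * npot (laplacian \<phi>) y)"
    unfolding Fub by (simp add: F_def[abs_def] npot_lborel)
  also have "\<dots> = - newton_const TYPE('n) * (LINT y|lborel. g' y * \<phi> y)"
    by (simp add: fundamental_solution[OF N \<phi>] mult.left_commute)
  also have "(LINT y|lborel. g' y * \<phi> y) = (LINT y|lebesgue. g' y * \<phi> y)"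
    by (rule integral_completion[symmetric]) measurable
  also have "\<dots> = (LINT y|lebesgue. g y * \<phi> y)"
    using g' borel_measurable_integrable[OF gi]
    by (intro integral_cong_AE borel_measurable_times borel_imp_lebesgue_measurable[of \<phi>]
        borel_imp_lebesgue_measurable[OF g'm]) (auto elim!: eventually_mono)
  finally show ?thesis .
qed

section \<open>Second derivatives for Hoelder continuous densities\<close>

lemma test_function_lipschitz:
  fixes \<phi> :: "real^'n::finite \<Rightarrow> real"
  assumes \<phi>: "test_function \<phi>"
  shows "\<exists>L\<ge>0. \<forall>x y. \<bar>\<phi> x - \<phi> y\<bar> \<le> L * norm (x - y)"
proof -
  have "\<exists>B\<ge>0. \<forall>x. \<bar>partial_deriv i \<phi> x\<bar> \<le> B" for i
  proof -
    obtain R where "\<And>x. norm x > R \<Longrightarrow> partial_deriv i \<phi> x = 0"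
      using test_functionD(5)[OF \<phi>, of i] by blast
    then show ?thesis using continuous_support_bounded test_functionD(3)[OF \<phi>] by blast
  qed
  then obtain B where B: "\<And>i. B i \<ge> 0" "\<And>i x. \<bar>partial_deriv i \<phi> x\<bar> \<le> B i" by metis
  have "\<bar>partial_deriv i \<phi> x\<bar> \<le> sum B UNIV" for i x
    using B member_le_sum[of i UNIV B] by (meson UNIV_I finite order_trans)
  then have "\<bar>\<phi> x - \<phi> y\<bar> \<le> CARD('n) * sum B UNIV * norm (x - y)" for x y
    using test_functionD(1)[OF \<phi>, of 1] by (intro lipschitz_partials_bounded[of UNIV]) auto
  moreover have "CARD('n) * sum B UNIV \<ge> 0" using B by (simp add: sum_nonneg)
  ultimately show ?thesis by blast
qed

text \<open>Hoelder continuity makes the corrected density vanish to order \<open>\<gamma>\<close>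
  at \<open>x\<close>, which compensates the critical order of \<open>nker2\<close>. The second
  derivatives of the regularized potentials then converge uniformly on the ball. The doubled radius
  leaves room for a cutoff of radius \<open>r\<close> around every point of
  \<open>ball a r\<close>.\<close>

lemma npot_second_derivatives:
  fixes g :: "real^'n::finite \<Rightarrow> real"
  assumes N: "CARD('n) \<ge> 3" and g: "potential_density g" and r: "r > 0" and \<gamma>: "0 < \<gamma>" "\<gamma> < 1" and H: "H \<ge> 0"
    and hol: "\<And>x y. x \<in> cball a (2 * r) \<Longrightarrow> y \<in> cball a (2 * r) \<Longrightarrow> \<bar>g x - g y\<bar> \<le> H * dist x y powr \<gamma>"
  shows "\<exists>D. \<forall>i j. continuous_on (ball a r) (D i j) \<and> (\<forall>x\<in>ball a r.
    partial_deriv i (npot g) differentiable (at x) \<and> partial_deriv j (partial_deriv i (npot g)) x = D i j x \<and>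
    (\<Sum>i\<in>UNIV. D i i x) = - newton_const TYPE('n) * g x)"
proof -
  have gi: "integrable lebesgue g" using g by (simp add: potential_density_def)
  let ?e = "\<lambda>n. inverse (real (Suc n))"
  have e: "?e n > 0" for n by simp
  define S where "S = ball a r"
  \<comment> \<open>The bump has the value \<open>exp (- 1)\<close> at its centre, so the factor
    \<open>exp 1\<close> normalizes the cutoff to \<open>\<eta> 0 = 1\<close>.\<close>
  define \<eta> :: "real^'n \<Rightarrow> real" where "\<eta> z = exp 1 * bump 0 r z" for z
  have \<eta>: "test_function \<eta>" unfolding \<eta>_def[abs_def] by (rule test_function_bump[OF r])
  have \<eta>0: "\<eta> 0 = 1" by (simp add: \<eta>_def bump_def bexp_def flip: exp_add)
  have \<eta>_out: "\<eta> z = 0" if "norm z \<ge> r" for z using bump_eq_0[OF r, of z 0] that by (simp add: \<eta>_def)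
  have \<eta>_even: "\<eta> (- z) = \<eta> z" for z by (simp add: \<eta>_def bump_def)
  note \<eta>c = test_functionD(2,3)[OF \<eta>]
  obtain B where B: "B \<ge> 0" "\<And>z. \<bar>\<eta> z\<bar> \<le> B"
    using continuous_support_bounded[OF \<eta>c(1), of r] \<eta>_out by (meson less_imp_le)
  obtain L where L: "L \<ge> 0" "\<And>z. \<bar>\<eta> z - 1\<bar> \<le> L * norm z"
    using test_function_lipschitz[OF \<eta>] \<eta>0 by (metis diff_zero)
  define M where "M = \<bar>g a\<bar> + H * (2 * r) powr \<gamma>"
  have M: "\<bar>g x\<bar> \<le> M" if "x \<in> S" for x
  proof -
    have "\<bar>g x - g a\<bar> \<le> H * dist x a powr \<gamma>" using that r by (intro hol) (auto simp: S_def dist_commute)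
    also have "\<dots> \<le> H * (2 * r) powr \<gamma>"
      using that r \<gamma> H by (intro mult_left_mono powr_mono2) (auto simp: S_def dist_commute)
    finally show ?thesis unfolding M_def by linarith
  qed
  have M0: "M \<ge> 0" using H by (simp add: M_def)
  \<comment> \<open>Subtracting \<open>g x \<eta>(x - y)\<close> makes the singularity of \<open>nker2\<close> integrable; on the subtracted part,
    which is a translate of a fixed function, one derivative is moved from the kernel to \<open>\<eta>\<close>.\<close>
  define w where "w x y = g y - g x * \<eta> (x - y)" for x y
  have \<eta>xc: "continuous_on UNIV (\<lambda>y. \<eta> (x - y))" for x
    by (intro continuous_on_compose2[OF \<eta>c(1)] continuous_intros) auto
  have \<eta>i: "integrable lebesgue (\<lambda>y. \<eta> (x - y))" for x
  proof (rule integrable_continuous_support[of _ "norm x + r"])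
    show "\<eta> (x - y) = 0" if "norm y > norm x + r" for y
      using that norm_triangle_ineq2[of y x] by (intro \<eta>_out) (simp add: norm_minus_commute)
  qed (rule \<eta>xc)
  have w1: "integrable lebesgue (w x)" for x
    unfolding w_def using gi \<eta>i by (intro Bochner_Integration.integrable_diff integrable_mult_right) auto
  \<comment> \<open>From \<open>\<bar>g y - g x\<bar> + \<bar>g x\<bar> * \<bar>\<eta> (x - y) -
    1\<bar>\<close>: the second term is of first order in the distance, and a distance of at most
    \<open>r\<close> is bounded by \<open>r powr (1 - \<gamma>)\<close> times its power
    \<open>\<gamma>\<close>.\<close>
  define H' where "H' = H + M * (L * r powr (1 - \<gamma>))"
  have H': "H' \<ge> 0" using H M0 L by (simp add: H'_def)
  have w2: "\<bar>w x y\<bar> \<le> H' * norm (x - y) powr \<gamma>" if x: "x \<in> S" and y: "norm (x - y) \<le> r" for x y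
  proof -
    have "dist a y \<le> dist a x + dist x y" by (rule dist_triangle)
    then have xy: "x \<in> cball a (2 * r)" "y \<in> cball a (2 * r)"
      using x y r by (auto simp: S_def dist_norm)
    have z: "norm (x - y) \<le> r powr (1 - \<gamma>) * norm (x - y) powr \<gamma>"
    proof (cases "x = y")
      case False
      then have "norm (x - y) = norm (x - y) powr (1 - \<gamma>) * norm (x - y) powr \<gamma>"
        by (simp add: powr_add[symmetric])
      also have "\<dots> \<le> r powr (1 - \<gamma>) * norm (x - y) powr \<gamma>"
        using y \<gamma> by (intro mult_right_mono powr_mono2) auto
      finally show ?thesis .
    qed simp
    have "w x y = (g y - g x) - g x * (\<eta> (x - y) - 1)" by (simp add: w_def algebra_simps)
    then have "\<bar>w x y\<bar> \<le> \<bar>g y - g x\<bar> + \<bar>g x\<bar> * \<bar>\<eta> (x - y) - 1\<bar>"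
      by (metis abs_mult abs_triangle_ineq4)
    also have "\<dots> \<le> H * norm (x - y) powr \<gamma> + M * (L * (r powr (1 - \<gamma>) * norm (x - y) powr \<gamma>))"
    proof (intro add_mono mult_mono)
      show "\<bar>g y - g x\<bar> \<le> H * norm (x - y) powr \<gamma>"
        using hol[OF xy(2,1)] by (simp add: dist_norm norm_minus_commute)
      show "\<bar>\<eta> (x - y) - 1\<bar> \<le> L * (r powr (1 - \<gamma>) * norm (x - y) powr \<gamma>)"
        using L(2)[of "x - y"] mult_left_mono[OF z L(1)] by linarith
    qed (use M[OF x] M0 in auto)
    finally show ?thesis by (simp add: H'_def algebra_simps)
  qed
  define W where "W = (LINT y|lebesgue. \<bar>g y\<bar> + M * B * indicator (cball a (2 * r)) y)"
  have w3: "(LINT y|lebesgue. \<bar>w x y\<bar>) \<le> W" if x: "x \<in> S" for x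
    unfolding W_def
  proof (intro integral_mono integrable_abs w1 Bochner_Integration.integrable_add gi integrable_mult_right)
    show "integrable lebesgue (indicator (cball a (2 * r)) :: real^'n \<Rightarrow> real)"
      using lmeasurable_cball[of a "2 * r"] by (simp add: fmeasurable_def)
    fix y
    have "\<bar>g x * \<eta> (x - y)\<bar> \<le> M * B * indicator (cball a (2 * r)) y"
    proof (cases "norm (x - y) < r")
      case True
      have "dist a y \<le> dist a x + dist x y" by (rule dist_triangle)
      then have "y \<in> cball a (2 * r)" using x True by (auto simp: S_def dist_norm)
      then show ?thesis using mult_mono[OF M[OF x] B(2)[of "x - y"]] M0 by (simp add: abs_mult)
    next
      case False
      then show ?thesis using \<eta>_out[of "x - y"] M0 B by simp
    qed
    then show "\<bar>w x y\<bar> \<le> \<bar>g y\<bar> + M * B * indicator (cball a (2 * r)) y"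
      unfolding w_def by linarith
  qed
  \<comment> \<open>The argument \<open>0 - y\<close> absorbs the minus sign of the integration by
    parts, \<open>nker1\<close> being odd, and lets \<open>kernel_density_limit\<close> apply at the
    point 0.\<close>
  define c where "c n i j = (LINT y|lebesgue. nker1 i (?e n) (0 - y) * partial_deriv j \<eta> y)" for n i j
  define c0 where "c0 i j = (LINT y|lebesgue. nker1 i 0 (0 - y) * partial_deriv j \<eta> y)" for i j
  have d\<eta>_out: "partial_deriv j \<eta> y = 0" if "norm y > r" for j y
    using partial_deriv_support[of r \<eta> y j] \<eta>_out that by auto
  have c_eq: "(LINT y|lebesgue. nker2 i j (?e n) (x - y) * \<eta> (x - y)) = c n i j" for n i j x
  proof -
    define \<epsilon> where "\<epsilon> = ?e n"
    have \<epsilon>: "\<epsilon> > 0" by (simp add: \<epsilon>_def)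
    note C2 = nker_C2[OF \<epsilon>, where 'n = 'n]
    have C1: "C_on 1 UNIV \<eta>" by (rule test_functionD(1)[OF \<eta>])
    have k1: "continuous_on UNIV (nker1 i \<epsilon> :: real^'n \<Rightarrow> real)" for i
      using C2(3)[of i] C_on_1_continuous[of 0 "nker1 i \<epsilon> :: real^'n \<Rightarrow> real"] by simp
    have k2: "continuous_on UNIV (nker2 i j \<epsilon> :: real^'n \<Rightarrow> real)"
      using C2(3)[of i] unfolding C2(5)[of j i, symmetric] by simp
    let ?F = "\<lambda>z. nker2 i j \<epsilon> z * \<eta> z"
    have Fc: "continuous_on UNIV ?F" by (intro continuous_intros k2 \<eta>c)
    then have Fm [measurable]: "?F \<in> borel_measurable borel" by (rule borel_measurable_continuous_onI)
    have "(LINT y|lebesgue. ?F (x - y)) = (LINT y|lborel. ?F (x - y))"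
      by (rule integral_completion) measurable
    also have "\<dots> = (LINT z|lborel. ?F (x - (x + 1 *\<^sub>R z)))"
      by (subst lborel_integral_scale[of "\<lambda>y. ?F (x - y)" 1 x]) simp_all
    also have "\<dots> = (LINT z|lborel. ?F z)" by (simp add: nker_even \<eta>_even)
    also have "\<dots> = (LINT z|lebesgue. ?F z)" by (rule integral_completion[symmetric]) measurable
    also have "\<dots> = c n i j"
    proof -
      have "(LINT z|lebesgue. partial_deriv j (\<lambda>z. nker1 i \<epsilon> z * \<eta> z) z) = 0"
        by (rule integral_partial_deriv_0[of _ r]) (use C_on_1_mult[OF C2(3) C1] \<eta>_out in auto)
      moreover have "partial_deriv j (\<lambda>z. nker1 i \<epsilon> z * \<eta> z) z = ?F z + nker1 i \<epsilon> z * partial_deriv j \<eta> z" for z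
        using C2(3)[of i] C1 by (subst partial_deriv_mult(2)) (simp_all add: C2(5))
      moreover have "integrable lebesgue ?F"
        by (rule integrable_continuous_support[of _ r, OF Fc]) (simp add: \<eta>_out)
      moreover have "integrable lebesgue (\<lambda>z. nker1 i \<epsilon> z * partial_deriv j \<eta> z)"
        by (rule integrable_continuous_support[of _ r]) (auto intro!: continuous_intros k1 \<eta>c simp: d\<eta>_out)
      ultimately have "(LINT z|lebesgue. ?F z) = - (LINT z|lebesgue. nker1 i \<epsilon> z * partial_deriv j \<eta> z)"
        by simp
      then show ?thesis by (simp add: c_def \<epsilon>_def nker_even)
    qed
    finally show ?thesis by (simp add: \<epsilon>_def)
  qed
  have c_lim: "(\<lambda>n. c n i j) \<longlonglongrightarrow> c0 i j" for i j
  proof -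
    have dens: "potential_density (partial_deriv j \<eta>)"
      by (rule potential_density_continuous_support[of _ r]) (auto intro: \<eta>c d\<eta>_out)
    have "uniform_limit (ball 0 1) (\<lambda>n x. LINT y|lebesgue. nker1 i (?e n) (x - y) * partial_deriv j \<eta> y)
         (\<lambda>x. LINT y|lebesgue. nker1 i 0 (x - y) * partial_deriv j \<eta> y) sequentially"
      using kernel_bound_nker(2)[OF N, of i] kernel_density_limit(2)[OF _ _ _ dens] N by fastforce
    from tendsto_uniform_limitI[OF this, of 0] show ?thesis by (simp add: c_def c0_def)
  qed
  have k2i: "integrable lebesgue (\<lambda>y. nker2 i j (?e n) (x - y) * h y)" if "integrable lebesgue h" for i j n x and h :: "real^'n \<Rightarrow> real"
    by (rule regularized_potential(6)[OF N e that])
  \<comment> \<open>The trace of the constants is the Laplacian of the regularized kernel tested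
    against \<open>\<eta>\<close>; it tends to \<open>- newton_const\<close> times
    \<open>\<eta> 0 = 1\<close>.\<close>
  have c_sum: "(\<Sum>i\<in>UNIV. c0 i i) = - newton_const TYPE('n)"
  proof (rule LIMSEQ_unique)
    show "(\<lambda>n. \<Sum>i\<in>UNIV. c n i i) \<longlonglongrightarrow> (\<Sum>i\<in>UNIV. c0 i i)" by (intro tendsto_sum c_lim)
    have "(\<Sum>i\<in>UNIV. c n i i) = (LINT x|lebesgue. (\<Sum>i\<in>UNIV. nker2 i i (?e n) (x - 0)) * \<eta> x)" for n
    proof -
      have "integrable lebesgue (\<lambda>y. nker2 i i (?e n) (0 - y) * \<eta> y)" for i
        using k2i[OF \<eta>i[of 0], of i i n 0] by (simp add: \<eta>_even)
      then have "(\<Sum>i\<in>UNIV. c n i i) = (LINT x|lebesgue. (\<Sum>i\<in>UNIV. nker2 i i (?e n) (0 - x) * \<eta> (0 - x)))"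
        unfolding c_eq[of _ _ _ 0, symmetric]
        by (intro Bochner_Integration.integral_sum[symmetric]) (simp add: \<eta>_even)
      then show ?thesis by (simp add: nker_even \<eta>_even sum_distrib_right)
    qed
    then show "(\<lambda>n. \<Sum>i\<in>UNIV. c n i i) \<longlonglongrightarrow> - newton_const TYPE('n)"
      using laplacian_nker_tendsto[of \<eta> B 0] \<eta>c(1) B(2) by (simp add: \<eta>0)
  qed
  define A where "A n i x = (LINT y|lebesgue. nker1 i (?e n) (x - y) * g y)" for n i x
  define D where "D i j x = (LINT y|lebesgue. nker2 i j 0 (x - y) * w x y) + g x * c0 i j" for i j x
  note reg = regularized_potential[OF N e gi, folded A_def]
  have Ad: "A n i differentiable (at x)" for n i x
    using reg(3)[of n i x] unfolding A_def[abs_def] .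
  have Ap: "partial_deriv j (A n i) x = (LINT y|lebesgue. nker2 i j (?e n) (x - y) * g y)" for n i j x
    using fun_cong[OF regularized_potential(4)[OF N e gi, of j i n], of x] unfolding A_def[abs_def] .
  have split: "partial_deriv j (A n i) x = (LINT y|lebesgue. nker2 i j (?e n) (x - y) * w x y) + g x * c n i j" for n i j x
  proof -
    have "(LINT y|lebesgue. nker2 i j (?e n) (x - y) * g y) =
        (LINT y|lebesgue. nker2 i j (?e n) (x - y) * w x y + g x * (nker2 i j (?e n) (x - y) * \<eta> (x - y)))"
      by (simp add: w_def algebra_simps)
    also have "\<dots> = (LINT y|lebesgue. nker2 i j (?e n) (x - y) * w x y) +
        (LINT y|lebesgue. g x * (nker2 i j (?e n) (x - y) * \<eta> (x - y)))"
      by (intro Bochner_Integration.integral_add integrable_mult_right k2i w1 \<eta>i)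
    finally show ?thesis using c_eq[of i j n x] by (simp add: Ap)
  qed
  have kb: "\<exists>C. kernel_bound (nker2 i j :: real \<Rightarrow> real^'n \<Rightarrow> real) (real CARD('n)) C" for i j
    by (rule kernel_bound_nker(3)[OF N])
  have U1: "uniform_limit S (\<lambda>n x. LINT y|lebesgue. nker2 i j (?e n) (x - y) * w x y)
      (\<lambda>x. LINT y|lebesgue. nker2 i j 0 (x - y) * w x y) sequentially"
    and int0: "x \<in> S \<Longrightarrow> integrable lebesgue (\<lambda>y. nker2 i j 0 (x - y) * w x y)" for i j x
  proof -
    obtain C where C: "kernel_bound (nker2 i j :: real \<Rightarrow> real^'n \<Rightarrow> real) (real CARD('n)) C" using kb by blast
    show "uniform_limit S (\<lambda>n x. LINT y|lebesgue. nker2 i j (?e n) (x - y) * w x y)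
      (\<lambda>x. LINT y|lebesgue. nker2 i j 0 (x - y) * w x y) sequentially"
      by (rule kernel_convolution_limit[OF C, where \<theta> = \<gamma> and R = r and H = H' and W = W])
        (use \<gamma> r H' N w1 w2 w3 in auto)
    show "integrable lebesgue (\<lambda>y. nker2 i j 0 (x - y) * w x y)" if "x \<in> S"
      by (rule kernel_convolution_integrable[OF C, where \<theta> = \<gamma> and R = r and H = H' and W = W and S = S])
        (use \<gamma> r H' N w1 w2 w3 that in auto)
  qed
  have U2: "uniform_limit S (\<lambda>n x. g x * c n i j) (\<lambda>x. g x * c0 i j) sequentially" for i j
  proof (rule uniform_limitI)
    fix \<epsilon> :: real assume "\<epsilon> > 0"
    then have "\<forall>\<^sub>F n in sequentially. dist (c n i j) (c0 i j) < \<epsilon> / (M + 1)"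
      using M0 by (intro tendstoD[OF c_lim]) simp
    then show "\<forall>\<^sub>F n in sequentially. \<forall>x\<in>S. dist (g x * c n i j) (g x * c0 i j) < \<epsilon>"
    proof eventually_elim
      case (elim n)
      show ?case
      proof
        fix x assume x: "x \<in> S"
        have "dist (g x * c n i j) (g x * c0 i j) = \<bar>g x\<bar> * dist (c n i j) (c0 i j)"
          by (simp add: dist_real_def flip: right_diff_distrib abs_mult)
        also have "\<dots> \<le> (M + 1) * dist (c n i j) (c0 i j)"
          using M[OF x] by (intro mult_right_mono) auto
        also have "\<dots> < \<epsilon>" using elim M0 by (simp add: pos_less_divide_eq mult.commute)
        finally show "dist (g x * c n i j) (g x * c0 i j) < \<epsilon>" .
      qed
    qed
  qed
  have U: "uniform_limit S (\<lambda>n. partial_deriv j (A n i)) (D i j) sequentially" for i j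
  proof -
    have "uniform_limit S (\<lambda>n x. (LINT y|lebesgue. nker2 i j (?e n) (x - y) * w x y) + g x * c n i j) (D i j) sequentially"
      unfolding D_def[abs_def] by (intro uniform_limit_add U1 U2)
    then show ?thesis unfolding split[symmetric] by simp
  qed
  have Al: "(\<lambda>n. A n i x) \<longlonglongrightarrow> partial_deriv i (npot g) x" for i x
  proof -
    have "uniform_limit (ball 0 (norm x + 1)) (\<lambda>n x. LINT y|lebesgue. nker1 i (?e n) (x - y) * g y)
         (\<lambda>x. LINT y|lebesgue. nker1 i 0 (x - y) * g y) sequentially"
      using kernel_bound_nker(2)[OF N, of i] kernel_density_limit(2)[OF _ _ _ g] N by fastforce
    from tendsto_uniform_limitI[OF this, of x] show ?thesis by (simp add: A_def npot_C1(2)[OF N g])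
  qed
  have S: "open S" "convex S" by (auto simp: S_def)
  show ?thesis
  proof (rule exI[of _ D], intro allI conjI ballI)
    fix i j :: 'n
    have "continuous_on S (D i j)"
    proof (rule uniform_limit_theorem[OF _ U])
      show "\<forall>\<^sub>F n in sequentially. continuous_on S (partial_deriv j (A n i))"
        using regularized_potential(5)[OF N e gi] by (intro always_eventually allI) (auto simp: Ap cong: continuous_on_cong intro: continuous_on_subset)
    qed simp
    then show "continuous_on (ball a r) (D i j)" by (simp add: S_def)
    fix x assume "x \<in> ball a r"
    then have x: "x \<in> S" by (simp add: S_def)
    show "partial_deriv i (npot g) differentiable (at x)" "partial_deriv j (partial_deriv i (npot g)) x = D i j x"
      using uniform_limit_partials[OF S Ad U Al x] by auto
    have "(\<Sum>i\<in>UNIV. LINT y|lebesgue. nker2 i i 0 (x - y) * w x y) =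
        (LINT y|lebesgue. (\<Sum>i\<in>UNIV. nker2 i i 0 (x - y)) * w x y)"
      unfolding sum_distrib_right by (intro Bochner_Integration.integral_sum[symmetric] int0[OF x])
    \<comment> \<open>The limit kernel has zero Laplacian, so only the subtracted part contributes
      to the trace.\<close>
    also have "\<dots> = 0" by (simp add: laplacian_nker)
    finally show "(\<Sum>i\<in>UNIV. D i i x) = - newton_const TYPE('n) * g x"
      unfolding D_def by (simp add: sum.distrib sum_distrib_left[symmetric] c_sum)
  qed
qed

lemma npot_C2:
  fixes g :: "real^'n::finite \<Rightarrow> real"
  assumes N: "CARD('n) \<ge> 3" and g: "potential_density g" and \<gamma>: "0 < \<gamma>" "\<gamma> < 1"
    and U: "open U" and hol: "locally_holder_on U \<gamma> g"
  shows "C_on 2 U (npot g)" and "x \<in> U \<Longrightarrow> laplacian (npot g) x = - newton_const TYPE('n) * g x"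
proof -
  have loc: "\<exists>r>0. \<exists>D. \<forall>i j. continuous_on (ball a r) (D i j) \<and> (\<forall>x\<in>ball a r.
    partial_deriv i (npot g) differentiable (at x) \<and> partial_deriv j (partial_deriv i (npot g)) x = D i j x \<and>
    (\<Sum>i\<in>UNIV. D i i x) = - newton_const TYPE('n) * g x)" if "a \<in> U" for a
  proof -
    have "\<exists>s>0. cball a s \<subseteq> U" using open_contains_cball[of U] U that by auto
    then obtain s where s: "s > 0" "cball a s \<subseteq> U" by blast
    obtain H where H: "\<forall>x\<in>cball a s. \<forall>y\<in>cball a s. \<bar>g x - g y\<bar> \<le> H * dist x y powr \<gamma>"
      using hol s compact_cball[of a s] unfolding locally_holder_on_def by blast
    \<comment> \<open>The constant in \<open>locally_holder_on\<close> has no prescribed sign and is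
      replaced by its positive part.\<close>
    have "H * dist x y powr \<gamma> \<le> max H 0 * dist x y powr \<gamma>" for x y :: "real^'n"
      by (intro mult_right_mono) auto
    with H have "\<And>x y. x \<in> cball a s \<Longrightarrow> y \<in> cball a s \<Longrightarrow> \<bar>g x - g y\<bar> \<le> max H 0 * dist x y powr \<gamma>"
      by (blast intro: order_trans)
    then have "\<exists>D. \<forall>i j. continuous_on (ball a (s / 2)) (D i j) \<and> (\<forall>x\<in>ball a (s / 2).
      partial_deriv i (npot g) differentiable (at x) \<and> partial_deriv j (partial_deriv i (npot g)) x = D i j x \<and>
      (\<Sum>i\<in>UNIV. D i i x) = - newton_const TYPE('n) * g x)"
      using s \<gamma> by (intro npot_second_derivatives[OF N g, of "s / 2" \<gamma> "max H 0" a]) simp_all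
    with s show ?thesis by (intro exI[of _ "s / 2"]) simp
  qed
  have c: "continuous_on U (partial_deriv j (partial_deriv i (npot g)))" for i j
    unfolding continuous_on_eq_continuous_at[OF U]
  proof
    fix a assume "a \<in> U"
    from loc[OF this] obtain r D where r: "r > 0" and *: "\<forall>i j. continuous_on (ball a r) (D i j) \<and> (\<forall>x\<in>ball a r.
      partial_deriv i (npot g) differentiable (at x) \<and> partial_deriv j (partial_deriv i (npot g)) x = D i j x \<and>
      (\<Sum>i\<in>UNIV. D i i x) = - newton_const TYPE('n) * g x)" by blast
    from * have D: "\<And>i j. continuous_on (ball a r) (D i j)"
      "\<And>i j x. x \<in> ball a r \<Longrightarrow> partial_deriv j (partial_deriv i (npot g)) x = D i j x" by blast+
    have "continuous_on (ball a r) (partial_deriv j (partial_deriv i (npot g)))"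
      by (rule continuous_on_eq[OF D(1)]) (simp add: D(2))
    then show "isCont (partial_deriv j (partial_deriv i (npot g))) a"
      using r by (rule_tac continuous_on_interior) auto
  qed
  have d: "partial_deriv i (npot g) differentiable (at a)" if "a \<in> U" for i a
  proof -
    from loc[OF that] obtain r D where "r > 0" and *: "\<forall>i j. continuous_on (ball a r) (D i j) \<and> (\<forall>x\<in>ball a r.
      partial_deriv i (npot g) differentiable (at x) \<and> partial_deriv j (partial_deriv i (npot g)) x = D i j x \<and>
      (\<Sum>i\<in>UNIV. D i i x) = - newton_const TYPE('n) * g x)" by blast
    then show ?thesis using centre_in_ball[of a r] by blast
  qed
  show "C_on 2 U (npot g)"
    using npot_C1(1)[OF N g] d c by (simp add: numeral_2_eq_2)
  show "laplacian (npot g) x = - newton_const TYPE('n) * g x" if "x \<in> U"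
  proof -
    from loc[OF that] obtain r D where r: "r > 0" and *: "\<forall>i j. continuous_on (ball x r) (D i j) \<and> (\<forall>z\<in>ball x r.
      partial_deriv i (npot g) differentiable (at z) \<and> partial_deriv j (partial_deriv i (npot g)) z = D i j z \<and>
      (\<Sum>i\<in>UNIV. D i i z) = - newton_const TYPE('n) * g z)" by blast
    have "x \<in> ball x r" using r by simp
    with * have "partial_deriv i (partial_deriv i (npot g)) x = D i i x" "(\<Sum>i\<in>UNIV. D i i x) = - newton_const TYPE('n) * g x" for i
      by blast+
    then show ?thesis by (simp add: laplacian_def)
  qed
qed

section \<open>Weakly harmonic functions vanishing at infinity\<close>

lemma vanishing_continuous_bounded:
  fixes h :: "'a::euclidean_space \<Rightarrow> real"
  assumes h: "continuous_on UNIV h" and lim: "(h \<longlongrightarrow> 0) at_infinity"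
  shows "\<exists>B>0. \<forall>x. \<bar>h x\<bar> \<le> B"
proof -
  have "\<forall>\<^sub>F x in at_infinity. dist (h x) 0 < 1" using lim by (rule tendstoD) simp
  then obtain R where R: "\<And>x. norm x \<ge> R \<Longrightarrow> \<bar>h x\<bar> < 1"
    by (auto simp: eventually_at_infinity)
  have "compact (h ` cball 0 R)"
    by (intro compact_continuous_image continuous_on_subset[OF h]) auto
  then obtain B where "\<forall>x\<in>cball 0 R. \<bar>h x\<bar> \<le> B"
    by (auto dest!: compact_imp_bounded simp: bounded_iff)
  then have "\<bar>h x\<bar> \<le> max B 1" for x
    using R[of x] by (cases "norm x \<le> R") (auto simp: le_max_iff_disj)
  then show ?thesis by (intro exI[of _ "max B 1"]) auto
qed

text \<open>Needed in closed form to match the derivative in \<open>s\<close> of a weight. The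
  indices come from \<open>bexp_DERIV\<close>: the derivative of \<open>bexp 0\<close> is
  \<open>bexp 2\<close>, and that of \<open>bexp 2\<close> at \<open>t\<close> is
  \<open>bexp 4 t - 2 * bexp 3 t\<close>.\<close>

lemma laplacian_bump:
  fixes a x :: "real^'n::finite"
  shows "laplacian (bump a s) x =
    4 / s ^ 4 * ((x - a) \<bullet> (x - a)) *
      (bexp 4 (1 - ((x - a) \<bullet> (x - a)) / s\<^sup>2) - 2 * bexp 3 (1 - ((x - a) \<bullet> (x - a)) / s\<^sup>2))
    - 2 * real CARD('n) / s\<^sup>2 * bexp 2 (1 - ((x - a) \<bullet> (x - a)) / s\<^sup>2)"
proof -
  define t where "t s x = 1 - ((x - a) \<bullet> (x - a)) / s\<^sup>2" for s and x :: "real^'n"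
  have p1: "partial_deriv i (bump a s) = (\<lambda>x. bexp 2 (t s x) * (- 2 / s\<^sup>2 * (x $ i - a $ i)))" for i
    using bexp_partial_deriv(2)[of i 0 a s] by (auto simp: bump_def[abs_def] t_def numeral_2_eq_2)
  have d2: "(\<lambda>x. bexp 2 (t s x)) differentiable (at x)"
    unfolding t_def by (rule bexp_partial_deriv(1))
  have lin: "((\<lambda>x::real^'n. - 2 / s\<^sup>2 * (x $ i - a $ i)) has_derivative (\<lambda>h. - 2 / s\<^sup>2 * h $ i)) (at x)" for i
    by (intro has_derivative_mult_right) (auto intro!: derivative_eq_intros bounded_linear_imp_has_derivative bounded_linear_vec_nth)
  have p2: "partial_deriv i (partial_deriv i (bump a s)) x =
      (bexp 4 (t s x) - 2 * bexp 3 (t s x)) * (4 / s ^ 4 * ((x $ i - a $ i) * (x $ i - a $ i))) - 2 / s\<^sup>2 * bexp 2 (t s x)" for i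
  proof -
    have "partial_deriv i (\<lambda>x. bexp 2 (t s x)) x = (bexp 4 (t s x) - 2 * bexp 3 (t s x)) * (- 2 / s\<^sup>2 * (x $ i - a $ i))"
      unfolding t_def by (subst bexp_partial_deriv(2)) simp
    moreover have "partial_deriv i (\<lambda>x::real^'n. - 2 / s\<^sup>2 * (x $ i - a $ i)) x = - 2 / s\<^sup>2"
      by (subst partial_derivI(2)[OF lin]) (simp add: axis_def)
    moreover have "s ^ 4 = s\<^sup>2 * s\<^sup>2" by (simp add: power_add[symmetric])
    ultimately show ?thesis
      unfolding p1 by (subst partial_deriv_mult(2)[OF d2 partial_derivI(1)[OF lin]]) (simp add: field_simps)
  qed
  have "(\<Sum>i\<in>UNIV. (x $ i - a $ i) * (x $ i - a $ i)) = (x - a) \<bullet> (x - a)" by (simp add: inner_vec_def)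
  then show ?thesis
    unfolding laplacian_def p2 sum_subtractf sum_distrib_left[symmetric] t_def[symmetric] by (simp add: mult_ac)
qed

text \<open>With \<open>b = bexp 0\<close> and \<open>b' = bexp 2\<close>, the weight \<open>k s x = s\<^sup>-\<^sup>N b'(1 - |x - a|\<^sup>2 / s\<^sup>2)\<close> satisfies
  \<open>\<partial>k/\<partial>s = (s\<^bsup>1-N\<^esup> / 2) \<Delta> b(1 - |x - a|\<^sup>2 / s\<^sup>2)\<close>. Hence the mean of a weakly harmonic function \<open>h\<close> with
  respect to this weight does not depend on \<open>s\<close>; it tends to a multiple of \<open>h a\<close> as \<open>s \<rightarrow> 0\<close>, and to \<open>0\<close> as
  \<open>s \<rightarrow> \<infinity>\<close>.\<close>

lemma weakly_harmonic_vanishing_eq_0: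
  fixes h :: "real^'n::finite \<Rightarrow> real"
  assumes h: "continuous_on UNIV h" and lim: "(h \<longlongrightarrow> 0) at_infinity"
    and harm: "\<And>\<phi>. test_function \<phi> \<Longrightarrow> (LINT x|lebesgue. h x * laplacian \<phi> x) = 0"
  shows "h a = 0"
proof -
  let ?N = "real CARD('n)"
  define t where "t s x = 1 - ((x - a) \<bullet> (x - a)) / s\<^sup>2" for s and x :: "real^'n"
  define k where "k s x = s powr - ?N * bexp 2 (t s x)" for s and x :: "real^'n"
  define M where "M s = (LINT x|lebesgue. h x * k s x)" for s
  have t_out: "bexp m (t s x) = 0" if "s > 0" "norm (x - a) \<ge> s" for m s x
  proof -
    have "s\<^sup>2 \<le> (x - a) \<bullet> (x - a)"
      using that unfolding power2_norm_eq_inner[symmetric] by (intro power_mono) auto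
    with \<open>s > 0\<close> have "1 \<le> ((x - a) \<bullet> (x - a)) / s\<^sup>2" by (subst pos_le_divide_eq) auto
    then show ?thesis by (simp add: t_def bexp_def)
  qed
  have tc: "continuous_on UNIV (\<lambda>x. bexp m (t s x))" for m s
    unfolding t_def divide_inverse by (intro continuous_on_compose2[OF continuous_bexp[of UNIV]] continuous_intros) auto
  have deriv: "((\<lambda>s. k s x) has_real_derivative s powr (1 - ?N) / 2 * laplacian (bump a s) x) (at s)" if s: "s > 0" for s x
  proof -
    let ?q = "(x - a) \<bullet> (x - a)"
    have ts: "((\<lambda>s. t s x) has_real_derivative 2 * ?q / s ^ 3) (at s)"
    proof -
      have s0: "s \<noteq> 0" using s by simp
      have "((\<lambda>s. 1 - ?q * inverse (s\<^sup>2)) has_real_derivative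
          0 - ?q * - (inverse (s\<^sup>2) * (2 * s) * inverse (s\<^sup>2))) (at s)"
        using s0 by (intro DERIV_diff DERIV_const DERIV_cmult DERIV_inverse') (auto intro!: derivative_eq_intros)
      moreover have "0 - ?q * - (inverse (s\<^sup>2) * (2 * s) * inverse (s\<^sup>2)) = 2 * ?q / s ^ 3"
        using s0 by (simp add: field_simps power2_eq_square power3_eq_cube)
      ultimately show ?thesis unfolding t_def divide_inverse[of ?q] by (simp only:)
    qed
    have "(bexp 2 has_real_derivative bexp 4 (t s x) - 2 * bexp 3 (t s x)) (at (t s x))"
      using bexp_DERIV[of 2 "t s x"] by simp
    then have "((\<lambda>s. bexp 2 (t s x)) has_real_derivative (bexp 4 (t s x) - 2 * bexp 3 (t s x)) * (2 * ?q / s ^ 3)) (at s)"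
      by (rule DERIV_chain2[where f = "bexp 2" and g = "\<lambda>s. t s x", OF _ ts])
    then have "((\<lambda>s. k s x) has_real_derivative (- ?N * s powr (- ?N - 1)) * bexp 2 (t s x) +
        (bexp 4 (t s x) - 2 * bexp 3 (t s x)) * (2 * ?q / s ^ 3) * s powr - ?N) (at s)"
      unfolding k_def using s by (intro DERIV_mult has_real_derivative_powr)
    also have "(- ?N * s powr (- ?N - 1)) * bexp 2 (t s x) +
        (bexp 4 (t s x) - 2 * bexp 3 (t s x)) * (2 * ?q / s ^ 3) * s powr - ?N =
        s powr (1 - ?N) / 2 * laplacian (bump a s) x"
    proof -
      have e: "s powr (- ?N - 1) = s powr - ?N / s" "s powr (1 - ?N) = s powr - ?N * s"
        using s powr_add[of s 1 "- ?N"] by (simp_all add: powr_diff)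
      have "laplacian (bump a s) x = 4 / s ^ 4 * ?q * (bexp 4 (t s x) - 2 * bexp 3 (t s x)) - 2 * ?N / s\<^sup>2 * bexp 2 (t s x)"
        unfolding t_def by (rule laplacian_bump)
      moreover have "(- ?N * (P / s)) * b2 + d * (2 * q / s ^ 3) * P = P * s / 2 * (4 / s ^ 4 * q * d - 2 * ?N / s\<^sup>2 * b2)"
        for P b2 d q :: real
        using s by (simp add: field_simps power2_eq_square power3_eq_cube power4_eq_xxxx)
      ultimately show ?thesis unfolding e by simp
    qed
    finally show ?thesis .
  qed
  have lapc: "continuous_on ({0<..} \<times> UNIV) (\<lambda>(s, x). laplacian (bump a s) x)"
  proof -
    have "continuous_on ({0<..} \<times> UNIV) (\<lambda>z. bexp m (t (fst z) (snd z)))" for m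
      unfolding t_def
      by (intro continuous_on_compose2[OF continuous_bexp[of UNIV]] continuous_intros) auto
    then show ?thesis
      unfolding laplacian_bump split_beta t_def[symmetric] by (intro continuous_intros) auto
  qed
  \<comment> \<open>For all radii below \<open>2 * s\<close> the weights are supported in one box,
    on which the rule for differentiating parameter integrals of continuous functions
    applies.\<close>
  have M': "(M has_real_derivative 0) (at s)" if s: "s > 0" for s
  proof -
    define U where "U = {0<..<2 * s}"
    obtain c where c: "ball a (2 * s) \<subseteq> cbox (- c) c"
      using bounded_subset_cbox_symmetric[OF bounded_ball] by blast
    have hk: "continuous_on UNIV (\<lambda>x. h x * k r x)" for r
      unfolding k_def by (intro continuous_intros h tc)
    have out: "k r x = 0" "laplacian (bump a r) x = 0" if "x \<notin> cbox (- c) c" "r \<in> U" for x r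
    proof -
      have "norm (x - a) \<ge> 2 * s" using that c by (auto simp: dist_norm norm_minus_commute subset_iff not_less[symmetric])
      then have "norm (x - a) \<ge> r" "r > 0" using that by (auto simp: U_def)
      then show "k r x = 0" "laplacian (bump a r) x = 0"
        using t_out[of r x] by (simp_all add: k_def laplacian_bump t_def[symmetric])
    qed
    have to_int: "(LINT x|lebesgue. F x) = integral (cbox (- c) c) F"
      if F: "continuous_on UNIV F" "\<And>x. x \<notin> cbox (- c) c \<Longrightarrow> F x = 0" for F :: "real^'n \<Rightarrow> real"
    proof -
      obtain R where R: "\<forall>x\<in>cbox (- c) c. norm x \<le> R" using bounded_cbox bounded_iff by blast
      have "integrable lebesgue F"
        by (rule integrable_continuous_support[of _ R]) (use F R in \<open>auto simp: not_le[symmetric]\<close>)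
      then have "(LINT x|lebesgue. F x) = integral UNIV F" by (simp add: integral_lebesgue)
      also have "\<dots> = integral UNIV (\<lambda>x. if x \<in> cbox (- c) c then F x else 0)"
        using F(2) by (intro arg_cong2[where f = integral]) auto
      finally show ?thesis by (simp only: integral_restrict_UNIV)
    qed
    have "((\<lambda>r. integral (cbox (- c) c) (\<lambda>x. h x * k r x)) has_field_derivative
        integral (cbox (- c) c) (\<lambda>x. h x * (s powr (1 - ?N) / 2 * laplacian (bump a s) x))) (at s within U)"
    proof (rule leibniz_rule_field_derivative)
      show "((\<lambda>r. h x * k r x) has_field_derivative h x * (r powr (1 - ?N) / 2 * laplacian (bump a r) x)) (at r within U)"
        if "r \<in> U" for r x
        using that by (intro DERIV_cmult has_field_derivative_at_within[OF deriv]) (auto simp: U_def)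
      show "(\<lambda>x. h x * k r x) integrable_on cbox (- c) c" for r
        by (intro integrable_continuous continuous_on_subset[OF hk]) auto
      have "continuous_on (U \<times> cbox (- c) c) (\<lambda>z. laplacian (bump a (fst z)) (snd z))"
        by (rule continuous_on_subset[OF lapc[unfolded split_beta]]) (auto simp: U_def)
      then show "continuous_on (U \<times> cbox (- c) c) (\<lambda>(r, x). h x * (r powr (1 - ?N) / 2 * laplacian (bump a r) x))"
        unfolding split_beta by (intro continuous_intros continuous_on_compose2[OF h]) (auto simp: U_def)
    qed (use s in \<open>auto simp: U_def\<close>)
    also have "integral (cbox (- c) c) (\<lambda>x. h x * (s powr (1 - ?N) / 2 * laplacian (bump a s) x)) = 0"
    proof -
      have bc: "continuous_on UNIV (laplacian (bump a s))"
        using test_functionD(4)[OF test_function_bump[OF s, of 1 a]] by simp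
      have "integral (cbox (- c) c) (\<lambda>x. h x * (s powr (1 - ?N) / 2 * laplacian (bump a s) x)) =
          (LINT x|lebesgue. h x * (s powr (1 - ?N) / 2 * laplacian (bump a s) x))"
        by (rule to_int[symmetric]) (use s in \<open>auto intro!: continuous_intros h bc simp: out(2)[of _ s] U_def\<close>)
      also have "\<dots> = s powr (1 - ?N) / 2 * (LINT x|lebesgue. h x * laplacian (bump a s) x)"
        unfolding integral_mult_right_zero[symmetric] by (simp add: mult_ac)
      also have "(LINT x|lebesgue. h x * laplacian (bump a s) x) = 0"
        using harm[OF test_function_bump[OF s, of 1 a]] by simp
      finally show ?thesis by simp
    qed
    finally have "((\<lambda>r. integral (cbox (- c) c) (\<lambda>x. h x * k r x)) has_field_derivative 0) (at s)"
      using s by (simp add: U_def at_within_open[of s "{0<..<2 * s}"])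
    moreover have "M r = integral (cbox (- c) c) (\<lambda>x. h x * k r x)" if "r \<in> U" for r
      unfolding M_def using that out(1)[OF _ that] by (intro to_int hk) simp
    ultimately show ?thesis
      by (rule_tac DERIV_cong_ev[THEN iffD1, OF refl _ refl, rotated])
        (use s eventually_nhds_in_open[of U s] in \<open>auto elim!: eventually_mono simp: U_def\<close>)
  qed
  have "\<exists>m. \<forall>s\<in>{0<..}. M s = m"
    by (rule has_field_derivative_zero_constant) (auto intro!: has_field_derivative_at_within[OF M'])
  then obtain m where m: "\<And>s. s > 0 \<Longrightarrow> M s = m" by auto
  define p where "p w = bexp 2 (1 - w \<bullet> w)" for w :: "real^'n"
  have pc: "continuous_on UNIV p"
    unfolding p_def by (intro continuous_on_compose2[OF continuous_bexp[of UNIV]] continuous_intros) auto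
  have p_out: "p w = 0" if "norm w > 1" for w
  proof -
    have "w \<bullet> w \<ge> 1" using that by (simp add: norm_eq_sqrt_inner)
    then show ?thesis by (simp add: p_def bexp_def)
  qed
  have pi: "integrable lborel p"
    using integrable_continuous_support[OF pc p_out] borel_measurable_continuous_onI[OF pc]
    by (simp add: integrable_completion)
  have [measurable]: "h \<in> borel_measurable borel" "p \<in> borel_measurable borel"
    using h pc by (auto intro: borel_measurable_continuous_onI)
  \<comment> \<open>Rescaling moves \<open>s\<close> from the weight to the argument of
    \<open>h\<close>, so both limits in \<open>s\<close> are taken with the fixed profile
    \<open>p\<close>.\<close>
  have Ms: "M s = (LINT w|lborel. p w * h (a + s *\<^sub>R w))" if s: "s > 0" for s
  proof -
    have km: "k s \<in> borel_measurable borel"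
      unfolding k_def[abs_def] by (intro borel_measurable_continuous_onI continuous_intros tc)
    have "M s = (LINT x|lborel. h x * k s x)"
      unfolding M_def using km by (intro integral_completion) auto
    also have "\<dots> = s ^ CARD('n) * (LINT w|lborel. h (a + s *\<^sub>R w) * k s (a + s *\<^sub>R w))"
      using km by (subst lborel_integral_scale[OF _ s, of _ a]) auto
    also have "\<dots> = (LINT w|lborel. s ^ CARD('n) * (h (a + s *\<^sub>R w) * k s (a + s *\<^sub>R w)))" by simp
    also have "\<dots> = (LINT w|lborel. p w * h (a + s *\<^sub>R w))"
    proof (rule Bochner_Integration.integral_cong[OF refl])
      fix w
      have "t s (a + s *\<^sub>R w) = 1 - w \<bullet> w" using s by (simp add: t_def power2_eq_square)
      then show "s ^ CARD('n) * (h (a + s *\<^sub>R w) * k s (a + s *\<^sub>R w)) = p w * h (a + s *\<^sub>R w)"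
        using s by (simp add: k_def p_def powr_minus powr_realpow)
    qed
    finally show ?thesis .
  qed
  obtain B where B: "B > 0" "\<And>x. \<bar>h x\<bar> \<le> B" using vanishing_continuous_bounded[OF h lim] by blast
  have "(\<lambda>n. LINT w|lborel. p w * h (a + inverse (real (Suc n)) *\<^sub>R w)) \<longlonglongrightarrow> (LINT w|lborel. p w) * h a"
    by (rule approximate_identity[OF pi h B(2) LIMSEQ_inverse_real_of_nat])
  moreover have "(LINT w|lborel. p w * h (a + inverse (real (Suc n)) *\<^sub>R w)) = m" for n
    using Ms[of "inverse (real (Suc n))"] m[of "inverse (real (Suc n))"] by simp
  ultimately have 1: "m = (LINT w|lborel. p w) * h a" by (simp add: LIMSEQ_const_iff)
  \<comment> \<open>For \<open>w \<noteq> 0\<close> the points at which \<open>h\<close> is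
    evaluated escape to infinity, where \<open>h\<close> vanishes; the bound on \<open>h\<close>
    provides the dominating function.\<close>
  have "(\<lambda>n. LINT w|lborel. p w * h (a + real (Suc n) *\<^sub>R w)) \<longlonglongrightarrow> (LINT w::real^'n|lborel. 0)"
  proof (rule integral_dominated_convergence[where w = "\<lambda>w. \<bar>p w\<bar> * B"])
    show "AE w in lborel. (\<lambda>n. p w * h (a + real (Suc n) *\<^sub>R w)) \<longlonglongrightarrow> 0"
      using AE_lborel_singleton[of "0::real^'n"]
    proof eventually_elim
      case (elim w)
      have "filterlim (\<lambda>n. real (Suc n) * norm w - norm a) at_top sequentially"
        unfolding diff_conv_add_uminus add.commute[of _ "- norm a"]
        using elim by (intro filterlim_tendsto_add_at_top[OF tendsto_const] filterlim_at_top_mult_tendsto_pos[OF tendsto_const]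
          filterlim_compose[OF filterlim_real_sequentially filterlim_Suc]) auto
      then have "filterlim (\<lambda>n. norm (a + real (Suc n) *\<^sub>R w)) at_top sequentially"
      proof (rule filterlim_at_top_mono, intro always_eventually allI)
        fix n
        show "real (Suc n) * norm w - norm a \<le> norm (a + real (Suc n) *\<^sub>R w)"
          using norm_triangle_ineq2[of "real (Suc n) *\<^sub>R w" "- a"] by (simp add: add.commute)
      qed
      then have "filterlim (\<lambda>n. a + real (Suc n) *\<^sub>R w) at_infinity sequentially"
        by (rule filterlim_norm_at_top_imp_at_infinity)
      then have "(\<lambda>n. h (a + real (Suc n) *\<^sub>R w)) \<longlonglongrightarrow> 0"
        by (rule filterlim_compose[OF lim])
      then show ?case by (rule tendsto_mult_right_zero)
    qed
    show "AE w in lborel. norm (p w * h (a + real (Suc n) *\<^sub>R w)) \<le> \<bar>p w\<bar> * B" for n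
      using B(2) by (auto simp: abs_mult intro!: mult_left_mono)
  qed (use pi in auto)
  moreover have "(LINT w|lborel. p w * h (a + real (Suc n) *\<^sub>R w)) = m" for n
    using Ms[of "real (Suc n)"] m[of "real (Suc n)"] by simp
  ultimately have 2: "m = 0" by (simp add: LIMSEQ_const_iff)
  \<comment> \<open>The constant mean is a multiple of \<open>h a\<close> and is zero; it remains to
    see that the factor, the mass of \<open>p\<close>, is nonzero.\<close>
  have "(LINT w|lborel. p w) \<noteq> 0"
  proof
    assume "(LINT w|lborel. p w) = 0"
    moreover have "AE w in lborel. 0 \<le> p w" by (simp add: p_def bexp_nonneg)
    ultimately have "AE w in lborel. p w = 0"
      using integral_nonneg_eq_0_iff_AE[OF pi] by blast
    moreover have "p w \<noteq> 0" if "w \<in> ball 0 1" for w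
    proof -
      have "w \<bullet> w < 1" using that by (simp add: norm_eq_sqrt_inner)
      then show ?thesis by (simp add: p_def bexp_def)
    qed
    ultimately have "AE w in lborel. w \<notin> ball (0::real^'n) 1" by (auto elim!: eventually_mono)
    then have "emeasure lborel (ball (0::real^'n) 1) = 0"
      by (subst (asm) AE_iff_measurable[of "ball 0 1"]) auto
    then show False using unit_ball_vol_pos[of "real CARD('n)"] by (simp add: emeasure_ball)
  qed
  with 1 2 show ?thesis by simp
qed

section \<open>Decay of Newtonian potentials\<close>

lemma AE_lebesgue_neq: "AE y in lebesgue. y \<noteq> (x::'a::euclidean_space)"
  using AE_lborel_singleton[of x] by (rule AE_completion)

lemma npot_integrable:
  fixes g :: "real^'n::finite \<Rightarrow> real"
  assumes N: "CARD('n) \<ge> 3" and g: "potential_density g"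
  shows "integrable lebesgue (\<lambda>y. nker 0 (x - y) * g y)"
  using kernel_bound_nker(1)[OF N] kernel_density_limit(1)[OF _ _ _ g, of nker _ _ 0 x] N by fastforce

lemma npot_mono:
  fixes g :: "real^'n::finite \<Rightarrow> real"
  assumes N: "CARD('n) \<ge> 3" and g: "potential_density g" "potential_density g'"
    and le: "AE y in lebesgue. g y \<le> g' y"
  shows "npot g x \<le> npot g' x"
  unfolding npot_def
proof (rule integral_mono_AE)
  show "AE y in lebesgue. nker 0 (x - y) * g y \<le> nker 0 (x - y) * g' y"
    using le by eventually_elim (auto simp: nker_def intro!: mult_left_mono)
qed (intro npot_integrable[OF N] g)+

lemma npot_cmult: "npot (\<lambda>y. c * g y) x = c * npot g x"
  unfolding npot_def integral_mult_right_zero[symmetric] by (simp add: mult.left_commute)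

lemma npot_add:
  fixes g :: "real^'n::finite \<Rightarrow> real"
  assumes N: "CARD('n) \<ge> 3" and g: "potential_density g" "potential_density g'"
  shows "npot (\<lambda>y. g y + g' y) x = npot g x + npot g' x"
  unfolding npot_def distrib_left
  by (intro Bochner_Integration.integral_add npot_integrable[OF N] g)

lemma potential_density_mult:
  fixes g F :: "real^'n::finite \<Rightarrow> real"
  assumes g: "potential_density g" and F: "F \<in> borel_measurable lebesgue" "\<And>x. \<bar>F x\<bar> \<le> K"
  shows "potential_density (\<lambda>y. g y * F y)"
  unfolding potential_density_def
proof (intro conjI allI)
  have "integrable lebesgue g" using g by (simp add: potential_density_def)
  from integrable_bounded_mult[OF F this] show "integrable lebesgue (\<lambda>y. g y * F y)" by (simp add: mult.commute)
  fix R
  obtain M where "AE y in lebesgue. norm y \<le> R \<longrightarrow> \<bar>g y\<bar> \<le> M"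
    using g by (auto simp: potential_density_def)
  then have "AE y in lebesgue. norm y \<le> R \<longrightarrow> \<bar>g y * F y\<bar> \<le> M * K"
  proof eventually_elim
    case (elim y)
    show ?case
      unfolding abs_mult using elim F(2)[of y] by (auto intro!: mult_mono intro: order_trans[OF abs_ge_zero])
  qed
  then show "\<exists>M. AE y in lebesgue. norm y \<le> R \<longrightarrow> \<bar>g y * F y\<bar> \<le> M" ..
qed

lemma potential_density_ball:
  fixes g :: "real^'n::finite \<Rightarrow> real"
  assumes "potential_density g"
  shows "potential_density (\<lambda>y. g y * indicator (cball 0 R) y)"
proof (rule potential_density_mult[OF assms, of _ 1])
  show "indicator (cball 0 R) \<in> borel_measurable (lebesgue :: (real^'n) measure)"
    by (intro borel_imp_lebesgue_measurable borel_measurable_indicator) simp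
qed (auto simp: indicator_def)

lemma potential_density_cmult: "potential_density g \<Longrightarrow> potential_density (\<lambda>y. c * g y)"
  using potential_density_mult[of g "\<lambda>_. c" "\<bar>c\<bar>"] by (simp add: mult.commute)

text \<open>The decay |x|^(2-N) of the kernel, altered so as to be bounded and positive at the
  origin; upper and lower bounds of potentials are expressed as multiples of it.\<close>

definition newton_profile :: "real^'n::finite \<Rightarrow> real" where
  "newton_profile x = (1 + norm x) powr (2 - real CARD('n))"

lemma newton_profile_pos: "newton_profile x > 0"
  using norm_ge_zero[of x] unfolding newton_profile_def powr_gt_zero by linarith

lemma newton_profile_le_1: "CARD('n) \<ge> 3 \<Longrightarrow> newton_profile (x :: real^'n::finite) \<le> 1"
  using powr_mono2'[of "2 - real CARD('n)" 1 "1 + norm x"] by (simp add: newton_profile_def)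

lemma newton_profile_tendsto_0:
  assumes "CARD('n::finite) \<ge> 3"
  shows "((newton_profile :: real^'n \<Rightarrow> real) \<longlongrightarrow> 0) at_infinity"
proof -
  have "filterlim (\<lambda>x::real^'n. 1 + norm x) at_top at_infinity"
    by (intro filterlim_tendsto_add_at_top[OF tendsto_const] filterlim_norm_at_top)
  then show ?thesis
    unfolding newton_profile_def[abs_def] using assms
    by (intro tendsto_neg_powr) auto
qed

text \<open>The polar formula needs a Borel function, while \<open>sphere_max \<rho>\<close> is only
  Lebesgue measurable. Raising a Borel version to \<open>\<infinity>\<close> on a Borel null set
  keeps the bound at every \<open>y\<close>, not merely at almost every radius, and leaves the
  integral unchanged.\<close>

lemma sphere_max_borel_majorant:
  fixes \<rho> :: "real^'n::finite \<Rightarrow> real"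
  assumes "sphere_max \<rho> \<in> borel_measurable lebesgue"
  obtains \<Phi> where "\<Phi> \<in> borel_measurable borel" "\<And>y. ennreal (\<rho> y) \<le> \<Phi> (norm y)"
    "(\<integral>\<^sup>+r\<in>{0<..}. ennreal (r ^ k) * \<Phi> r \<partial>lborel) = (\<integral>\<^sup>+r\<in>{0<..}. ennreal (r ^ k) * sphere_max \<rho> r \<partial>lebesgue)"
proof -
  obtain \<Phi>' where [measurable]: "\<Phi>' \<in> borel_measurable borel" and eq: "AE r in lborel. sphere_max \<rho> r = \<Phi>' r"
    using completion_ex_borel_measurable[OF assms] by auto
  obtain Z where Z0: "{r \<in> space lborel. sphere_max \<rho> r \<noteq> \<Phi>' r} \<subseteq> Z" "emeasure lborel Z = 0" "Z \<in> sets lborel"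
    by (rule AE_E[OF eq])
  then have Z: "Z \<in> null_sets lborel" "{r \<in> space lborel. sphere_max \<rho> r \<noteq> \<Phi>' r} \<subseteq> Z" by auto
  have [measurable]: "Z \<in> sets borel" using Z(1) by auto
  define \<Phi> where "\<Phi> r = (if r \<in> Z then \<infinity> else \<Phi>' r)" for r
  have m [measurable]: "\<Phi> \<in> borel_measurable borel" unfolding \<Phi>_def[abs_def] by measurable
  have "ennreal (\<rho> y) \<le> \<Phi> (norm y)" for y
  proof -
    have "ennreal (\<rho> y) \<le> sphere_max \<rho> (norm y)" unfolding sphere_max_def by (rule SUP_upper) simp
    moreover have "sphere_max \<rho> (norm y) = \<Phi>' (norm y)" if "norm y \<notin> Z" using Z(2) that by auto
    ultimately show ?thesis by (cases "norm y \<in> Z") (simp_all add: \<Phi>_def)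
  qed
  moreover have "(\<integral>\<^sup>+r\<in>{0<..}. ennreal (r ^ k) * \<Phi> r \<partial>lborel) = (\<integral>\<^sup>+r\<in>{0<..}. ennreal (r ^ k) * sphere_max \<rho> r \<partial>lebesgue)"
  proof -
    have "AE r in lborel. \<Phi> r = sphere_max \<rho> r"
      using eq AE_not_in[OF Z(1)] by eventually_elim (simp add: \<Phi>_def)
    then have ae: "AE r in lebesgue. \<Phi> r = sphere_max \<rho> r" by (rule AE_completion)
    have "(\<integral>\<^sup>+r\<in>{0<..}. ennreal (r ^ k) * \<Phi> r \<partial>lborel) = (\<integral>\<^sup>+r\<in>{0<..}. ennreal (r ^ k) * \<Phi> r \<partial>lebesgue)"
      by (rule nn_integral_completion[symmetric]) measurable
    also have "\<dots> = (\<integral>\<^sup>+r\<in>{0<..}. ennreal (r ^ k) * sphere_max \<rho> r \<partial>lebesgue)"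
      by (rule nn_integral_cong_AE) (use ae in \<open>auto elim!: eventually_mono\<close>)
    finally show ?thesis .
  qed
  ultimately show ?thesis using that m by blast
qed

text \<open>The radial kernel bound degenerates at the origin, where local boundedness of
  \<open>\<rho>\<close> controls the potential instead; the two estimates are glued at
  \<open>norm x = 1\<close>. Integrability of \<open>\<rho>\<close> is the polar formula with
  angular factor 1.\<close>

lemma newtonian_potential_decay:
  fixes \<rho> :: "real^'n::finite \<Rightarrow> real"
  assumes N: "CARD('n) \<ge> 3" and \<rho>: "Linf_loc \<rho>" "AE x in lebesgue. \<rho> x \<ge> 0"
    and m: "sphere_max \<rho> \<in> borel_measurable lebesgue"
    and fin: "(\<integral>\<^sup>+r\<in>{0<..}. ennreal (r ^ (CARD('n) - 1)) * sphere_max \<rho> r \<partial>lebesgue) < \<infinity>"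
  shows "potential_density \<rho>" and "\<exists>C>0. \<forall>x. npot \<rho> x \<le> C * newton_profile x"
proof -
  let ?N = "real CARD('n)"
  have \<rho>m [measurable]: "\<rho> \<in> borel_measurable lebesgue" using \<rho>(1) by (simp add: Linf_loc_def)
  obtain \<Phi> where [measurable]: "\<Phi> \<in> borel_measurable borel" and \<Phi>: "\<And>y. ennreal (\<rho> y) \<le> \<Phi> (norm y)"
    and \<Phi>I: "(\<integral>\<^sup>+r\<in>{0<..}. ennreal (r ^ (CARD('n) - 1)) * \<Phi> r \<partial>lborel) =
      (\<integral>\<^sup>+r\<in>{0<..}. ennreal (r ^ (CARD('n) - 1)) * sphere_max \<rho> r \<partial>lebesgue)"
    using sphere_max_borel_majorant[OF m] by blast
  define J where "J = (\<integral>\<^sup>+r\<in>{0<..}. ennreal (r ^ (CARD('n) - 1)) * \<Phi> r \<partial>lborel)"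
  have J: "J < \<infinity>" using fin \<Phi>I by (simp add: J_def)
  have "(\<integral>\<^sup>+y. ennreal (norm (\<rho> y)) \<partial>lebesgue) \<le> (\<integral>\<^sup>+y. \<Phi> (norm y) \<partial>(lebesgue :: (real^'n) measure))"
    using \<rho>(2) \<Phi> by (intro nn_integral_mono_AE) (auto elim!: eventually_mono)
  also have "\<dots> = (\<integral>\<^sup>+y. 1 * \<Phi> (norm y) \<partial>(lborel :: (real^'n) measure))"
    by (subst nn_integral_completion) simp_all
  also have "\<dots> = (\<integral>\<^sup>+y\<in>cball (0::real^'n) 1. 1 \<partial>lborel) *
      (\<integral>\<^sup>+r\<in>{0<..}. ennreal (real DIM(real^'n) * r ^ (DIM(real^'n) - 1)) * \<Phi> r \<partial>lborel)"
    by (rule nn_integral_homogeneous_polar) (auto simp: emeasure_cball)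
  also have "(\<integral>\<^sup>+r\<in>{0<..}. ennreal (real DIM(real^'n) * r ^ (DIM(real^'n) - 1)) * \<Phi> r \<partial>lborel) =
      (\<integral>\<^sup>+r. ennreal ?N * (ennreal (r ^ (CARD('n) - 1)) * \<Phi> r * indicator {0<..} r) \<partial>lborel)"
    by (intro nn_integral_cong) (auto simp: ennreal_mult' mult.assoc)
  also have "\<dots> = ennreal ?N * J" unfolding J_def by (intro nn_integral_cmult) auto
  also have "(\<integral>\<^sup>+y\<in>cball (0::real^'n) 1. 1 \<partial>lborel) * (ennreal ?N * J) < \<infinity>"
    using J by (auto simp: emeasure_cball ennreal_mult_less_top)
  finally have \<rho>i: "integrable lebesgue \<rho>" by (intro integrableI_bounded) auto
  show dens: "potential_density \<rho>"
    unfolding potential_density_def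
  proof (intro conjI \<rho>i allI)
    fix R
    have "compact (cball (0::real^'n) R)" by simp
    then obtain M where "AE x in lebesgue. x \<in> cball 0 R \<longrightarrow> \<bar>\<rho> x\<bar> \<le> M"
      using \<rho>(1) unfolding Linf_loc_def by blast
    then show "\<exists>M. AE y in lebesgue. norm y \<le> R \<longrightarrow> \<bar>\<rho> y\<bar> \<le> M" by auto
  qed
  obtain C1 where C1: "C1 \<ge> 0" "\<And>(x::real^'n) \<Phi>. x \<noteq> 0 \<Longrightarrow> \<Phi> \<in> borel_measurable borel \<Longrightarrow>
    (\<integral>\<^sup>+y. ennreal (norm (x - y) powr (2 - ?N)) * \<Phi> (norm y) \<partial>lborel) \<le>
    ennreal (C1 * norm x powr (2 - ?N)) * (\<integral>\<^sup>+r\<in>{0<..}. ennreal (r ^ (CARD('n) - 1)) * \<Phi> r \<partial>lborel)"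
    using newtonian_kernel_radial_bound[where 'a = "real^'n"] N by auto
  have far: "npot \<rho> x \<le> C1 * enn2real J * norm x powr (2 - ?N)" if x: "x \<noteq> 0" for x
  proof -
    have "ennreal (npot \<rho> x) = (\<integral>\<^sup>+y. ennreal (nker 0 (x - y) * \<rho> y) \<partial>lebesgue)"
      unfolding npot_def using \<rho>(2) by (intro nn_integral_eq_integral[symmetric] npot_integrable[OF N dens])
        (auto elim!: eventually_mono simp: nker_def)
    also have "\<dots> \<le> (\<integral>\<^sup>+y. ennreal (norm (x - y) powr (2 - ?N)) * \<Phi> (norm y) \<partial>lebesgue)"
      using \<rho>(2) \<Phi> by (intro nn_integral_mono_AE)
        (auto elim!: eventually_mono simp: nker_0_eq ennreal_mult intro!: mult_left_mono)
    also have "\<dots> = (\<integral>\<^sup>+y. ennreal (norm (x - y) powr (2 - ?N)) * \<Phi> (norm y) \<partial>lborel)"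
      by (rule nn_integral_completion) measurable
    also have "\<dots> \<le> ennreal (C1 * norm x powr (2 - ?N)) * J"
      unfolding J_def by (rule C1(2)[OF x]) measurable
    also have "J = ennreal (enn2real J)" using J by simp
    also have "ennreal (C1 * norm x powr (2 - ?N)) * ennreal (enn2real J) = ennreal (C1 * enn2real J * norm x powr (2 - ?N))"
      using C1(1) by (subst ennreal_mult[symmetric]) (auto simp: mult_ac)
    finally show ?thesis using C1(1) by (subst (asm) ennreal_le_iff) auto
  qed
  obtain C2 where C2: "\<And>x. norm x \<le> 1 \<Longrightarrow> npot \<rho> x \<le> C2" "C2 \<ge> 0"
  proof -
    obtain M where M: "M \<ge> 0" "\<And>x. norm x \<le> 1 \<Longrightarrow> AE y in lebesgue. norm (x - y) \<le> 1 \<longrightarrow> y \<noteq> x \<longrightarrow> \<bar>\<rho> y\<bar> \<le> M * norm (x - y) powr 0"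
      using potential_density_near[OF dens, of 1] by blast
    have M': "AE y in lebesgue. norm (x - y) \<le> 1 \<longrightarrow> \<bar>\<rho> y\<bar> \<le> M" if "norm x \<le> 1" for x
      using M(2)[OF that] AE_lebesgue_neq[of x] by eventually_elim auto
    obtain C where C: "C \<ge> 0" "\<And>(g :: real^'n \<Rightarrow> real) M x. integrable lebesgue g \<Longrightarrow> M \<ge> 0 \<Longrightarrow>
      (AE y in lebesgue. norm (x - y) \<le> 1 \<longrightarrow> \<bar>g y\<bar> \<le> M) \<Longrightarrow> \<bar>npot g x\<bar> \<le> M * C + (LINT y|lebesgue. \<bar>g y\<bar>)"
      using npot_bound[where 'n = 'n, OF N] by blast
    have "npot \<rho> x \<le> M * C + (LINT y|lebesgue. \<bar>\<rho> y\<bar>)" if "norm x \<le> 1" for x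
      using C(2)[OF \<rho>i M(1) M'[OF that]] by linarith
    then show ?thesis using that[of "M * C + (LINT y|lebesgue. \<bar>\<rho> y\<bar>)"] M(1) C(1) by simp
  qed
  \<comment> \<open>For \<open>norm x \<ge> 1\<close> one has
    \<open>norm x \<ge> (1 + norm x) / 2\<close>, which costs the power of 2; the same power lifts
    the profile to at least 1 on the unit ball. The summand 1 ensures \<open>C > 0\<close>.\<close>
  define C where "C = (C1 * enn2real J + C2) * 2 powr (?N - 2) + 1"
  have "npot \<rho> x \<le> C * newton_profile x" for x
  proof -
    have p: "newton_profile x > 0" by (rule newton_profile_pos)
    have "npot \<rho> x \<le> (C1 * enn2real J + C2) * 2 powr (?N - 2) * newton_profile x"
    proof (cases "norm x \<le> 1")
      case True
      have "2 powr (2 - ?N) \<le> newton_profile x"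
        unfolding newton_profile_def using True N by (intro powr_mono2') (auto simp: add_pos_nonneg)
      then have "1 \<le> 2 powr (?N - 2) * newton_profile x"
        using mult_left_mono[of "2 powr (2 - ?N)" "newton_profile x" "2 powr (?N - 2)"] by (simp add: powr_add[symmetric])
      then have "C2 * 1 \<le> (C1 * enn2real J + C2) * (2 powr (?N - 2) * newton_profile x)"
        using C1(1) C2(2) by (intro mult_mono) auto
      then show ?thesis using C2(1)[OF True] by (simp add: mult.assoc)
    next
      case False
      then have x0: "x \<noteq> 0" by auto
      have "norm x powr (2 - ?N) \<le> ((1 + norm x) / 2) powr (2 - ?N)"
        using False N by (intro powr_mono2') auto
      also have "\<dots> = 2 powr (?N - 2) * newton_profile x"
        using powr_minus[of 2 "?N - 2"] by (simp add: powr_divide newton_profile_def field_simps)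
      finally have "C1 * enn2real J * norm x powr (2 - ?N) \<le> (C1 * enn2real J + C2) * (2 powr (?N - 2) * newton_profile x)"
        using C1(1) C2(2) by (intro mult_mono) auto
      then show ?thesis using far[OF x0] by (simp add: mult.assoc)
    qed
    also have "\<dots> \<le> C * newton_profile x" using p by (intro mult_right_mono) (auto simp: C_def)
    finally show ?thesis .
  qed
  moreover have "C > 0" using C1(1) C2(2) by (simp add: C_def add_nonneg_pos)
  ultimately show "\<exists>C>0. \<forall>x. npot \<rho> x \<le> C * newton_profile x" by blast
qed

text \<open>For \<open>norm y \<le> R\<close> and \<open>R \<ge> 1\<close> the distance from
  \<open>x\<close> to \<open>y\<close> is at most \<open>R * (1 + norm x)\<close>, so the kernel is
  at least a fixed multiple of the profile. The density is cut to a ball so that later a source has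
  to be bounded below on a compact set only.\<close>

lemma potential_lower_bound:
  fixes g :: "real^'n::finite \<Rightarrow> real"
  assumes N: "CARD('n) \<ge> 3" and g: "potential_density g" and nonneg: "AE y in lebesgue. g y \<ge> 0"
    and nz: "\<not> (AE y in lebesgue. g y = 0)"
  shows "\<exists>R\<ge>1. \<exists>c>0. \<forall>x. npot (\<lambda>y. g y * indicator (cball 0 R) y) x \<ge> c * newton_profile x"
proof -
  let ?N = "real CARD('n)"
  have gi: "integrable lebesgue g" using g by (simp add: potential_density_def)
  let ?g = "\<lambda>R y. g y * indicator (cball 0 R) y"
  have dens: "potential_density (?g R)" for R
    by (rule potential_density_ball[OF g])
  have gRi: "integrable lebesgue (?g R)" for R using dens by (simp add: potential_density_def)
  have gRn: "AE y in lebesgue. ?g R y \<ge> 0" for R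
    using nonneg by eventually_elim (auto simp: indicator_def)
  \<comment> \<open>Some ball carries mass: otherwise \<open>g\<close> would vanish almost
    everywhere on each of countably many balls that exhaust the space.\<close>
  have "\<exists>n. (LINT y|lebesgue. ?g (real (Suc n)) y) > 0"
  proof (rule ccontr)
    assume "\<not> ?thesis"
    then have "(LINT y|lebesgue. ?g (real (Suc n)) y) = 0" for n
      using integral_nonneg_AE[OF gRn[of "real (Suc n)"]] by (metis less_eq_real_def)
    then have "AE y in lebesgue. ?g (real (Suc n)) y = 0" for n
      using integral_nonneg_eq_0_iff_AE[OF gRi gRn] by blast
    then have "AE y in lebesgue. \<forall>n. ?g (real (Suc n)) y = 0"
      unfolding AE_all_countable by blast
    then have "AE y in lebesgue. g y = 0"
    proof eventually_elim
      case (elim y)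
      obtain n where "norm y \<le> real n" using real_arch_simple by blast
      then have "y \<in> cball 0 (real (Suc n))" by simp
      with elim show ?case by (metis indicator_simps(1) mult.right_neutral)
    qed
    with nz show False by simp
  qed
  then obtain n where n: "(LINT y|lebesgue. ?g (real (Suc n)) y) > 0" by blast
  define R where "R = real (Suc n)"
  define I where "I = (LINT y|lebesgue. ?g R y)"
  have R: "R \<ge> 1" and I: "I > 0" using n by (auto simp: R_def I_def)
  have "npot (?g R) x \<ge> R powr (2 - ?N) * I * newton_profile x" for x
  proof -
    have "(LINT y|lebesgue. (norm x + R) powr (2 - ?N) * ?g R y) \<le> npot (?g R) x"
      unfolding npot_def
    proof (rule integral_mono_AE[OF integrable_mult_right[OF gRi] npot_integrable[OF N dens]])
      show "AE y in lebesgue. (norm x + R) powr (2 - ?N) * ?g R y \<le> nker 0 (x - y) * ?g R y"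
        using gRn[of R] AE_lebesgue_neq[of x]
      proof eventually_elim
        case (elim y)
        show ?case
        proof (cases "norm y \<le> R")
          case True
          have "norm (x - y) \<le> norm x + R" using norm_triangle_ineq4[of x y] True by linarith
          then have "(norm x + R) powr (2 - ?N) \<le> nker 0 (x - y)"
            unfolding nker_0_eq using elim N by (intro powr_mono2') auto
          then show ?thesis using elim by (intro mult_right_mono) auto
        qed simp
      qed
    qed
    also have "(LINT y|lebesgue. (norm x + R) powr (2 - ?N) * ?g R y) = (norm x + R) powr (2 - ?N) * I"
      by (simp add: I_def)
    finally have "(norm x + R) powr (2 - ?N) * I \<le> npot (?g R) x" .
    note low = this
    have "R powr (2 - ?N) * newton_profile x \<le> (norm x + R) powr (2 - ?N)"
    proof -
      have "norm x * 1 \<le> norm x * R" using R by (intro mult_left_mono) auto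
      then have "norm x + R \<le> R * (1 + norm x)" by (simp add: algebra_simps)
      moreover have "0 < norm x + R" using R by (simp add: add_nonneg_pos)
      ultimately have "(R * (1 + norm x)) powr (2 - ?N) \<le> (norm x + R) powr (2 - ?N)"
        using N by (intro powr_mono2') auto
      then show ?thesis using R by (simp add: powr_mult newton_profile_def)
    qed
    from mult_right_mono[OF this, of I] I
    have "R powr (2 - ?N) * I * newton_profile x \<le> (norm x + R) powr (2 - ?N) * I" by (simp add: mult_ac)
    with low show ?thesis by linarith
  qed
  moreover have "R powr (2 - ?N) * I > 0" using R I by simp
  ultimately show ?thesis using R by blast
qed

section \<open>The sublinear problem\<close>

lemma locally_holder_onD:
  assumes "locally_holder_on S a g" "compact K" "K \<subseteq> S"
  shows "\<exists>C. \<forall>x\<in>K. \<forall>y\<in>K. \<bar>g x - g y\<bar> \<le> C * dist x y powr a"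
  using assms by (simp add: locally_holder_on_def)

lemma locally_holder_on_bounded:
  assumes g: "locally_holder_on S a g" and "a > 0" and K: "compact K" "K \<subseteq> S"
  shows "\<exists>M\<ge>0. \<forall>x\<in>K. \<bar>g x\<bar> \<le> M"
proof (cases "K = {}")
  case False
  then obtain k where k: "k \<in> K" by blast
  obtain C where "\<forall>x\<in>K. \<forall>y\<in>K. \<bar>g x - g y\<bar> \<le> C * dist x y powr a"
    using locally_holder_onD[OF g, of K] K by blast
  then have C: "\<And>x y. x \<in> K \<Longrightarrow> y \<in> K \<Longrightarrow> \<bar>g x - g y\<bar> \<le> C * dist x y powr a" by simp
  obtain D where D: "\<And>x. x \<in> K \<Longrightarrow> dist k x \<le> D"
    using compact_imp_bounded[OF K(1)] unfolding bounded_any_center[of K k] by blast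
  have "\<bar>g x\<bar> \<le> \<bar>g k\<bar> + \<bar>C\<bar> * \<bar>D\<bar> powr a" if x: "x \<in> K" for x
  proof -
    have "\<bar>g x - g k\<bar> \<le> C * dist x k powr a" by (rule C[OF x k])
    also have "\<dots> \<le> \<bar>C\<bar> * \<bar>D\<bar> powr a"
      using D[OF x] \<open>a > 0\<close> by (intro mult_mono powr_mono2) (auto simp: dist_commute)
    finally show ?thesis by linarith
  qed
  then show ?thesis by (intro exI[of _ "\<bar>g k\<bar> + \<bar>C\<bar> * \<bar>D\<bar> powr a"]) auto
qed auto

text \<open>Distances in a compact set are bounded, so the surplus \<open>a - b\<close> of the
  exponent turns into a constant. This gives \<open>\<rho>\<close> and \<open>f (u x)\<close> a
  common exponent.\<close>

lemma locally_holder_on_weaken: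
  assumes g: "locally_holder_on S a g" and b: "0 < b" "b \<le> a"
  shows "locally_holder_on S b g"
  unfolding locally_holder_on_def
proof (intro allI impI)
  fix K assume K: "compact K \<and> K \<subseteq> S"
  then obtain C where "\<forall>x\<in>K. \<forall>y\<in>K. \<bar>g x - g y\<bar> \<le> C * dist x y powr a"
    using locally_holder_onD[OF g, of K] by blast
  then have C: "\<And>x y. x \<in> K \<Longrightarrow> y \<in> K \<Longrightarrow> \<bar>g x - g y\<bar> \<le> C * dist x y powr a" by simp
  obtain D where D: "\<And>x y. x \<in> K \<Longrightarrow> y \<in> K \<Longrightarrow> dist x y \<le> D"
    using compact_imp_bounded[of K] K unfolding bounded_two_points by blast
  show "\<exists>C. \<forall>x\<in>K. \<forall>y\<in>K. \<bar>g x - g y\<bar> \<le> C * dist x y powr b"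
  proof (intro exI ballI)
    fix x y assume xy: "x \<in> K" "y \<in> K"
    have "dist x y powr a = dist x y powr (a - b) * dist x y powr b"
      by (simp add: powr_add[symmetric])
    also have "\<dots> \<le> D powr (a - b) * dist x y powr b"
      using D[OF xy] b by (intro mult_right_mono powr_mono2) auto
    finally have "\<bar>C\<bar> * dist x y powr a \<le> \<bar>C\<bar> * D powr (a - b) * dist x y powr b"
      by (simp add: mult_left_mono mult.assoc)
    moreover have "C * dist x y powr a \<le> \<bar>C\<bar> * dist x y powr a" by (intro mult_right_mono) auto
    ultimately show "\<bar>g x - g y\<bar> \<le> \<bar>C\<bar> * D powr (a - b) * dist x y powr b" using C[OF xy] by linarith
  qed
qed

lemma locally_holder_on_mult:
  assumes g: "locally_holder_on S a g" and h: "locally_holder_on S a h" and a: "a > 0"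
  shows "locally_holder_on S a (\<lambda>x. g x * h x)"
  unfolding locally_holder_on_def
proof (intro allI impI)
  fix K assume K: "compact K \<and> K \<subseteq> S"
  obtain C where "\<forall>x\<in>K. \<forall>y\<in>K. \<bar>g x - g y\<bar> \<le> C * dist x y powr a"
    using locally_holder_onD[OF g, of K] K by blast
  then have C: "\<And>x y. x \<in> K \<Longrightarrow> y \<in> K \<Longrightarrow> \<bar>g x - g y\<bar> \<le> C * dist x y powr a" by simp
  obtain D where "\<forall>x\<in>K. \<forall>y\<in>K. \<bar>h x - h y\<bar> \<le> D * dist x y powr a"
    using locally_holder_onD[OF h, of K] K by blast
  then have D: "\<And>x y. x \<in> K \<Longrightarrow> y \<in> K \<Longrightarrow> \<bar>h x - h y\<bar> \<le> D * dist x y powr a" by simp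
  obtain M where M: "M \<ge> 0" "\<And>x. x \<in> K \<Longrightarrow> \<bar>g x\<bar> \<le> M"
    using locally_holder_on_bounded[OF g a, of K] K by auto
  obtain L where L: "L \<ge> 0" "\<And>x. x \<in> K \<Longrightarrow> \<bar>h x\<bar> \<le> L"
    using locally_holder_on_bounded[OF h a, of K] K by auto
  show "\<exists>C. \<forall>x\<in>K. \<forall>y\<in>K. \<bar>g x * h x - g y * h y\<bar> \<le> C * dist x y powr a"
  proof (intro exI ballI)
    fix x y assume xy: "x \<in> K" "y \<in> K"
    have "g x * h x - g y * h y = (g x - g y) * h x + g y * (h x - h y)" by (simp add: algebra_simps)
    then have "\<bar>g x * h x - g y * h y\<bar> \<le> \<bar>g x - g y\<bar> * \<bar>h x\<bar> + \<bar>g y\<bar> * \<bar>h x - h y\<bar>"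
      by (metis abs_mult abs_triangle_ineq)
    also have "\<dots> \<le> (C * dist x y powr a) * L + M * (D * dist x y powr a)"
      using C[OF xy] D[OF xy] M L xy by (intro add_mono mult_mono) (auto intro: order_trans[OF abs_ge_zero])
    finally show "\<bar>g x * h x - g y * h y\<bar> \<le> (C * L + M * D) * dist x y powr a" by (simp add: algebra_simps)
  qed
qed

lemma locally_holder_on_continuous:
  assumes g: "locally_holder_on S a g" and a: "a > 0" and S: "open (S :: real set)"
  shows "continuous_on S g"
  unfolding continuous_on_eq_continuous_at[OF S]
proof
  fix x assume x: "x \<in> S"
  have "\<exists>r>0. cball x r \<subseteq> S" using S x by (simp add: open_contains_cball)
  then obtain r where r: "r > 0" "cball x r \<subseteq> S" by blast
  then obtain C where "\<forall>z\<in>cball x r. \<forall>y\<in>cball x r. \<bar>g z - g y\<bar> \<le> C * dist z y powr a"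
    using locally_holder_onD[OF g compact_cball r(2)] by blast
  then have C: "\<And>z y. z \<in> cball x r \<Longrightarrow> y \<in> cball x r \<Longrightarrow> \<bar>g z - g y\<bar> \<le> C * dist z y powr a" by simp
  have "((\<lambda>y. C * dist y x powr a) \<longlongrightarrow> C * dist x x powr a) (at x)"
    using a by (intro tendsto_mult tendsto_const tendsto_powr' tendsto_dist tendsto_ident_at) auto
  then have lim: "((\<lambda>y. C * dist y x powr a) \<longlongrightarrow> 0) (at x)" by simp
  have "\<forall>\<^sub>F y in at x. norm (g y - g x) \<le> C * dist y x powr a"
  proof (rule eventually_mono[OF eventually_at_ball[OF r(1), of x UNIV]])
    show "norm (g y - g x) \<le> C * dist y x powr a" if "y \<in> ball x r \<and> y \<in> UNIV" for y
      using C[of y x] that r(1) by auto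
  qed
  from Lim_null_comparison[OF this lim] show "isCont g x"
    by (simp add: isCont_def LIM_zero_iff)
qed

lemma C_on_1_locally_lipschitz:
  fixes u :: "real^'n::finite \<Rightarrow> real"
  assumes u: "C_on 1 UNIV u"
  shows "\<exists>L\<ge>0. \<forall>x\<in>ball 0 R. \<forall>y\<in>ball 0 R. \<bar>u x - u y\<bar> \<le> L * norm (x - y)"
proof -
  have "\<exists>B\<ge>0. \<forall>x\<in>cball 0 R. \<bar>partial_deriv i u x\<bar> \<le> B" for i
  proof -
    have "compact (partial_deriv i u ` cball 0 R)"
      using u by (intro compact_continuous_image) (auto intro: continuous_on_subset)
    then obtain B where "\<forall>x\<in>cball 0 R. \<bar>partial_deriv i u x\<bar> \<le> B"
      by (auto dest!: compact_imp_bounded simp: bounded_iff)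
    then show ?thesis by (intro exI[of _ "max B 0"]) (auto simp: le_max_iff_disj)
  qed
  then obtain B where B: "\<And>i. B i \<ge> 0" "\<And>i x. x \<in> cball 0 R \<Longrightarrow> \<bar>partial_deriv i u x\<bar> \<le> B i" by metis
  have "\<bar>partial_deriv i u x\<bar> \<le> sum B UNIV" if "x \<in> ball 0 R" for i x
    using B(2)[of x i] that member_le_sum[of i UNIV B] B(1) by force
  then have "\<forall>x\<in>ball 0 R. \<forall>y\<in>ball 0 R. \<bar>u x - u y\<bar> \<le> CARD('n) * sum B UNIV * norm (x - y)"
    using u by (intro ballI lipschitz_partials_bounded[of "ball 0 R"]) auto
  moreover have "CARD('n) * sum B UNIV \<ge> 0" using B by (simp add: sum_nonneg)
  ultimately show ?thesis by blast
qed

text \<open>The image of \<open>K\<close> under \<open>u\<close> is a compact subset of the positive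
  half-line, where \<open>f\<close> has one Hoelder constant. \<open>u\<close> is Lipschitz on a
  ball containing \<open>K\<close>; the ball supplies the convexity used in the Lipschitz
  bound.\<close>

lemma locally_holder_on_compose_C1:
  fixes u :: "real^'n::finite \<Rightarrow> real"
  assumes u: "C_on 1 UNIV u" "\<And>x. u x > 0" and f: "locally_holder_on {0<..} a f" "a > 0"
  shows "locally_holder_on S a (\<lambda>x. f (u x))"
  unfolding locally_holder_on_def
proof (intro allI impI)
  fix K assume K: "compact K \<and> K \<subseteq> S"
  obtain R where R: "K \<subseteq> ball 0 R" using K compact_imp_bounded bounded_subset_ballD[of K 0] by blast
  obtain L where L: "L \<ge> 0" "\<And>x y. x \<in> ball 0 R \<Longrightarrow> y \<in> ball 0 R \<Longrightarrow> \<bar>u x - u y\<bar> \<le> L * norm (x - y)"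
    using C_on_1_locally_lipschitz[OF u(1), of R] by blast
  have "continuous_on UNIV u" using u C_on_1_continuous[of 0 u] by simp
  then have "compact (u ` K)" using K by (intro compact_continuous_image) (auto intro: continuous_on_subset)
  then have "\<exists>C. \<forall>s\<in>u ` K. \<forall>t\<in>u ` K. \<bar>f s - f t\<bar> \<le> C * dist s t powr a"
    using u(2) by (intro locally_holder_onD[OF f(1)]) auto
  then obtain C where C: "\<forall>s\<in>u ` K. \<forall>t\<in>u ` K. \<bar>f s - f t\<bar> \<le> C * dist s t powr a" by blast
  show "\<exists>C. \<forall>x\<in>K. \<forall>y\<in>K. \<bar>f (u x) - f (u y)\<bar> \<le> C * dist x y powr a"
  proof (intro exI ballI)
    fix x y assume xy: "x \<in> K" "y \<in> K"
    have "\<bar>f (u x) - f (u y)\<bar> \<le> C * dist (u x) (u y) powr a" using C xy by blast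
    also have "\<dots> \<le> \<bar>C\<bar> * (L * dist x y) powr a"
      using L xy R f(2) by (intro mult_mono powr_mono2) (auto simp: dist_norm subset_iff)
    also have "\<dots> = \<bar>C\<bar> * L powr a * dist x y powr a" using L by (simp add: powr_mult)
    finally show "\<bar>f (u x) - f (u y)\<bar> \<le> \<bar>C\<bar> * L powr a * dist x y powr a" .
  qed
qed

section \<open>The fixed-point problem and monotone iteration\<close>

locale sublinear_problem =
  fixes \<rho> :: "real^'n::finite \<Rightarrow> real" and f :: "real \<Rightarrow> real" and \<alpha> \<kappa> :: real
  assumes N: "CARD('n) \<ge> 3" and \<kappa>_def: "\<kappa> = newton_const TYPE('n)"
    and dens: "potential_density \<rho>" and nonneg: "AE x in lebesgue. \<rho> x \<ge> 0"
    and nonzero: "\<not> (AE x in lebesgue. \<rho> x = 0)"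
    and decay: "\<exists>C>0. \<forall>x. npot \<rho> x \<le> C * newton_profile x"
    and f_pos: "\<And>t. t > 0 \<Longrightarrow> f t > 0"
    and \<alpha>: "0 < \<alpha>" "\<alpha> < 1" and f_holder: "locally_holder_on {0<..} \<alpha> f"
    and f_sublinear: "strict_antimono_on {0<..} (\<lambda>t. f t / t)"
    and f_at_top: "((\<lambda>t. f t / t) \<longlongrightarrow> 0) at_top"
    and f_mono: "mono_on {0<..} f"
    and f_at_0: "filterlim (\<lambda>t. f t / t) at_top (at_right 0)"
begin

text \<open>Dividing by \<open>\<kappa>\<close> turns the equation into
  \<open>u = npot (source u)\<close> with no constant in front.\<close>

definition source :: "(real^'n \<Rightarrow> real) \<Rightarrow> real^'n \<Rightarrow> real" where
  "source u y = \<rho> y * (f (u y) / \<kappa>)"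

text \<open>As \<open>f\<close> increases, the constant \<open>K\<close> bounds
  \<open>f (u x)\<close> by \<open>f K\<close>, so the source is a potential density; positivity
  keeps the values of \<open>u\<close> where \<open>f\<close> is controlled.\<close>

definition admissible :: "real \<Rightarrow> (real^'n \<Rightarrow> real) \<Rightarrow> bool" where
  "admissible K u \<longleftrightarrow> u \<in> borel_measurable lebesgue \<and> (\<forall>x. 0 < u x \<and> u x \<le> K)"

lemma \<kappa>: "\<kappa> > 0" unfolding \<kappa>_def by (rule newton_const_pos[OF N])

lemma f_le: "0 < s \<Longrightarrow> s \<le> t \<Longrightarrow> f s \<le> f t"
  using f_mono by (auto simp: mono_on_def)

lemma f_isCont: "t > 0 \<Longrightarrow> isCont f t"
  using locally_holder_on_continuous[OF f_holder \<alpha>(1)] by (simp add: continuous_on_eq_continuous_at)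

lemma measurable_f_comp:
  assumes u: "u \<in> borel_measurable lebesgue" "\<And>x::real^'n. u x > 0"
  shows "(\<lambda>x. f (u x)) \<in> borel_measurable lebesgue"
proof -
  \<comment> \<open>Nothing is known about \<open>f\<close> off the positive half-line; setting it
    to 0 there yields a monotone, hence Borel, function.\<close>
  define F where "F t = (if t > 0 then f t else 0)" for t
  have "mono F" using f_le f_pos by (auto simp: mono_def F_def less_imp_le)
  then have "F \<in> borel_measurable borel" by (rule borel_measurable_mono)
  from measurable_compose[OF u(1) this] show ?thesis by (simp add: F_def u(2))
qed

lemma source_density:
  assumes "admissible K u"
  shows "potential_density (source u)"
  unfolding source_def
proof (rule potential_density_mult[OF dens])
  show "(\<lambda>y. f (u y) / \<kappa>) \<in> borel_measurable lebesgue"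
    using assms measurable_f_comp[of u] by (auto simp: admissible_def)
  show "\<bar>f (u x) / \<kappa>\<bar> \<le> f K / \<kappa>" for x
    using assms f_le[of "u x" K] f_pos[of "u x"] \<kappa> by (auto simp: admissible_def divide_right_mono abs_of_pos)
qed

lemma continuous_potential: "potential_density g \<Longrightarrow> continuous_on UNIV (npot (g :: real^'n \<Rightarrow> real))"
  using npot_C1(3)[OF N, of g] C_on_1_continuous[of 0 "npot g"] by simp

lemma measurable_potential: "potential_density g \<Longrightarrow> npot (g :: real^'n \<Rightarrow> real) \<in> borel_measurable lebesgue"
  by (intro borel_imp_lebesgue_measurable borel_measurable_continuous_onI continuous_potential)

lemma potential_source_mono:
  assumes "admissible K u" "admissible K v" "\<And>y. u y \<le> v y"
  shows "npot (source u) x \<le> npot (source v) x"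
proof (rule npot_mono[OF N source_density[OF assms(1)] source_density[OF assms(2)]])
  show "AE y in lebesgue. source u y \<le> source v y"
    using nonneg
  proof eventually_elim
    case (elim y)
    then show ?case
      using assms f_le[of "u y" "v y"] \<kappa> unfolding source_def admissible_def
      by (intro mult_left_mono divide_right_mono) auto
  qed
qed

definition upper_const :: real where
  "upper_const = (SOME C. C > 0 \<and> (\<forall>x. npot \<rho> x \<le> C * newton_profile x))"

lemma upper_const: "upper_const > 0" "npot \<rho> x \<le> upper_const * newton_profile x"
  using someI_ex[OF decay[unfolded Bex_def]] unfolding upper_const_def by auto

lemma potential_source_upper:
  assumes u: "admissible K u"
  shows "npot (source u) x \<le> f K / \<kappa> * upper_const * newton_profile x"
proof -
  have K: "K > 0" using u by (auto simp: admissible_def intro: less_le_trans)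
  have "npot (source u) x \<le> npot (\<lambda>y. f K / \<kappa> * \<rho> y) x"
  proof (rule npot_mono[OF N source_density[OF u]])
    show "potential_density (\<lambda>y. f K / \<kappa> * \<rho> y)"
      by (rule potential_density_cmult[OF dens])
    show "AE y in lebesgue. source u y \<le> f K / \<kappa> * \<rho> y"
      using nonneg
    proof eventually_elim
      case (elim y)
      have "f (u y) / \<kappa> \<le> f K / \<kappa>"
        using u f_le[of "u y" K] \<kappa> by (auto simp: admissible_def intro!: divide_right_mono)
      from mult_left_mono[OF this elim] show ?case by (simp add: source_def mult.commute)
    qed
  qed
  also have "\<dots> = f K / \<kappa> * npot \<rho> x" by (rule npot_cmult)
  also have "\<dots> \<le> f K / \<kappa> * (upper_const * newton_profile x)"
    using f_pos[OF K] \<kappa> by (intro mult_left_mono upper_const) auto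
  finally show ?thesis by (simp add: mult.assoc)
qed

text \<open>\<open>R\<close> and \<open>c\<close> come from \<open>\<rho>\<close> alone. This
  uniformity in \<open>u\<close> lets one lower barrier survive every step of the iteration.\<close>

lemma potential_source_lower:
  obtains R c where "R \<ge> 1" "c > 0"
    "\<And>K u b x. admissible K u \<Longrightarrow> b > 0 \<Longrightarrow> (\<And>y. norm y \<le> R \<Longrightarrow> b \<le> u y) \<Longrightarrow>
      f b / \<kappa> * (c * newton_profile x) \<le> npot (source u) x"
proof -
  obtain R c where R: "R \<ge> 1" and c: "c > 0" and
    low: "\<And>x. npot (\<lambda>y. \<rho> y * indicator (cball 0 R) y) x \<ge> c * newton_profile x"
    using potential_lower_bound[OF N dens nonneg nonzero] by blast
  have densR: "potential_density (\<lambda>y. \<rho> y * indicator (cball 0 R) y)"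
    by (rule potential_density_ball[OF dens])
  have "f b / \<kappa> * (c * newton_profile x) \<le> npot (source u) x"
    if u: "admissible K u" and b: "b > 0" "\<And>y. norm y \<le> R \<Longrightarrow> b \<le> u y" for K u b x
  proof -
    have fb: "f b / \<kappa> > 0" using f_pos[OF b(1)] \<kappa> by simp
    have "f b / \<kappa> * (c * newton_profile x) \<le> f b / \<kappa> * npot (\<lambda>y. \<rho> y * indicator (cball 0 R) y) x"
      using fb by (intro mult_left_mono low) auto
    also have "\<dots> = npot (\<lambda>y. f b / \<kappa> * (\<rho> y * indicator (cball 0 R) y)) x" by (rule npot_cmult[symmetric])
    also have "\<dots> \<le> npot (source u) x"
    proof (rule npot_mono[OF N _ source_density[OF u]])
      show "potential_density (\<lambda>y. f b / \<kappa> * (\<rho> y * indicator (cball 0 R) y))"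
        by (rule potential_density_cmult[OF densR])
      show "AE y in lebesgue. f b / \<kappa> * (\<rho> y * indicator (cball 0 R) y) \<le> source u y"
        using nonneg
      proof eventually_elim
        case (elim y)
        show ?case
        proof (cases "norm y \<le> R")
          case True
          have "f b / \<kappa> \<le> f (u y) / \<kappa>"
            using f_le[of b "u y"] b True \<kappa> by (intro divide_right_mono) auto
          from mult_left_mono[OF this elim] True show ?thesis by (simp add: source_def mult.commute)
        next
          case False
          have "0 \<le> f (u y) / \<kappa>" using u f_pos[of "u y"] \<kappa> by (auto simp: admissible_def less_imp_le)
          from mult_nonneg_nonneg[OF elim this] False show ?thesis by (simp add: source_def)
        qed
      qed
    qed
    finally show ?thesis .
  qed
  with that R c show ?thesis by blast
qed

text \<open>The iterates decrease from a constant and stay above a barrier, so they converge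
  pointwise to a positive function; the bound \<open>f K\<close> on the nonlinearity lets the
  potential pass to the limit by dominated convergence.\<close>

lemma fixed_point_exists: "\<exists>K u. admissible K u \<and> u = npot (source u)"
proof -
  obtain R c where R: "R \<ge> 1" and c: "c > 0" and low: "\<And>K u b x. admissible K u \<Longrightarrow> b > 0 \<Longrightarrow>
      (\<And>y. norm y \<le> R \<Longrightarrow> b \<le> u y) \<Longrightarrow> f b / \<kappa> * (c * newton_profile x) \<le> npot (source u) x"
    using potential_source_lower by blast
  have prof: "0 < newton_profile x" "newton_profile x \<le> 1" for x :: "real^'n"
    using newton_profile_pos newton_profile_le_1[OF N] by auto
  \<comment> \<open>This makes \<open>K\<close> a supersolution: the potential is at most
    \<open>f K / \<kappa> * upper_const\<close>, since the profile is at most 1.\<close>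
  have "\<forall>\<^sub>F t in at_top. f t / t < \<kappa> / upper_const"
    using f_at_top \<kappa> upper_const(1) by (intro order_tendstoD(2)) auto
  then have "\<forall>\<^sub>F t in at_top. f t / t < \<kappa> / upper_const \<and> t > 0"
    using eventually_gt_at_top by (rule eventually_conj)
  then obtain K where K: "f K / K < \<kappa> / upper_const" "K > 0"
    using eventually_happens trivial_limit_at_top_linorder by blast
  have fK: "f K / \<kappa> * upper_const \<le> K"
    using K \<kappa> upper_const(1) by (simp add: field_simps less_imp_le)
  \<comment> \<open>The value of the profile at radius \<open>R\<close>, hence its smallest value on
    the ball.\<close>
  define b where "b = (1 + R) powr (2 - real CARD('n))"
  have b: "b > 0" using R by (simp add: b_def)
  have b_le: "b \<le> newton_profile y" if "norm y \<le> R" for y :: "real^'n"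
    unfolding b_def newton_profile_def using that N by (intro powr_mono2') (auto simp: add_pos_nonneg)
  \<comment> \<open>Here \<open>t = \<epsilon> * b\<close> will be the barrier at radius
    \<open>R\<close>. The growth of \<open>f t / t\<close> at 0 gives
    \<open>\<epsilon> \<le> f t / \<kappa> * c\<close>, so the next iterate again lies above the
    barrier.\<close>
  have "\<forall>\<^sub>F t in at_right 0. \<kappa> / (c * b) \<le> f t / t"
    using f_at_0 by (simp add: filterlim_at_top)
  \<comment> \<open>\<open>t < K * b\<close> yields \<open>\<epsilon> \<le> K\<close>, so the
    iteration starts above the barrier.\<close>
  moreover have "\<forall>\<^sub>F t in at_right 0. t \<in> {0<..<K * b}"
    using K b by (intro eventually_at_right_real) simp
  ultimately have "\<forall>\<^sub>F t in at_right 0. \<kappa> / (c * b) \<le> f t / t \<and> t \<in> {0<..<K * b}"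
    by (rule eventually_conj)
  then obtain t where t: "\<kappa> / (c * b) \<le> f t / t" "0 < t" "t < K * b"
    using eventually_happens[of _ "at_right (0::real)"] trivial_limit_at_right_real by fastforce
  define \<epsilon> where "\<epsilon> = t / b"
  have \<epsilon>: "\<epsilon> > 0" "\<epsilon> \<le> K" using t b by (auto simp: \<epsilon>_def field_simps)
  have \<epsilon>f: "\<epsilon> \<le> f t / \<kappa> * c" using t b c \<kappa> by (simp add: \<epsilon>_def field_simps)
  define U where "U n = ((\<lambda>u. npot (source u)) ^^ n) (\<lambda>_. K)" for n
  have U0: "U 0 = (\<lambda>_. K)" and US: "U (Suc n) = npot (source (U n))" for n by (auto simp: U_def)
  have inv: "admissible K (U n) \<and> (\<forall>x. \<epsilon> * newton_profile x \<le> U n x)" for n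
  proof (induction n)
    case 0
    have "\<epsilon> * newton_profile x \<le> K * 1" for x :: "real^'n"
      using \<epsilon> prof[of x] K by (intro mult_mono) auto
    then show ?case using K by (simp add: U0 admissible_def)
  next
    case (Suc n)
    have "\<epsilon> * newton_profile x \<le> U (Suc n) x" for x
    proof -
      have "t \<le> U n y" if "norm y \<le> R" for y
      proof -
        have "t = \<epsilon> * b" using b by (simp add: \<epsilon>_def)
        also have "\<dots> \<le> \<epsilon> * newton_profile y" using \<epsilon> b_le[OF that] by (intro mult_left_mono) auto
        finally show ?thesis using Suc by (meson order_trans)
      qed
      then have "f t / \<kappa> * (c * newton_profile x) \<le> U (Suc n) x"
        unfolding US using Suc t by (intro low) auto
      moreover have "\<epsilon> * newton_profile x \<le> f t / \<kappa> * c * newton_profile x"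
        using \<epsilon>f prof[of x] by (intro mult_right_mono) auto
      ultimately show ?thesis by (simp add: mult.assoc)
    qed
    moreover have "U (Suc n) x \<le> K" for x
    proof -
      have "U (Suc n) x \<le> f K / \<kappa> * upper_const * newton_profile x"
        unfolding US using Suc by (intro potential_source_upper) auto
      also have "\<dots> \<le> K * 1" using fK prof[of x] K by (intro mult_mono) auto
      finally show ?thesis by simp
    qed
    moreover have "U (Suc n) x > 0" for x
      using calculation(1)[of x] mult_pos_pos[OF \<epsilon>(1) prof(1)[of x]] by linarith
    moreover have "U (Suc n) \<in> borel_measurable lebesgue"
      unfolding US using Suc by (intro measurable_potential source_density) auto
    ultimately show ?case by (simp add: admissible_def)
  qed
  have dec: "U (Suc n) x \<le> U n x" for n x
  proof (induction n arbitrary: x)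
    case 0
    show ?case using inv[of 1] by (simp add: U0 admissible_def)
  next
    case (Suc n)
    show ?case unfolding US[of "Suc n"] US[of n]
      using inv[of "Suc n"] inv[of n] Suc unfolding US[of n] by (intro potential_source_mono[of K]) auto
  qed
  have "\<exists>l. (\<lambda>n. U n x) \<longlonglongrightarrow> l" for x
  proof -
    have "decseq (\<lambda>n. U n x)" using dec by (simp add: decseq_Suc_iff)
    then obtain l where "(\<lambda>n. U n x) \<longlonglongrightarrow> l"
      by (rule decseq_convergent[of _ 0]) (use inv in \<open>auto simp: admissible_def less_imp_le\<close>)
    then show ?thesis ..
  qed
  then obtain u where u: "\<And>x. (\<lambda>n. U n x) \<longlonglongrightarrow> u x" by metis
  have u_low: "\<epsilon> * newton_profile x \<le> u x" for x
    using inv by (intro LIMSEQ_le_const[OF u]) auto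
  have u_up: "u x \<le> K" for x
    using inv by (intro LIMSEQ_le_const2[OF u]) (auto simp: admissible_def)
  have u_pos: "u x > 0" for x using u_low[of x] mult_pos_pos[OF \<epsilon>(1) prof(1)[of x]] by linarith
  have um: "u \<in> borel_measurable lebesgue"
    by (rule borel_measurable_LIMSEQ_real[OF u]) (use inv in \<open>auto simp: admissible_def\<close>)
  have adm: "admissible K u" using um u_pos u_up by (simp add: admissible_def)
  have "(\<lambda>n. npot (source (U n)) x) \<longlonglongrightarrow> npot (source u) x" for x
    unfolding npot_def
  \<comment> \<open>The absolute value appears because \<open>\<rho>\<close> is nonnegative only
    almost everywhere.\<close>
  proof (rule integral_dominated_convergence[where w = "\<lambda>y. nker 0 (x - y) * (\<bar>\<rho> y\<bar> * (f K / \<kappa>))"])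
    have "potential_density (\<lambda>y. \<bar>\<rho> y\<bar> * (f K / \<kappa>))"
      using potential_density_mult[of "\<lambda>y. \<bar>\<rho> y\<bar>" "\<lambda>_. f K / \<kappa>" "\<bar>f K / \<kappa>\<bar>"] dens
      by (simp add: potential_density_def integrable_abs)
    then show "integrable lebesgue (\<lambda>y. nker 0 (x - y) * (\<bar>\<rho> y\<bar> * (f K / \<kappa>)))"
      by (rule npot_integrable[OF N])
    show "AE y in lebesgue. (\<lambda>n. nker 0 (x - y) * source (U n) y) \<longlonglongrightarrow> nker 0 (x - y) * source u y"
      unfolding source_def
      using f_isCont[OF u_pos] \<kappa> by (intro AE_I2 tendsto_intros isCont_tendsto_compose[of _ f] u) auto
    show "AE y in lebesgue. norm (nker 0 (x - y) * source (U n) y) \<le> nker 0 (x - y) * (\<bar>\<rho> y\<bar> * (f K / \<kappa>))" for n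
    proof (intro AE_I2)
      fix y
      have "0 < U n y" "U n y \<le> K" using inv by (auto simp: admissible_def)
      then have "\<bar>f (U n y) / \<kappa>\<bar> \<le> f K / \<kappa>"
        using f_le[of "U n y" K] f_pos[of "U n y"] \<kappa> by (simp add: divide_right_mono)
      then show "norm (nker 0 (x - y) * source (U n) y) \<le> nker 0 (x - y) * (\<bar>\<rho> y\<bar> * (f K / \<kappa>))"
        unfolding source_def real_norm_def abs_mult[of "nker _ _"] abs_mult[of "\<rho> _"]
        by (intro mult_mono) (auto simp: nker_def)
    qed
    show "(\<lambda>y. nker 0 (x - y) * source u y) \<in> borel_measurable lebesgue"
      by (rule borel_measurable_integrable[OF npot_integrable[OF N source_density[OF adm]]])
    show "(\<lambda>y. nker 0 (x - y) * source (U n) y) \<in> borel_measurable lebesgue" for n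
      using inv by (intro borel_measurable_integrable[OF npot_integrable[OF N source_density]]) auto
  qed
  then have "(\<lambda>n. U (Suc n) x) \<longlonglongrightarrow> npot (source u) x" for x by (simp add: US)
  then have "u x = npot (source u) x" for x
    using LIMSEQ_unique[OF LIMSEQ_Suc[OF u[of x]]] by blast
  then have "u = npot (source u)" by auto
  with adm show ?thesis by blast
qed

end

section \<open>Solutions as fixed points, and uniqueness\<close>

context sublinear_problem
begin

lemma integral_source:
  "(LINT x|lebesgue. source u x * \<phi> x) * \<kappa> = (LINT x|lebesgue. \<rho> x * f (u x) * \<phi> x)"
proof -
  have "(LINT x|lebesgue. source u x * \<phi> x) * \<kappa> = (LINT x|lebesgue. source u x * \<phi> x * \<kappa>)" by simp
  also have "\<dots> = (LINT x|lebesgue. \<rho> x * f (u x) * \<phi> x)"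
    using \<kappa> by (intro Bochner_Integration.integral_cong) (auto simp: source_def)
  finally show ?thesis .
qed

lemma potential_source_nonneg:
  assumes u: "admissible K u"
  shows "0 \<le> npot (source u) x"
  unfolding npot_def
proof (rule integral_nonneg_AE)
  show "AE y in lebesgue. 0 \<le> nker 0 (x - y) * source u y"
    using nonneg
  proof eventually_elim
    case (elim y)
    have "u y > 0" using u by (simp add: admissible_def)
    from f_pos[OF this] elim \<kappa> show ?case by (simp add: source_def nker_def)
  qed
qed

lemma potential_source_tendsto_0:
  assumes u: "admissible K u"
  shows "(npot (source u) \<longlongrightarrow> 0) at_infinity"
proof -
  have "((\<lambda>x::real^'n. f K / \<kappa> * upper_const * newton_profile x) \<longlongrightarrow> f K / \<kappa> * upper_const * 0) at_infinity"
    by (intro tendsto_mult tendsto_const newton_profile_tendsto_0[OF N])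
  then have lim: "((\<lambda>x::real^'n. f K / \<kappa> * upper_const * newton_profile x) \<longlongrightarrow> 0) at_infinity" by simp
  show ?thesis
    by (rule tendsto_sandwich[OF _ _ tendsto_const lim])
       (intro always_eventually allI potential_source_nonneg[OF u] potential_source_upper[OF u])+
qed

text \<open>One bootstrap: as a potential \<open>u\<close> is C1, so \<open>f (u x)\<close> is
  Hoelder continuous with exponent \<open>\<alpha>\<close>. Where \<open>\<rho>\<close> has exponent
  \<open>\<beta>\<close>, the source has exponent \<open>min \<alpha> \<beta>\<close>, and there the
  potential is C2 and solves the equation pointwise.\<close>

lemma fixed_point_solution:
  assumes u: "admissible K u" and fp: "u = npot (source u)"
  shows "classical_solution \<rho> f u" "(u \<longlongrightarrow> 0) at_infinity"
proof -
  have pos: "u x > 0" for x using u by (simp add: admissible_def)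
  note sd = source_density[OF u]
  have C1: "C_on 1 UNIV u" using npot_C1(3)[OF N sd] fp by simp
  show "classical_solution \<rho> f u"
    unfolding classical_solution_def
  proof (intro conjI allI impI C1)
    show "distributional_solution \<rho> f u"
      unfolding distributional_solution_def
    proof (intro allI impI)
      fix \<phi> :: "real^'n \<Rightarrow> real" assume "test_function \<phi>"
      from npot_distributional[OF N sd this] fp
      have "(LINT x|lebesgue. u x * laplacian \<phi> x) = - \<kappa> * (LINT x|lebesgue. source u x * \<phi> x)"
        by (simp add: \<kappa>_def)
      then show "- (LINT x|lebesgue. u x * laplacian \<phi> x) = (LINT x|lebesgue. \<rho> x * f (u x) * \<phi> x)"
        unfolding integral_source[symmetric] by simp
    qed
  next
    fix U \<beta> assume U: "open U \<and> 0 < \<beta> \<and> \<beta> < 1 \<and> locally_holder_on U \<beta> \<rho>"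
    define \<gamma> where "\<gamma> = min \<alpha> \<beta>"
    have \<gamma>: "0 < \<gamma>" "\<gamma> < 1" "\<gamma> \<le> \<alpha>" "\<gamma> \<le> \<beta>" using U \<alpha> by (auto simp: \<gamma>_def)
    have "locally_holder_on U \<gamma> (\<lambda>x. f (u x))"
      using locally_holder_on_weaken[OF locally_holder_on_compose_C1[OF C1 pos f_holder \<alpha>(1)] \<gamma>(1,3)] .
    moreover have "locally_holder_on U \<gamma> (\<lambda>x. 1 / \<kappa>)"
      unfolding locally_holder_on_def by (auto intro!: exI[of _ 0])
    ultimately have fu: "locally_holder_on U \<gamma> (\<lambda>x. f (u x) * (1 / \<kappa>))"
      by (rule locally_holder_on_mult[OF _ _ \<gamma>(1)])
    have "locally_holder_on U \<gamma> \<rho>"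
      using U locally_holder_on_weaken[OF _ \<gamma>(1,4)] by blast
    from locally_holder_on_mult[OF this fu \<gamma>(1)]
    have "locally_holder_on U \<gamma> (\<lambda>x. \<rho> x * (f (u x) * (1 / \<kappa>)))" .
    then have hol: "locally_holder_on U \<gamma> (source u)" by (simp add: source_def[abs_def])
    have op: "open U" using U by simp
    have "laplacian u x = - \<kappa> * source u x" if "x \<in> U" for x
      using npot_C2(2)[OF N sd \<gamma>(1,2) op hol that] fp by (simp add: \<kappa>_def)
    moreover have "C_on 2 U u" using npot_C2(1)[OF N sd \<gamma>(1,2) op hol] fp by simp
    ultimately show "C2_solution_on U \<rho> f u"
      using \<kappa> by (auto simp: C2_solution_on_def source_def)
  qed
  show "(u \<longlongrightarrow> 0) at_infinity"
    using potential_source_tendsto_0[OF u] fp by simp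
qed

text \<open>Continuity and decay make \<open>u\<close> bounded, hence admissible, so the potential
  of its source exists. Both functions have the same distributional Laplacian and vanish at
  infinity.\<close>

lemma solution_fixed_point:
  assumes sol: "classical_solution \<rho> f u" and pos: "\<And>x. u x > 0" and lim: "(u \<longlongrightarrow> 0) at_infinity"
  shows "u = npot (source u)" "\<exists>K. admissible K u"
proof -
  have uc: "continuous_on UNIV u"
    using sol C_on_1_continuous[of 0 u] by (simp add: classical_solution_def)
  obtain B where "\<And>x. \<bar>u x\<bar> \<le> B" using vanishing_continuous_bounded[OF uc lim] by blast
  then have "u x \<le> B" for x using abs_le_D1 by blast
  then have adm: "admissible B u"
    using pos borel_imp_lebesgue_measurable[OF borel_measurable_continuous_onI[OF uc]] by (simp add: admissible_def)
  then show "\<exists>K. admissible K u" ..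
  note sd = source_density[OF adm]
  let ?v = "npot (source u)"
  have vc: "continuous_on UNIV ?v" by (rule continuous_potential[OF sd])
  have v0: "(?v \<longlongrightarrow> 0) at_infinity" by (rule potential_source_tendsto_0[OF adm])
  have "u x - ?v x = 0" for x
  proof (rule weakly_harmonic_vanishing_eq_0)
    show "continuous_on UNIV (\<lambda>x. u x - ?v x)" by (intro continuous_intros uc vc)
    show "((\<lambda>x. u x - ?v x) \<longlongrightarrow> 0) at_infinity" using tendsto_diff[OF lim v0] by simp
    fix \<phi> :: "real^'n \<Rightarrow> real" assume \<phi>: "test_function \<phi>"
    obtain R where R: "\<And>x. norm x > R \<Longrightarrow> laplacian \<phi> x = 0" using test_functionD(5)[OF \<phi>] by blast
    have int: "integrable lebesgue (\<lambda>x. w x * laplacian \<phi> x)" if "continuous_on UNIV w" for w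
      by (rule integrable_continuous_support[of _ R]) (auto intro!: continuous_intros that test_functionD(4)[OF \<phi>] simp: R)
    have "(LINT x|lebesgue. (u x - ?v x) * laplacian \<phi> x) =
        (LINT x|lebesgue. u x * laplacian \<phi> x) - (LINT x|lebesgue. ?v x * laplacian \<phi> x)"
      unfolding left_diff_distrib by (rule Bochner_Integration.integral_diff[OF int[OF uc] int[OF vc]])
    also have "(LINT x|lebesgue. u x * laplacian \<phi> x) = - (LINT x|lebesgue. \<rho> x * f (u x) * \<phi> x)"
      using sol \<phi> unfolding classical_solution_def distributional_solution_def
      by (metis (no_types, lifting) minus_minus)
    also have "(LINT x|lebesgue. ?v x * laplacian \<phi> x) = - (LINT x|lebesgue. \<rho> x * f (u x) * \<phi> x)"
      unfolding npot_distributional[OF N sd \<phi>] integral_source[symmetric] by (simp add: \<kappa>_def)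
    finally show "(LINT x|lebesgue. (u x - ?v x) * laplacian \<phi> x) = 0" by simp
  qed
  then show "u = ?v" by (auto simp: fun_eq_iff)
qed

text \<open>On the ball from \<open>potential_source_lower\<close> the continuous positive
  \<open>u\<close> has a positive minimum; feeding it through the equation once bounds
  \<open>u\<close> from below on the whole space.\<close>

lemma fixed_point_lower:
  assumes u: "admissible K u" and fp: "u = npot (source u)"
  shows "\<exists>c>0. \<forall>x. c * newton_profile x \<le> u x"
proof -
  obtain R c where R: "R \<ge> 1" and c: "c > 0" and low: "\<And>K u b x. admissible K u \<Longrightarrow> b > 0 \<Longrightarrow>
      (\<And>y. norm y \<le> R \<Longrightarrow> b \<le> u y) \<Longrightarrow> f b / \<kappa> * (c * newton_profile x) \<le> npot (source u) x"
    using potential_source_lower by blast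
  have "continuous_on UNIV u" using continuous_potential[OF source_density[OF u]] fp by simp
  then have "continuous_on (cball 0 R) u" by (rule continuous_on_subset) simp
  then have "\<exists>z\<in>cball 0 R. \<forall>y\<in>cball 0 R. u z \<le> u y"
    using R by (intro continuous_attains_inf) auto
  then obtain z where "\<forall>y\<in>cball 0 R. u z \<le> u y" by blast
  then have z: "\<And>y. norm y \<le> R \<Longrightarrow> u z \<le> u y" by simp
  have "u z > 0" using u by (simp add: admissible_def)
  then have "f (u z) / \<kappa> * (c * newton_profile x) \<le> u x" for x
    using low[OF u _ z, of x] fp by simp
  moreover have "f (u z) / \<kappa> * c > 0" using f_pos[OF \<open>u z > 0\<close>] \<kappa> c by simp
  ultimately show ?thesis by (intro exI[of _ "f (u z) / \<kappa> * c"]) (simp add: mult.assoc)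
qed

text \<open>The largest \<open>\<lambda>\<close> with \<open>\<lambda> v \<le> u\<close> is at least \<open>1\<close>: otherwise \<open>f (\<lambda> v) > \<lambda> f v\<close>, and the potential of
  the excess \<open>\<rho> (f (\<lambda> v) - \<lambda> f v)\<close> dominates a multiple of \<open>(1 + |x|)\<^bsup>2-N\<^esup>\<close>, hence of \<open>v\<close>.\<close>

lemma fixed_point_le:
  assumes u: "admissible K u" "u = npot (source u)" and v: "admissible L v" "v = npot (source v)"
  shows "v x \<le> u x"
proof -
  obtain c where c: "c > 0" "\<And>x. c * newton_profile x \<le> u x" using fixed_point_lower[OF u] by blast
  have vpos: "v x > 0" for x using v(1) by (simp add: admissible_def)
  have Lpos: "L > 0" using v(1) by (auto simp: admissible_def intro: less_le_trans)
  define C where "C = f L / \<kappa> * upper_const"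
  have C: "C > 0" using f_pos[OF Lpos] \<kappa> upper_const(1) by (simp add: C_def)
  have vC: "v x \<le> C * newton_profile x" for x
    using potential_source_upper[OF v(1), of x] v(2) by (simp add: C_def)
  define T where "T = {t. 0 \<le> t \<and> t \<le> 1 \<and> (\<forall>x. t * v x \<le> u x)}"
  \<comment> \<open>As \<open>v\<close> is at most \<open>C * newton_profile\<close>, a surplus
    \<open>d * newton_profile\<close> over \<open>t * v\<close> raises the factor by
    \<open>d / C\<close>. This yields both a first positive element of \<open>T\<close> and the
    contradiction to maximality.\<close>
  have gain: "min 1 (t + d / C) \<in> T" if "t \<ge> 0" "d > 0" "\<And>x. t * v x + d * newton_profile x \<le> u x" for t d
  proof -
    have "min 1 (t + d / C) * v x \<le> u x" for x
    proof -
      have "min 1 (t + d / C) * v x \<le> (t + d / C) * v x"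
        using vpos[of x] by (intro mult_right_mono) auto
      also have "\<dots> = t * v x + d / C * v x" by (simp add: algebra_simps)
      also have "d / C * v x \<le> d / C * (C * newton_profile x)"
        using that C vC[of x] by (intro mult_left_mono) auto
      also have "\<dots> = d * newton_profile x" using C by simp
      finally show ?thesis using that(3)[of x] by simp
    qed
    moreover have "0 \<le> min 1 (t + d / C)" using that C by simp
    ultimately show ?thesis by (simp add: T_def)
  qed
  have t0: "min 1 (0 + c / C) \<in> T" using c by (intro gain) auto
  then have Tne: "T \<noteq> {}" by blast
  have bdd: "bdd_above T" by (auto simp: T_def bdd_above_def)
  define \<mu> where "\<mu> = Sup T"
  have \<mu>_up: "t \<le> \<mu>" if "t \<in> T" for t unfolding \<mu>_def by (rule cSup_upper[OF that bdd])
  have "0 < min 1 (0 + c / C)" using c C by simp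
  from less_le_trans[OF this \<mu>_up[OF t0]] have \<mu>_pos: "\<mu> > 0" .
  have \<mu>_le: "\<mu> \<le> 1" unfolding \<mu>_def using Tne by (intro cSup_least) (auto simp: T_def)
  have \<mu>_T: "\<mu> * v x \<le> u x" for x
  proof -
    have "\<mu> \<le> u x / v x"
      unfolding \<mu>_def using Tne vpos[of x] by (intro cSup_least) (auto simp: T_def pos_le_divide_eq)
    then show ?thesis using vpos[of x] by (simp add: pos_le_divide_eq)
  qed
  have "\<mu> \<ge> 1"
  proof (rule ccontr)
    assume "\<not> ?thesis"
    then have \<mu>1: "\<mu> < 1" by simp
    define w where "w x = \<mu> * v x" for x
    have w: "admissible L w"
    proof -
      have "w x \<le> 1 * L" for x
        unfolding w_def using \<mu>_le \<mu>_pos v(1) vpos[of x] by (intro mult_mono) (auto simp: admissible_def less_imp_le)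
      moreover have "w \<in> borel_measurable lebesgue"
        unfolding w_def using v(1) by (intro borel_measurable_times) (auto simp: admissible_def)
      ultimately show ?thesis using \<mu>_pos vpos by (simp add: admissible_def w_def)
    qed
    \<comment> \<open>\<open>w\<close> is admissible for \<open>L\<close> since
      \<open>\<mu> \<le> 1\<close>, and for \<open>K\<close> since it lies below \<open>u\<close>;
      the second form is the one that allows its source to be compared with that of
      \<open>u\<close>.\<close>
    have wK: "admissible K w"
      using w \<mu>_T u(1) unfolding admissible_def w_def by (meson order_trans)
    \<comment> \<open>Positive at every point by strict antitonicity of \<open>f t / t\<close>, as
      \<open>w y < v y\<close>; so \<open>d\<close> vanishes exactly where \<open>\<rho>\<close>
      does and inherits its nontriviality.\<close>
    define e where "e y = f (w y) - \<mu> * f (v y)" for y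
    have e: "e y > 0" for y
    proof -
      have wv: "0 < w y" "w y < v y" using \<mu>_pos \<mu>1 vpos[of y] by (simp_all add: w_def)
      then have "f (v y) / v y < f (w y) / w y"
        using f_sublinear vpos[of y] by (auto simp: monotone_on_def)
      then have "\<mu> * f (v y) < f (w y)" using wv vpos[of y] \<mu>_pos by (simp add: w_def field_simps)
      then show ?thesis by (simp add: e_def)
    qed
    define d where "d y = \<rho> y * (e y / \<kappa>)" for y
    have d_eq: "source w y = \<mu> * source v y + d y" for y
      using \<kappa> by (simp add: source_def d_def e_def field_simps)
    have dv: "potential_density (\<lambda>y. \<mu> * source v y)"
      by (rule potential_density_cmult[OF source_density[OF v(1)]])
    have dd: "potential_density d"
      unfolding d_def
    proof (rule potential_density_mult[OF dens])
      show "(\<lambda>y. e y / \<kappa>) \<in> borel_measurable lebesgue"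
        using w v(1) measurable_f_comp[of w] measurable_f_comp[of v] by (simp add: admissible_def e_def[abs_def])
      have "e y \<le> f L" for y
      proof -
        have "f (w y) \<le> f L" using w f_le[of "w y" L] by (simp add: admissible_def)
        moreover have "0 < \<mu> * f (v y)" using f_pos[OF vpos[of y]] \<mu>_pos by simp
        ultimately show ?thesis unfolding e_def by linarith
      qed
      then show "\<bar>e y / \<kappa>\<bar> \<le> f L / \<kappa>" for y
        using e[of y] \<kappa> by (simp add: divide_right_mono)
    qed
    have "AE y in lebesgue. d y \<ge> 0"
      using nonneg
    proof eventually_elim
      case (elim y)
      then show ?case using e[of y] \<kappa> by (simp add: d_def)
    qed
    moreover have "\<not> (AE y in lebesgue. d y = 0)"
    proof
      assume "AE y in lebesgue. d y = 0"
      then have "AE y in lebesgue. \<rho> y = 0"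
      proof eventually_elim
        case (elim y)
        then show ?case using e[of y] \<kappa> by (simp add: d_def)
      qed
      with nonzero show False by simp
    qed
    ultimately obtain R c' where c': "c' > 0" and
      low: "\<And>x. c' * newton_profile x \<le> npot (\<lambda>y. d y * indicator (cball 0 R) y) x"
      using potential_lower_bound[OF N dd] by blast
    have dR: "potential_density (\<lambda>y. d y * indicator (cball 0 R) y)"
      by (rule potential_density_ball[OF dd])
    have "\<mu> * v x + c' * newton_profile x \<le> u x" for x
    proof -
      have "npot (\<lambda>y. d y * indicator (cball 0 R) y) x \<le> npot d x"
        using \<open>AE y in lebesgue. d y \<ge> 0\<close>
        by (intro npot_mono[OF N dR dd]) (auto elim!: eventually_mono simp: indicator_def)
      then have "\<mu> * v x + c' * newton_profile x \<le> \<mu> * npot (source v) x + npot d x"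
        using low[of x] fun_cong[OF v(2), of x] by simp
      also have "\<dots> = npot (source w) x"
        unfolding d_eq[abs_def] npot_add[OF N dv dd] npot_cmult ..
      also have "\<dots> \<le> npot (source u) x"
        using \<mu>_T by (intro potential_source_mono[OF wK u(1)]) (simp add: w_def)
      finally show ?thesis using fun_cong[OF u(2), of x] by simp
    qed
    then have "min 1 (\<mu> + c' / C) \<in> T" using \<mu>_pos c' by (intro gain) auto
    from \<mu>_up[OF this] \<mu>1 divide_pos_pos[OF c' C] show False
      unfolding min_le_iff_disj by linarith
  qed
  with \<mu>_le \<mu>_T[of x] show ?thesis by simp
qed

end

section \<open>Existence and uniqueness from the original hypotheses\<close>

theorem theorem2:
  fixes \<rho> :: "real^'n::finite \<Rightarrow> real" and f :: "real \<Rightarrow> real" and \<alpha> :: real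
  assumes "CARD('n) \<ge> 3"
    and "Linf_loc \<rho>"
    and "AE x in lebesgue. \<rho> x \<ge> 0"
    and "\<not> (AE x in lebesgue. \<rho> x = 0)"
    and "sphere_max \<rho> \<in> borel_measurable lebesgue"
    and "(\<integral>\<^sup>+r\<in>{0<..}. ennreal (r ^ (CARD('n) - 1)) * sphere_max \<rho> r \<partial>lebesgue) < \<infinity>"
    and "\<And>t. t > 0 \<Longrightarrow> f t > 0"
    and "0 < \<alpha>" and "\<alpha> < 1" and "locally_holder_on {0<..} \<alpha> f"
    and "strict_antimono_on {0<..} (\<lambda>t. f t / t)"
    and "((\<lambda>t. f t / t) \<longlongrightarrow> 0) at_top"
    and "mono_on {0<..} f"
    and "filterlim (\<lambda>t. f t / t) at_top (at_right 0)"
  shows "\<exists>!u :: real^'n \<Rightarrow> real.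
    classical_solution \<rho> f u \<and> (\<forall>x. u x > 0) \<and> (u \<longlongrightarrow> 0) at_infinity"
proof -
  interpret sublinear_problem \<rho> f \<alpha> "newton_const TYPE('n)"
  proof
    \<comment> \<open>The integral condition on the spherical maxima enters here, turned into
      integrability of \<open>\<rho>\<close> and decay of its potential.\<close>
    show "potential_density \<rho>" "\<exists>C>0. \<forall>x. npot \<rho> x \<le> C * newton_profile x"
      using newtonian_potential_decay[OF assms(1-3,5,6)] by auto
  qed (fact assms refl)+
  show ?thesis
  proof (rule ex_ex1I)
    obtain K u where u: "admissible K u" "u = npot (source u)" using fixed_point_exists by blast
    then have "\<forall>x. u x > 0" by (simp add: admissible_def)
    with fixed_point_solution[OF u]
    show "\<exists>u. classical_solution \<rho> f u \<and> (\<forall>x. u x > 0) \<and> (u \<longlongrightarrow> 0) at_infinity" by blast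
  next
    fix u v assume *: "classical_solution \<rho> f u \<and> (\<forall>x. u x > 0) \<and> (u \<longlongrightarrow> 0) at_infinity"
      "classical_solution \<rho> f v \<and> (\<forall>x. v x > 0) \<and> (v \<longlongrightarrow> 0) at_infinity"
    obtain K where u: "admissible K u" "u = npot (source u)"
      using solution_fixed_point[of u] * by blast
    obtain L where v: "admissible L v" "v = npot (source v)"
      using solution_fixed_point[of v] * by blast
    show "u = v"
      using fixed_point_le[OF u v] fixed_point_le[OF v u] by (auto intro: antisym)
  qed
qed

end
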